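(* Let $(h_{1,n})$ and $(h_{2,n})$ be sequences of complex rational maps of degrees $d_1$ and $d_2$ with $d_1d_2\ge2$, and set $f=h_1\cdot h_2$, $g=h_2\cdot h_1$. Then $\varepsilon_\star(f)=\varepsilon_\star(g)$. Moreover, if $\varepsilon(f)=\varepsilon_\star(f)$ and $\varepsilon(g)=\varepsilon_\star(g)$, then, writing $\varepsilon_\star$ for this common scale, the limits $h_{1,\varepsilon_\star}$ and $h_{2,\varepsilon_\star}$ both have degree at least $1$.
   Context: Fix a non-principal ultrafilter $\omega$ on $\mathbb N$; $\lim$ denotes the limit along $\omega$. A scale is an equivalence class of bounded sequences of positive reals, $(\varepsilon_n)\sim(\eta_n)$ iff $\lim\varepsilon_n/\eta_n\in(0,\infty)$. For a scale $\varepsilon$, $\mathscr H_\varepsilon$ is the quotient of $\{(z_n)\in\mathbb C^{\mathbb N}:\lim|z_n|^{\varepsilon_n}<\infty\}$ by $\{(z_n):\lim|z_n|^{\varepsilon_n}=0\}$ (a complete algebraically closed normed field). For a sequence $(h_n)$ of complex rational maps of degree $d$, write $h_n=[P_n:Q_n]$ with coefficients of maximal modulus $1$; the coefficient sequences define $P_\varepsilon,Q_\varepsilon$ over $\mathscr H_\varepsilon$, and the limit $h_\varepsilon$ is $[P_\varepsilon:Q_\varepsilon]$ after dividing by their gcd (possibly constant). $h_1\cdot h_2=(h_{1,n}\circ h_{2,n})$. For $g=[P:Q]$ of degree $d$ over a normed field $k$, $|\mathrm{Res}(g)|=|\mathrm{Res}(P,Q)|/\max(|\text{coefficients}|)^{2d}$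 and $|\mathrm{res}(g)|=\sup_{M\in\mathrm{PGL}(2,k)}|\mathrm{Res}(MgM^{-1})|$. Let $\theta(s)=-1/\log s$ for $0<s\le1/e$, $\theta(s)=1$ for $s\ge1/e$. $\varepsilon(f)=(\theta(|\mathrm{Res}(f_n)|))$ and $\varepsilon_\star(f)=(\theta(|\mathrm{res}(f_n)|))$ (the fundamental scale). *)

theory Defs
  imports "HOL-Analysis.Analysis" "HOL-Computational_Algebra.Polynomial"
begin

definition nonprincipal_ultrafilter :: "nat filter \<Rightarrow> bool" where
  "nonprincipal_ultrafilter \<omega> \<longleftrightarrow> \<omega> \<noteq> bot \<and>
     (\<forall>P. eventually P \<omega> \<or> eventually (\<lambda>n. \<not> P n) \<omega>) \<and> \<omega> \<le> cofinite"

definition scale_eq :: "nat filter \<Rightarrow> (nat \<Rightarrow> real) \<Rightarrow> (nat \<Rightarrow> real) \<Rightarrow> bool" where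
  "scale_eq \<omega> e h \<longleftrightarrow> (\<exists>c>0. ((\<lambda>n. e n / h n) \<longlongrightarrow> c) \<omega>)"

text \<open>The field H_eps: elements are represented by sequences z with
  lim |z_n|^{eps_n} finite; two representatives are identified iff
  lim |z_n - w_n|^{eps_n} = 0.\<close>
definition H_adm :: "nat filter \<Rightarrow> (nat \<Rightarrow> real) \<Rightarrow> (nat \<Rightarrow> complex) \<Rightarrow> bool" where
  "H_adm \<omega> e z \<longleftrightarrow> (\<exists>C. eventually (\<lambda>n. norm (z n) powr e n \<le> C) \<omega>)"

definition H_eq :: "nat filter \<Rightarrow> (nat \<Rightarrow> real) \<Rightarrow> (nat \<Rightarrow> complex) \<Rightarrow> (nat \<Rightarrow> complex) \<Rightarrow> bool" where
  "H_eq \<omega> e z w \<longleftrightarrow> ((\<lambda>n. norm (z n - w n) powr e n) \<longlongrightarrow> 0) \<omega>"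

text \<open>A rational map [P:Q] of degree d is represented by a pair of complex polynomials
  of degree at most d, read as dehomogenised binary forms of degree d
  (coefficient i = coefficient of X^i Y^(d-i)).\<close>
type_synonym rmap = "complex poly \<times> complex poly"

definition det_fun :: "nat \<Rightarrow> (nat \<Rightarrow> nat \<Rightarrow> complex) \<Rightarrow> complex" where
  "det_fun m A = (\<Sum>p | p permutes {..<m}. of_int (sign p) * (\<Prod>i<m. A i (p i)))"

definition sylvester :: "nat \<Rightarrow> complex poly \<Rightarrow> complex poly \<Rightarrow> nat \<Rightarrow> nat \<Rightarrow> complex" where
  "sylvester d P Q i j =
     (if i < d then (if i \<le> j \<and> j \<le> i + d then coeff P (d - (j - i)) else 0)
      else (if i - d \<le> j \<and> j \<le> i then coeff Q (d - (j - (i - d))) else 0))"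

definition hres :: "nat \<Rightarrow> complex poly \<Rightarrow> complex poly \<Rightarrow> complex" where
  "hres d P Q = det_fun (2 * d) (sylvester d P Q)"

definition is_ratmap :: "nat \<Rightarrow> rmap \<Rightarrow> bool" where
  "is_ratmap d h \<longleftrightarrow> degree (fst h) \<le> d \<and> degree (snd h) \<le> d \<and> hres d (fst h) (snd h) \<noteq> 0"

definition maxcoef :: "nat \<Rightarrow> rmap \<Rightarrow> real" where
  "maxcoef d h = Max ((\<lambda>i. norm (coeff (fst h) i)) ` {..d} \<union> (\<lambda>i. norm (coeff (snd h) i)) ` {..d})"

definition normRes :: "nat \<Rightarrow> rmap \<Rightarrow> real" where
  "normRes d h = norm (hres d (fst h) (snd h)) / maxcoef d h ^ (2 * d)"

definition hsubst :: "nat \<Rightarrow> complex poly \<Rightarrow> complex poly \<Rightarrow> complex poly \<Rightarrow> complex poly" where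
  "hsubst d P A B = (\<Sum>i\<le>d. smult (coeff P i) (A ^ i * B ^ (d - i)))"

definition rcomp :: "nat \<Rightarrow> rmap \<Rightarrow> rmap \<Rightarrow> rmap" where
  "rcomp d1 h1 h2 = (hsubst d1 (fst h1) (fst h2) (snd h2), hsubst d1 (snd h1) (fst h2) (snd h2))"

text \<open>Conjugation M g M^{-1} for M = [[a,b],[c,e]] (using the adjugate for M^{-1}).\<close>
definition conj_map :: "nat \<Rightarrow> complex \<Rightarrow> complex \<Rightarrow> complex \<Rightarrow> complex \<Rightarrow> rmap \<Rightarrow> rmap" where
  "conj_map d a b c e g =
     (let P' = hsubst d (fst g) [:-b, e:] [:a, -c:];
          Q' = hsubst d (snd g) [:-b, e:] [:a, -c:]
      in (smult a P' + smult b Q', smult c P' + smult e Q'))"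

definition minRes :: "nat \<Rightarrow> rmap \<Rightarrow> real" where
  "minRes d g = (SUP M \<in> {(a, b, c, e). a * e - b * c \<noteq> (0::complex)}.
                   normRes d (case M of (a, b, c, e) \<Rightarrow> conj_map d a b c e g))"

definition theta :: "real \<Rightarrow> real" where
  "theta s = (if s \<ge> exp (-1) then 1 else - 1 / ln s)"

definition eps_scale :: "nat \<Rightarrow> (nat \<Rightarrow> rmap) \<Rightarrow> nat \<Rightarrow> real" where
  "eps_scale d f n = theta (normRes d (f n))"

definition eps_star :: "nat \<Rightarrow> (nat \<Rightarrow> rmap) \<Rightarrow> nat \<Rightarrow> real" where
  "eps_star d f n = theta (minRes d (f n))"

definition ncoeff :: "nat \<Rightarrow> (nat \<Rightarrow> rmap) \<Rightarrow> bool \<Rightarrow> nat \<Rightarrow> nat \<Rightarrow> complex" where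
  "ncoeff d h second i n = coeff ((if second then snd else fst) (h n)) i / of_real (maxcoef d (h n))"

definition H_form :: "nat filter \<Rightarrow> (nat \<Rightarrow> real) \<Rightarrow> nat \<Rightarrow> (nat \<Rightarrow> complex poly) \<Rightarrow> bool" where
  "H_form \<omega> ep e G \<longleftrightarrow> (\<forall>n. degree (G n) \<le> e) \<and> (\<forall>i\<le>e. H_adm \<omega> ep (\<lambda>n. coeff (G n) i))"

definition H_nonzero_form :: "nat filter \<Rightarrow> (nat \<Rightarrow> real) \<Rightarrow> nat \<Rightarrow> (nat \<Rightarrow> complex poly) \<Rightarrow> bool" where
  "H_nonzero_form \<omega> ep e G \<longleftrightarrow> H_form \<omega> ep e G \<and> (\<exists>i\<le>e. \<not> H_eq \<omega> ep (\<lambda>n. coeff (G n) i) (\<lambda>_. 0))"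

definition H_divides :: "nat filter \<Rightarrow> (nat \<Rightarrow> real) \<Rightarrow> nat \<Rightarrow> (nat \<Rightarrow> complex poly) \<Rightarrow> nat \<Rightarrow> (nat \<Rightarrow> nat \<Rightarrow> complex) \<Rightarrow> bool" where
  "H_divides \<omega> ep e G d c \<longleftrightarrow> (\<exists>R. H_form \<omega> ep (d - e) R \<and>
      (\<forall>k\<le>d. H_eq \<omega> ep (\<lambda>n. coeff (G n * R n) k) (c k)))"

definition lim_gcd_deg :: "nat filter \<Rightarrow> (nat \<Rightarrow> real) \<Rightarrow> nat \<Rightarrow> (nat \<Rightarrow> rmap) \<Rightarrow> nat" where
  "lim_gcd_deg \<omega> ep d h = Max {e. e \<le> d \<and> (\<exists>G. H_nonzero_form \<omega> ep e G \<and>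
       H_divides \<omega> ep e G d (\<lambda>i. ncoeff d h False i) \<and>
       H_divides \<omega> ep e G d (\<lambda>i. ncoeff d h True i))}"

definition lim_deg :: "nat filter \<Rightarrow> (nat \<Rightarrow> real) \<Rightarrow> nat \<Rightarrow> (nat \<Rightarrow> rmap) \<Rightarrow> nat" where
  "lim_deg \<omega> ep d h = d - lim_gcd_deg \<omega> ep d h"

end

theory Submission
  imports "Jordan_Normal_Form.Determinant" "HOL-Computational_Algebra.Fundamental_Theorem_Algebra" Defs
begin

text \<open>Lifting a rational map of degree \<open>d\<close> to a homogeneous map \<open>H\<close> of \<open>\<complex>\<^sup>2\<close>, its normalised resultant
  is comparable, up to constants and powers depending only on \<open>d\<close>, to the ratio \<open>min |H| / max |H|\<close> on
  the unit sphere; this ratio behaves well under composition. Given \<open>f = h1 \<circ> h2\<close> with resultant at least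
  \<open>r\<close>, put \<open>h2\<close> into a normal form \<open>N \<circ> h2\<close> with well-conditioned coefficient matrix. Then \<open>h1 \<circ> N\<^sup>-\<^sup>1\<close>
  and \<open>N \<circ> h2\<close> both have ratio at least a power of \<open>r\<close>, hence so does
  \<open>N \<circ> h2 \<circ> h1 \<circ> N\<^sup>-\<^sup>1\<close>, a conjugate of \<open>g = h2 \<circ> h1\<close>. Taking logarithms gives the equality of the scales.
  If \<open>g\<close> itself also has resultant at least \<open>r\<close>, then, the degree being at least \<open>2\<close>, \<open>N\<close> has condition
  number at most a power of \<open>1/r\<close>, so some \<open>2 \<times> 2\<close> minor of the coefficients of \<open>h2\<close> is bounded below by
  a power of \<open>r\<close>, which survives in the limit field; a constant limit would make all these minors vanish.\<close>

section \<open>Homogeneous evaluation and the norm of coefficients\<close>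

text \<open>Neither h1 nor h2 is controlled by f alone: f does not change when h1 and h2 are
  replaced by h1 o A^-1 and A o h2, so both factors may degenerate while f stays good. The matrix N
  removes exactly this freedom. It is read off from the coefficients of h2 at a maximal minor;
  linear independence of the two coordinate forms, measured by that minor, already bounds the
  coefficients of h1 o N^-1 by those of f, whatever the resultant of h2 is. Powers and constants may
  be lost at every step, because \<open>theta s\<close> is 1 / max(1, -log s): replacing s by c s^k
  changes it by a bounded factor, and along an ultrafilter a ratio bounded away from 0 and infinity
  has a positive limit. So inequalities of polynomial type, with constants depending on the degrees
  only, are sought, and one direction suffices because the roles of h1 and h2 can be exchanged.
  \<open>minRes\<close> is a supremum over conjugates, so a good conjugate of g is enough for the
  first claim; the second compares g itself with that conjugate.\<close>

definition hev :: "nat \<Rightarrow> complex poly \<Rightarrow> complex \<times> complex \<Rightarrow> complex" where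
  "hev d P w = (\<Sum>i\<le>d. coeff P i * fst w ^ i * snd w ^ (d - i))"

definition hmap :: "nat \<Rightarrow> rmap \<Rightarrow> complex \<times> complex \<Rightarrow> complex \<times> complex" where
  "hmap d h w = (hev d (fst h) w, hev d (snd h) w)"

text \<open>The l1 norm of the coefficients: it is submultiplicative and independent of the formal
  degree assigned to the form.\<close>

definition pnorm :: "complex poly \<Rightarrow> real" where
  "pnorm P = (\<Sum>i\<le>degree P. cmod (coeff P i))"

lemma pnorm_eq: "degree P \<le> d \<Longrightarrow> pnorm P = (\<Sum>i\<le>d. cmod (coeff P i))"
  unfolding pnorm_def by (rule sum.mono_neutral_left) (auto simp: coeff_eq_0)

lemma pnorm_nonneg [simp]: "0 \<le> pnorm P"
  unfolding pnorm_def by (simp add: sum_nonneg)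

lemma coeff_le_pnorm: "cmod (coeff P i) \<le> pnorm P"
proof (cases "i \<le> degree P")
  case True
  then show ?thesis unfolding pnorm_def
    by (intro member_le_sum) auto
next
  case False
  then show ?thesis by (simp add: coeff_eq_0)
qed

lemma pnorm_0 [simp]: "pnorm 0 = 0"
  by (simp add: pnorm_def)

lemma pnorm_add: "pnorm (P + Q) \<le> pnorm P + pnorm Q"
proof -
  define d where "d = max (degree P) (degree Q)"
  have "pnorm (P + Q) = (\<Sum>i\<le>d. cmod (coeff P i + coeff Q i))"
    by (subst pnorm_eq[of _ d]) (auto simp: d_def intro: degree_add_le_max)
  also have "\<dots> \<le> (\<Sum>i\<le>d. cmod (coeff P i) + cmod (coeff Q i))"
    by (intro sum_mono norm_triangle_ineq)
  also have "\<dots> = pnorm P + pnorm Q"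
    by (simp add: sum.distrib pnorm_eq[of P d] pnorm_eq[of Q d] d_def)
  finally show ?thesis .
qed

lemma pnorm_smult [simp]: "pnorm (smult c P) = cmod c * pnorm P"
  by (cases "c = 0") (auto simp: pnorm_def norm_mult sum_distrib_left)

lemma pnorm_minus [simp]: "pnorm (- P) = pnorm P"
  by (simp add: pnorm_def)

lemma pnorm_diff: "pnorm (P - Q) \<le> pnorm P + pnorm Q"
  using pnorm_add[of P "- Q"] by simp

lemma pnorm_pCons: "pnorm (pCons a P) = cmod a + pnorm P"
  by (subst pnorm_eq[of _ "Suc (degree P)"])
    (auto simp: degree_pCons_le sum.atMost_Suc_shift pnorm_def simp del: sum.atMost_Suc)

lemma pnorm_mult: "pnorm (P * Q) \<le> pnorm P * pnorm Q"
proof (induction P)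
  case (pCons a P)
  have "pnorm (pCons a P * Q) \<le> pnorm (smult a Q) + pnorm (pCons 0 (P * Q))"
    by (simp only: mult_pCons_left pnorm_add)
  also have "\<dots> \<le> cmod a * pnorm Q + pnorm P * pnorm Q"
    using pCons by (simp add: pnorm_pCons)
  finally show ?case by (simp add: pnorm_pCons algebra_simps)
qed auto

lemma pnorm_1 [simp]: "pnorm 1 = 1"
  by (simp add: pnorm_def)

lemma pnorm_power: "pnorm (P ^ n) \<le> pnorm P ^ n"
proof (induction n)
  case (Suc n)
  have "pnorm (P ^ Suc n) \<le> pnorm P * pnorm (P ^ n)"
    using pnorm_mult[of P "P ^ n"] by simp
  also have "\<dots> \<le> pnorm P * pnorm P ^ n"
    by (intro mult_left_mono Suc) auto
  finally show ?case by simp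
qed auto

lemma pnorm_monom [simp]: "pnorm (monom c n) = cmod c"
proof -
  have "pnorm (monom c n) = (\<Sum>i\<le>n. if i = n then cmod c else 0)"
    by (subst pnorm_eq[of _ n]) (auto simp: degree_monom_le if_distrib[of cmod] cong: if_cong)
  then show ?thesis by simp
qed

section \<open>Evaluation of binary forms: algebra and growth\<close>

lemma hev_0 [simp]: "hev d 0 w = 0"
  by (simp add: hev_def)

lemma hev_add: "hev d (P + Q) w = hev d P w + hev d Q w"
  by (simp add: hev_def sum.distrib algebra_simps)

lemma hev_smult: "hev d (smult c P) w = c * hev d P w"
  by (simp add: hev_def sum_distrib_left algebra_simps)

lemma hev_diff: "hev d (P - Q) w = hev d P w - hev d Q w"
  by (simp add: hev_def sum_subtractf algebra_simps)

lemma hev_sum: "hev d (\<Sum>i\<in>A. f i) w = (\<Sum>i\<in>A. hev d (f i) w)"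
  by (induction A rule: infinite_finite_induct) (auto simp: hev_add)

lemma hev_scale: "hev d P (c * u, c * v) = c ^ d * hev d P (u, v)"
proof -
  have "c ^ i * c ^ (d - i) = c ^ d" if "i \<le> d" for i
    using that by (simp flip: power_add)
  then show ?thesis
    unfolding hev_def sum_distrib_left
    by (intro sum.cong) (auto simp: power_mult_distrib algebra_simps)
qed

lemma poly_eq_hev: "degree P \<le> d \<Longrightarrow> poly P z = hev d P (z, 1)"
  unfolding hev_def poly_altdef
  by (simp, rule sum.mono_neutral_left) (auto simp: coeff_eq_0)

lemma hev_at_infinity: "hev d P (u, 0) = coeff P d * u ^ d"
proof -
  have "hev d P (u, 0) = (\<Sum>i\<le>d. if i = d then coeff P d * u ^ d else 0)"
    unfolding hev_def by (intro sum.cong) auto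
  then show ?thesis by simp
qed

lemma hev_affine: "degree P \<le> d \<Longrightarrow> v \<noteq> 0 \<Longrightarrow> hev d P (u, v) = v ^ d * poly P (u / v)"
  using hev_scale[of d P v "u / v" 1] by (simp add: poly_eq_hev)

lemma hev_eqI:
  assumes "degree P \<le> d" "degree Q \<le> d" "\<And>w. hev d P w = hev d Q w"
  shows "P = Q"
proof -
  have "poly P = poly Q" using assms by (simp add: poly_eq_hev fun_eq_iff)
  then show ?thesis by (simp add: poly_eq_poly_eq_iff)
qed

lemma coeff_mult_top:
  assumes "degree (P :: complex poly) \<le> d" "degree Q \<le> e"
  shows "coeff (P * Q) (d + e) = coeff P d * coeff Q e"
proof -
  have "coeff (P * Q) (d + e) = (\<Sum>i\<le>d + e. coeff P i * coeff Q (d + e - i))"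
    by (rule coeff_mult)
  also have "\<dots> = (\<Sum>i\<le>d + e. if i = d then coeff P d * coeff Q e else 0)"
  proof (intro sum.cong refl)
    fix i
    show "coeff P i * coeff Q (d + e - i) = (if i = d then coeff P d * coeff Q e else 0)"
    proof (cases "i < d")
      case True
      then have "degree Q < d + e - i" using assms by simp
      then show ?thesis using True by (simp add: coeff_eq_0)
    next
      case False
      then show ?thesis using assms by (cases "i = d") (auto simp: coeff_eq_0)
    qed
  qed
  finally show ?thesis by simp
qed

text \<open>For v nonzero this is multiplicativity of \<open>poly\<close> after scaling by v; on the
  line v = 0 only the coefficients of top formal degree survive.\<close>

lemma hev_mult:
  assumes "degree P \<le> d" "degree Q \<le> e"
  shows "hev (d + e) (P * Q) w = hev d P w * hev e Q w"
proof (cases w)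
  case (Pair u v)
  have "degree (P * Q) \<le> d + e" using degree_mult_le[of P Q] assms by simp
  then show ?thesis using assms
    by (cases "v = 0")
      (simp_all add: Pair hev_at_infinity coeff_mult_top hev_affine power_add)
qed

lemma hev_power:
  assumes "degree P \<le> k"
  shows "hev (k * n) (P ^ n) w = hev k P w ^ n"
proof (induction n)
  case 0
  then show ?case by (simp add: hev_def)
next
  case (Suc n)
  have "degree (P ^ n) \<le> k * n"
    using degree_power_le[of P n] assms by (meson le_trans mult_le_mono1)
  then show ?case using Suc hev_mult[OF assms, of "P ^ n" "k * n" w] by simp
qed

lemma degree_hsubst:
  assumes "degree A \<le> k" "degree B \<le> k"
  shows "degree (hsubst d P A B) \<le> d * k"
  unfolding hsubst_def
proof (intro degree_sum_le finite_atMost)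
  fix i assume "i \<in> {..d}"
  have "degree (A ^ i * B ^ (d - i)) \<le> degree (A ^ i) + degree (B ^ (d - i))"
    by (rule degree_mult_le)
  also have "\<dots> \<le> degree A * i + degree B * (d - i)"
    by (intro add_mono degree_power_le)
  also have "\<dots> \<le> k * i + k * (d - i)"
    using assms by (intro add_mono mult_right_mono) auto
  also have "\<dots> = d * k" using \<open>i \<in> {..d}\<close> by (simp flip: distrib_left)
  finally show "degree (smult (coeff P i) (A ^ i * B ^ (d - i))) \<le> d * k"
    using degree_smult_le le_trans by blast
qed

lemma hev_hsubst:
  assumes "degree A \<le> k" "degree B \<le> k"
  shows "hev (d * k) (hsubst d P A B) w = hev d P (hev k A w, hev k B w)"
proof -
  have "hev (d * k) (A ^ i * B ^ (d - i)) w = hev k A w ^ i * hev k B w ^ (d - i)"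
    if "i \<le> d" for i
  proof -
    have "degree (A ^ i) \<le> k * i" "degree (B ^ (d - i)) \<le> k * (d - i)"
      using degree_power_le[of A i] degree_power_le[of B "d - i"] assms
      by (meson le_trans mult_le_mono1)+
    from hev_mult[OF this] show ?thesis using that assms
      by (simp add: hev_power flip: distrib_left) (simp add: mult.commute)
  qed
  then show ?thesis
    unfolding hsubst_def hev_def[of d P]
    by (simp add: hev_sum hev_smult mult.assoc)
qed

lemma norm_hev_le:
  assumes "degree P \<le> d"
  shows "cmod (hev d P w) \<le> pnorm P * norm w ^ d"
proof -
  have "cmod (hev d P w) \<le> (\<Sum>i\<le>d. cmod (coeff P i * fst w ^ i * snd w ^ (d - i)))"
    unfolding hev_def by (rule norm_sum)
  also have "\<dots> \<le> (\<Sum>i\<le>d. cmod (coeff P i) * norm w ^ d)"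
  proof (intro sum_mono)
    fix i assume "i \<in> {..d}"
    have "cmod (fst w) ^ i * cmod (snd w) ^ (d - i) \<le> norm w ^ i * norm w ^ (d - i)"
      using norm_fst_le[of "fst w" "snd w"] norm_snd_le[of "snd w" "fst w"]
      by (intro mult_mono power_mono) auto
    also have "\<dots> = norm w ^ d" using \<open>i \<in> {..d}\<close> by (simp flip: power_add)
    finally show "cmod (coeff P i * fst w ^ i * snd w ^ (d - i)) \<le> cmod (coeff P i) * norm w ^ d"
      by (simp add: norm_mult norm_power mult.assoc mult_left_mono)
  qed
  also have "\<dots> = pnorm P * norm w ^ d"
    using assms by (simp add: pnorm_eq sum_distrib_right)
  finally show ?thesis .
qed

section \<open>Zeros, linear factors and coefficient bounds\<close>

text \<open>If the coefficient of formal top degree vanishes, (1, 0) is a zero; otherwise the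
  fundamental theorem of algebra gives an affine one. Homogeneity moves it to the unit
  sphere.\<close>

lemma hev_zero_exists:
  assumes "degree P \<le> d" "1 \<le> d"
  shows "\<exists>u v. cmod u ^ 2 + cmod v ^ 2 = 1 \<and> hev d P (u, v) = 0"
proof -
  have "\<exists>w. w \<noteq> 0 \<and> hev d P w = 0"
  proof (cases "coeff P d = 0")
    case True
    then have "hev d P (1, 0) = 0" by (simp add: hev_at_infinity)
    then show ?thesis by (intro exI[of _ "(1, 0)"]) (simp add: zero_prod_def)
  next
    case False
    then have "degree P = d" using assms by (simp add: le_antisym le_degree)
    then have "\<not> constant (poly P)" using assms by (simp add: constant_degree)
    then obtain z where "poly P z = 0" using fundamental_theorem_of_algebra by blast
    then have "hev d P (z, 1) = 0" using assms by (simp add: poly_eq_hev)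
    then show ?thesis by (intro exI[of _ "(z, 1)"]) (simp add: zero_prod_def)
  qed
  then obtain u v where w: "(u, v) \<noteq> 0" "hev d P (u, v) = 0" by (metis prod.collapse)
  define c where "c = complex_of_real (1 / norm (u, v))"
  have "norm (u, v) ^ 2 = cmod u ^ 2 + cmod v ^ 2"
    by (simp add: norm_Pair)
  moreover have "norm (u, v) ^ 2 > 0" using w by simp
  moreover have "cmod c ^ 2 = 1 / norm (u, v) ^ 2"
    by (simp add: c_def norm_divide power_divide)
  ultimately have "cmod c ^ 2 * (cmod u ^ 2 + cmod v ^ 2) = 1"
    by (metis nonzero_eq_divide_eq less_irrefl)
  then have "cmod (c * u) ^ 2 + cmod (c * v) ^ 2 = 1"
    by (simp add: norm_mult power_mult_distrib distrib_left)
  moreover have "hev d P (c * u, c * v) = 0" using w by (simp add: hev_scale)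
  ultimately show ?thesis by blast
qed

lemma pnorm_linear: "pnorm [:- u, v:] = cmod u + cmod v"
  by (simp add: pnorm_pCons)

text \<open>The coefficients b_k of \<open>B\<close> are recovered from those of the product by the
  recursion c_(k+1) = v b_k - u b_(k+1). It is solved from the top downwards if |u| <= |v| and from
  the bottom upwards otherwise, so that one always divides by the larger of the two and errors are
  never amplified.\<close>

lemma pnorm_linear_mult:
  assumes "degree B \<le> D"
  shows "pnorm [:- u, v:] * pnorm B \<le> 2 * real (Suc D) * pnorm ([:- u, v:] * B)"
proof -
  define C where "C = [:- u, v:] * B"
  have C0: "coeff C 0 = - u * coeff B 0" and CS: "coeff C (Suc k) = v * coeff B k - u * coeff B (Suc k)" for k
    by (simp_all add: C_def coeff_pCons)
  define M where "M = max (cmod u) (cmod v)"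
  have main: "M * cmod (coeff B k) \<le> pnorm C" for k
  proof (cases "cmod u \<le> cmod v")
    case True
    then have M: "M = cmod v" by (simp add: M_def)
    \<comment> \<open>Beyond this index the coefficients of both \<open>B\<close> and
      \<open>C\<close> vanish, which makes the start of the downward induction trivial.\<close>
    define E where "E = degree C + degree B"
    have pn: "pnorm C = (\<Sum>i\<le>E. cmod (coeff C i))" unfolding E_def by (rule pnorm_eq) simp
    have "M * cmod (coeff B k) \<le> (\<Sum>i\<in>{k<..E}. cmod (coeff C i))" if "k \<le> E"
      using that
    proof (induction k rule: inc_induct)
      case base
      have "coeff B E = 0 \<or> coeff C (Suc E) = 0" by (simp add: E_def coeff_eq_0)
      then show ?case
        using CS[of E] M by (auto simp: E_def coeff_eq_0)
    next
      case (step k)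
      have "v * coeff B k = coeff C (Suc k) + u * coeff B (Suc k)" using CS[of k] by simp
      then have "M * cmod (coeff B k) \<le> cmod (coeff C (Suc k)) + cmod u * cmod (coeff B (Suc k))"
        unfolding M using norm_triangle_ineq[of "coeff C (Suc k)" "u * coeff B (Suc k)"]
        by (metis norm_mult)
      also have "cmod u * cmod (coeff B (Suc k)) \<le> M * cmod (coeff B (Suc k))"
        by (intro mult_right_mono) (auto simp: M_def)
      also have "M * cmod (coeff B (Suc k)) \<le> (\<Sum>i\<in>{Suc k<..E}. cmod (coeff C i))" by (rule step.IH)
      also have "cmod (coeff C (Suc k)) + (\<Sum>i\<in>{Suc k<..E}. cmod (coeff C i)) = (\<Sum>i\<in>{k<..E}. cmod (coeff C i))"
      proof -
        have "{k<..E} = insert (Suc k) {Suc k<..E}" using step by auto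
        then show ?thesis by simp
      qed
      finally show ?case by simp
    qed
    moreover have "(\<Sum>i\<in>{k<..E}. cmod (coeff C i)) \<le> pnorm C"
      unfolding pn by (intro sum_mono2) auto
    ultimately show ?thesis
      by (cases "k \<le> E") (auto simp: coeff_eq_0 E_def intro: order_trans)
  next
    case False
    then have M: "M = cmod u" by (simp add: M_def)
    have "M * cmod (coeff B k) \<le> (\<Sum>i\<le>k. cmod (coeff C i))"
    proof (induction k)
      case 0
      then show ?case by (simp add: C0 M norm_mult)
    next
      case (Suc k)
      have "u * coeff B (Suc k) = v * coeff B k - coeff C (Suc k)" using CS[of k] by simp
      then have "M * cmod (coeff B (Suc k)) \<le> cmod v * cmod (coeff B k) + cmod (coeff C (Suc k))"
        unfolding M using norm_triangle_ineq4[of "v * coeff B k" "coeff C (Suc k)"]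
        by (metis norm_mult)
      also have "cmod v * cmod (coeff B k) \<le> M * cmod (coeff B k)"
        by (intro mult_right_mono) (auto simp: M_def)
      finally show ?case using Suc by simp
    qed
    also have "\<dots> \<le> (\<Sum>i\<le>degree C + k. cmod (coeff C i))" by (intro sum_mono2) auto
    also have "\<dots> = pnorm C" by (rule pnorm_eq [symmetric]) simp
    finally show ?thesis .
  qed
  have "pnorm [:- u, v:] * pnorm B \<le> (2 * M) * pnorm B"
    unfolding pnorm_linear by (intro mult_right_mono) (auto simp: M_def)
  also have "\<dots> = 2 * (\<Sum>i\<le>D. M * cmod (coeff B i))"
    using assms by (simp add: pnorm_eq sum_distrib_left mult.assoc)
  also have "\<dots> \<le> 2 * (\<Sum>i\<le>D. pnorm C)"
    by (intro mult_left_mono sum_mono main) auto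
  also have "\<dots> = 2 * real (Suc D) * pnorm C" by simp
  finally show ?thesis unfolding C_def .
qed

text \<open>A zero at infinity is a drop of the degree, and there the linear factor is the constant
  -u. The clause for d = 0 repairs the truncated subtraction d - 1: a form of degree 0 with a zero
  is 0.\<close>

lemma hev_zero_factor:
  assumes F: "degree F \<le> d" and z: "hev d F (u, v) = 0" and w: "(u, v) \<noteq> 0"
  obtains G where "F = [:- u, v:] * G" "degree G \<le> d - 1" "d = 0 \<longrightarrow> G = 0"
proof (cases "v = 0")
  case True
  then have u: "u \<noteq> 0" using w by (auto simp: zero_prod_def)
  have "coeff F d = 0" using z u True by (simp add: hev_at_infinity)
  define G where "G = smult (- inverse u) F"
  have "F = [:- u, v:] * G" using True u by (simp add: G_def)
  moreover have "degree G \<le> d - 1" using F \<open>coeff F d = 0\<close>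
    by (cases "degree F = d") (auto simp: G_def intro: order_trans[OF degree_smult_le])
  moreover have "d = 0 \<longrightarrow> G = 0" using F \<open>coeff F d = 0\<close>
    by (metis G_def leading_coeff_0_iff le_zero_eq smult_0_right)
  ultimately show ?thesis using that by blast
next
  case False
  have "poly F (u / v) = 0" using z F False by (simp add: hev_affine)
  then obtain H where H: "F = [:- (u / v), 1:] * H" by (metis dvdE poly_eq_0_iff_dvd)
  define G where "G = smult (inverse v) H"
  have "F = [:- u, v:] * G" using False H by (simp add: G_def field_simps)
  moreover have "degree G \<le> d - 1 \<and> (d = 0 \<longrightarrow> G = 0)"
  proof (cases "G = 0")
    case False
    then have "degree F = Suc (degree G)"
      using \<open>F = [:- u, v:] * G\<close> \<open>v \<noteq> 0\<close> by (simp add: degree_mult_eq del: mult_pCons_left)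
    then show ?thesis using F by simp
  qed auto
  ultimately show ?thesis using that by blast
qed

text \<open>Passing to P(z) - 2^(d+1) P(z/2) multiplies the k-th coefficient by 1 - 2^(d+1-k): this
  kills the top coefficient and has modulus at least 1 for all lower ones, so the induction
  hypothesis bounds these. The top coefficient is then P(1) minus the sum of the others.\<close>

lemma coeff_le_sup:
  "\<exists>C>0. \<forall>P b. degree P \<le> d \<longrightarrow> (\<forall>z. cmod z \<le> 1 \<longrightarrow> cmod (poly P z) \<le> b) \<longrightarrow>
     (\<forall>i. cmod (coeff P i) \<le> C * b)"
proof (induction d)
  case 0
  show ?case
  proof (intro exI[of _ 1] conjI allI impI)
    fix P :: "complex poly" and b i
    assume P: "degree P \<le> 0" "\<forall>z. cmod z \<le> 1 \<longrightarrow> cmod (poly P z) \<le> b"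
    obtain c where c: "P = [:c:]" using degree_eq_zeroE[of P] P(1) by auto
    have "0 \<le> b" using order_trans[OF norm_ge_zero P(2)[rule_format, of 0]] by simp
    then show "cmod (coeff P i) \<le> 1 * b"
      using P(2)[rule_format, of 0] c by (auto simp: coeff_pCons split: nat.splits)
  qed auto
next
  case (Suc d)
  then obtain C where C: "C > 0" and IH: "\<And>P b i. degree P \<le> d \<Longrightarrow>
    (\<And>z. cmod z \<le> 1 \<Longrightarrow> cmod (poly P z) \<le> b) \<Longrightarrow> cmod (coeff P i) \<le> C * b" by blast
  define K where "K = C * (1 + 2 ^ Suc d)"
  have K: "K > 0" using C by (simp add: K_def add_pos_nonneg)
  show ?case
  proof (intro exI[of _ "1 + real (Suc d) * K"] conjI allI impI)
    fix P :: "complex poly" and b i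
    assume P: "degree P \<le> Suc d" and b: "\<forall>z. cmod z \<le> 1 \<longrightarrow> cmod (poly P z) \<le> b"
    have b0: "0 \<le> b" using order_trans[OF norm_ge_zero b[rule_format, of 0]] by simp
    \<comment> \<open>\<open>P(z) - 2^(d+1) P(z/2)\<close> has lower degree and is still bounded on the unit disc\<close>
    define T where "T = P - smult (2 ^ Suc d) (pcompose P [:0, 1/2:])"
    have cT: "coeff T k = (1 - 2 ^ Suc d / 2 ^ k) * coeff P k" for k
      unfolding T_def by (simp add: coeff_pcompose_linear algebra_simps power_divide)
    have "degree T \<le> d"
    proof (rule degree_le, intro allI impI)
      fix k assume "d < k"
      then show "coeff T k = 0" using P unfolding cT by (cases "k = Suc d") (auto simp: coeff_eq_0)
    qed
    moreover have "cmod (poly T z) \<le> (1 + 2 ^ Suc d) * b" if "cmod z \<le> 1" for z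
    proof -
      have "poly T z = poly P z - 2 ^ Suc d * poly P (z / 2)"
        by (simp add: T_def poly_pcompose)
      then have "cmod (poly T z) \<le> cmod (poly P z) + cmod (2 ^ Suc d * poly P (z / 2))"
        by (simp only: norm_triangle_ineq4)
      also have "\<dots> = cmod (poly P z) + 2 ^ Suc d * cmod (poly P (z / 2))"
        by (simp add: norm_mult norm_power)
      also have "\<dots> \<le> b + 2 ^ Suc d * b"
        using b that by (intro add_mono mult_left_mono) (auto simp: norm_divide)
      finally show ?thesis by (simp add: algebra_simps)
    qed
    ultimately have T: "cmod (coeff T k) \<le> K * b" for k
      using IH[of T "(1 + 2 ^ Suc d) * b" k] by (simp add: K_def mult.assoc)
    have low: "cmod (coeff P k) \<le> K * b" if "k \<le> d" for k
    proof -
      have "(2::real) ^ Suc d / 2 ^ k = 2 ^ (Suc d - k)"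
        using that by (simp add: power_diff)
      moreover have "(2::real) ^ 1 \<le> 2 ^ (Suc d - k)" using that by (intro power_increasing) auto
      ultimately have "1 \<le> \<bar>1 - (2::real) ^ Suc d / 2 ^ k\<bar>" by simp
      also have "\<dots> = cmod (of_real (1 - 2 ^ Suc d / 2 ^ k))"
        by (rule norm_of_real [symmetric])
      also have "\<dots> = cmod (1 - 2 ^ Suc d / 2 ^ k)" by simp
      finally have "1 * cmod (coeff P k) \<le> cmod (coeff T k)"
        unfolding cT norm_mult by (intro mult_right_mono) auto
      then show ?thesis using T[of k] by simp
    qed
    have "poly P 1 = (\<Sum>k\<le>Suc d. coeff P k)"
      using P by (simp add: poly_eq_hev hev_def del: sum.atMost_Suc)
    then have "coeff P (Suc d) = poly P 1 - (\<Sum>k\<le>d. coeff P k)" by simp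
    then have "cmod (coeff P (Suc d)) \<le> cmod (poly P 1) + cmod (\<Sum>k\<le>d. coeff P k)"
      by (simp only: norm_triangle_ineq4)
    also have "\<dots> \<le> b + (\<Sum>k\<le>d. K * b)"
      using b low by (intro add_mono order_trans[OF norm_sum] sum_mono) auto
    finally have top: "cmod (coeff P (Suc d)) \<le> (1 + real (Suc d) * K) * b"
      by (simp add: algebra_simps)
    have "0 \<le> K * b" using K b0 by simp
    have "K * b \<le> (1 + real (Suc d) * K) * b"
      using K b0 by (intro mult_right_mono) (auto simp: algebra_simps)
    consider "i \<le> d" | "i = Suc d" | "i > Suc d" by linarith
    then show "cmod (coeff P i) \<le> (1 + real (Suc d) * K) * b"
    proof cases
      case 1
      then show ?thesis using low \<open>K * b \<le> _\<close> order_trans by blast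
    next
      case 2
      then show ?thesis using top by simp
    next
      case 3
      then show ?thesis using P \<open>0 \<le> K * b\<close> \<open>K * b \<le> _\<close> by (simp add: coeff_eq_0)
    qed
  qed (use K in \<open>simp add: add_pos_nonneg\<close>)
qed

section \<open>Effective Bezout identity and the resultant\<close>

text \<open>Split off a linear factor \<open>L\<close> of \<open>P = L P2\<close> with zero \<open>v\<close>. Evaluating \<open>A P + B Q\<close> at \<open>v\<close> bounds \<open>B(v)\<close>,
  and subtracting \<open>B(v) M\<^sup>e\<close> from \<open>B\<close>, where \<open>M\<close> is the linear form with \<open>M(v) = 1\<close> given by the inner
  product with \<open>v\<close>, leaves a multiple \<open>L B1\<close>; the induction proceeds with \<open>A P2 + B1 Q\<close>.\<close>
lemma bezout_bound_aux:
  fixes D :: nat and K0 :: real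
  assumes K0: "0 \<le> K0"
  shows "\<exists>K>0. \<forall>P Q A B a. degree P \<le> e \<longrightarrow> degree Q \<le> Suc D \<longrightarrow> pnorm Q \<le> K0 \<longrightarrow>
      0 < a \<longrightarrow> a \<le> 1 \<longrightarrow>
      (\<forall>u v. cmod u ^ 2 + cmod v ^ 2 = 1 \<longrightarrow> hev e P (u, v) = 0 \<longrightarrow> a \<le> cmod (hev (Suc D) Q (u, v))) \<longrightarrow>
      degree A \<le> D \<longrightarrow> degree B \<le> e - 1 \<longrightarrow> (e = 0 \<longrightarrow> B = 0) \<longrightarrow>
      pnorm A * pnorm P + pnorm B \<le> K / a ^ e * pnorm (A * P + B * Q)"
proof (induction e)
  case 0
  show ?case
  proof (intro exI[of _ 1] conjI allI impI)
    fix P Q A B :: "complex poly" and a :: real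
    assume "degree P \<le> 0" "0 = (0::nat) \<longrightarrow> B = 0"
    then obtain p where "P = [:p:]" "B = 0" using degree_eq_zeroE[of P] by auto
    then show "pnorm A * pnorm P + pnorm B \<le> 1 / a ^ 0 * pnorm (A * P + B * Q)"
      by (simp add: pnorm_pCons mult.commute)
  qed auto
next
  case (Suc e)
  then obtain K where K: "K > 0" and IH: "\<And>P Q A B a. \<lbrakk>degree P \<le> e; degree Q \<le> Suc D; pnorm Q \<le> K0;
      0 < a; a \<le> 1;
      \<And>u v. cmod u ^ 2 + cmod v ^ 2 = 1 \<Longrightarrow> hev e P (u, v) = 0 \<Longrightarrow> a \<le> cmod (hev (Suc D) Q (u, v));
      degree A \<le> D; degree B \<le> e - 1; e = 0 \<longrightarrow> B = 0\<rbrakk> \<Longrightarrow>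
      pnorm A * pnorm P + pnorm B \<le> K / a ^ e * pnorm (A * P + B * Q)"
    by blast
  \<comment> \<open>\<open>T\<close> bounds |L S| in units of |R|/a: 1 from R itself and 2^e K0 from
    the correction by M^e Q. \<open>W\<close> is the loss in dividing by L a form of degree at most
    D + e. In \<open>K'\<close> the factor 2 comes from |L| <= 2, and 2^e is the cost of the removed
    multiple of M^e.\<close>
  define T where "T = 1 + 2 ^ e * K0"
  define W where "W = 2 * real (Suc (D + e))"
  define K' where "K' = 2 * K * W * T + 2 ^ e"
  have T: "T > 0" and W: "W > 0" using K0 by (auto simp: T_def W_def add_pos_nonneg)
  show ?case
  proof (intro exI[of _ K'] conjI allI impI)
    show "K' > 0" using K T W by (simp add: K'_def add_pos_pos)
    fix P Q A B :: "complex poly" and a :: real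
    assume P: "degree P \<le> Suc e" and Q: "degree Q \<le> Suc D" "pnorm Q \<le> K0" and a: "0 < a" "a \<le> 1"
      and zeros: "\<forall>u v. cmod u ^ 2 + cmod v ^ 2 = 1 \<longrightarrow> hev (Suc e) P (u, v) = 0 \<longrightarrow> a \<le> cmod (hev (Suc D) Q (u, v))"
      and A: "degree A \<le> D" and B: "degree B \<le> Suc e - 1"
    obtain u v where uv: "cmod u ^ 2 + cmod v ^ 2 = 1" and P0: "hev (Suc e) P (u, v) = 0"
      using hev_zero_exists[OF P] by auto
    have nz: "(u, v) \<noteq> 0" using uv by (auto simp: zero_prod_def)
    have uv1: "norm (u, v) = 1" using uv by (simp add: norm_Pair)
    have "1 \<le> cmod u + cmod v" using norm_Pair_le[of u v] uv1 by simp
    have "cmod u \<le> 1" "cmod v \<le> 1" using uv1 norm_fst_le[of u v] norm_snd_le[of v u] by auto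
    define L where "L = [:- u, v:]"
    define M where "M = [:cnj v, cnj u:]"
    obtain P2 where P2: "P = L * P2" "degree P2 \<le> e"
      using hev_zero_factor[OF P P0 nz] unfolding L_def by force
    have Ldeg: "degree L \<le> 1" by (simp add: L_def)
    have nL: "1 \<le> pnorm L" "pnorm L \<le> 2" unfolding L_def pnorm_linear
      using \<open>1 \<le> _\<close> \<open>cmod u \<le> 1\<close> \<open>cmod v \<le> 1\<close> by auto
    have nM: "pnorm M \<le> 2" unfolding M_def
      using \<open>cmod u \<le> 1\<close> \<open>cmod v \<le> 1\<close> by (simp add: pnorm_pCons)
    have Mdeg: "degree M \<le> 1" by (simp add: M_def)
    have M1: "hev 1 M (u, v) = 1"
    proof -
      have "hev 1 M (u, v) = cnj v * v + cnj u * u" by (simp add: hev_def M_def)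
      also have "\<dots> = of_real (cmod v ^ 2 + cmod u ^ 2)"
        by (simp only: of_real_add complex_norm_square mult.commute)
      finally show ?thesis using uv by (simp add: add.commute)
    qed
    have nMe: "pnorm (M ^ e) \<le> 2 ^ e"
      using pnorm_power[of M e] power_mono[OF nM, of e] by simp
    have Me1: "hev e (M ^ e) (u, v) = 1" using hev_power[OF Mdeg, of e "(u, v)"] M1 by simp
    have Medeg: "degree (M ^ e) \<le> e"
      using degree_power_le[of M e] mult_le_mono1[OF Mdeg, of e] by linarith
    define \<beta> where "\<beta> = hev e B (u, v)"
    have "degree (B - smult \<beta> (M ^ e)) \<le> e"
      using B Medeg by (intro degree_diff_le) (auto intro: order_trans[OF degree_smult_le])
    moreover have "hev e (B - smult \<beta> (M ^ e)) (u, v) = 0"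
      by (simp add: hev_diff hev_smult Me1 \<beta>_def)
    ultimately obtain B1 where B1: "B - smult \<beta> (M ^ e) = L * B1" "degree B1 \<le> e - 1" "e = 0 \<longrightarrow> B1 = 0"
      unfolding L_def by (rule hev_zero_factor[OF _ _ nz])
    define R where "R = A * P + B * Q"
    have "degree (A * P) \<le> e + Suc D" "degree (B * Q) \<le> e + Suc D"
      using degree_mult_le[of A P] degree_mult_le[of B Q] A P B Q by auto
    then have Rdeg: "degree R \<le> e + Suc D" unfolding R_def by (rule degree_add_le)
    have "hev (e + Suc D) R (u, v) = \<beta> * hev (Suc D) Q (u, v)"
    proof -
      have "hev (D + Suc e) (A * P) (u, v) = 0"
        using hev_mult[OF A P, of "(u, v)"] P0 by simp
      moreover have "hev (e + Suc D) (B * Q) (u, v) = \<beta> * hev (Suc D) Q (u, v)"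
        using hev_mult[of B e Q "Suc D" "(u, v)"] B Q by (simp add: \<beta>_def)
      ultimately show ?thesis by (simp add: R_def hev_add add.commute)
    qed
    then have "cmod \<beta> * cmod (hev (Suc D) Q (u, v)) \<le> pnorm R"
      using norm_hev_le[OF Rdeg, of "(u, v)"] uv1 by (simp add: norm_mult)
    moreover have "a \<le> cmod (hev (Suc D) Q (u, v))" using zeros uv P0 by blast
    then have "cmod \<beta> * a \<le> cmod \<beta> * cmod (hev (Suc D) Q (u, v))" by (rule mult_left_mono) auto
    ultimately have "cmod \<beta> * a \<le> pnorm R" by linarith
    then have beta: "cmod \<beta> \<le> pnorm R / a" using a by (simp add: pos_le_divide_eq)
    define S where "S = A * P2 + B1 * Q"
    have LS: "L * S = R - smult \<beta> (M ^ e * Q)"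
    proof -
      have "L * S = A * P + (L * B1) * Q" unfolding S_def P2 by (simp add: algebra_simps)
      also have "L * B1 = B - smult \<beta> (M ^ e)" using B1 by simp
      finally show ?thesis by (simp add: R_def algebra_simps)
    qed
    have "degree (A * P2) \<le> D + e" using degree_mult_le[of A P2] A P2 by simp
    \<comment> \<open>For e = 0 the bound on the degree of \<open>B1\<close> alone would give Suc D
      here; \<open>B1 = 0\<close> closes this case.\<close>
    moreover have "degree (B1 * Q) \<le> D + e"
      using degree_mult_le[of B1 Q] B1 Q by (cases "e = 0") auto
    ultimately have Sdeg: "degree S \<le> D + e" unfolding S_def by (rule degree_add_le)
    have Ra: "pnorm R \<le> pnorm R / a" using a by (simp add: pos_le_divide_eq mult_left_le)
    have "pnorm (M ^ e * Q) \<le> 2 ^ e * K0"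
      using pnorm_mult[of "M ^ e" Q] nMe Q mult_mono[OF nMe Q(2)] by simp
    then have "cmod \<beta> * pnorm (M ^ e * Q) \<le> (pnorm R / a) * (2 ^ e * K0)"
      using beta a by (intro mult_mono) auto
    then have "pnorm (L * S) \<le> pnorm R / a + (pnorm R / a) * (2 ^ e * K0)"
      unfolding LS using pnorm_diff[of R "smult \<beta> (M ^ e * Q)"] Ra by simp
    then have nLS: "pnorm (L * S) \<le> T * (pnorm R / a)" by (simp add: T_def algebra_simps)
    have "pnorm S \<le> pnorm L * pnorm S" using nL mult_right_mono[of 1 "pnorm L" "pnorm S"] by simp
    also have "\<dots> \<le> W * pnorm (L * S)" unfolding L_def W_def by (rule pnorm_linear_mult[OF Sdeg])
    also have "\<dots> \<le> W * (T * (pnorm R / a))" using nLS W by (intro mult_left_mono) auto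
    finally have nS: "pnorm S \<le> W * T * (pnorm R / a)" by simp
    have "pnorm A * pnorm P2 + pnorm B1 \<le> K / a ^ e * pnorm S"
      unfolding S_def
    proof (rule IH)
      fix x y assume xy: "cmod x ^ 2 + cmod y ^ 2 = 1" and "hev e P2 (x, y) = 0"
      then have "hev (1 + e) P (x, y) = 0" unfolding P2(1)
        using hev_mult[OF Ldeg P2(2), of "(x, y)"] by simp
      then show "a \<le> cmod (hev (Suc D) Q (x, y))" using zeros xy by simp
    qed (use P2 Q a A B1 in auto)
    also have "\<dots> \<le> K / a ^ e * (W * T * (pnorm R / a))"
      using nS K a by (intro mult_left_mono) auto
    finally have main: "pnorm A * pnorm P2 + pnorm B1 \<le> K * W * T / a ^ Suc e * pnorm R"
      by (simp add: mult_ac)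
    have "pnorm B \<le> 2 ^ e * cmod \<beta> + 2 * pnorm B1"
    proof -
      have "B = smult \<beta> (M ^ e) + L * B1" using B1 by (simp add: algebra_simps)
      then have "pnorm B \<le> pnorm (smult \<beta> (M ^ e)) + pnorm (L * B1)" using pnorm_add by metis
      also have "pnorm (smult \<beta> (M ^ e)) \<le> 2 ^ e * cmod \<beta>"
        using mult_right_mono[OF nMe norm_ge_zero[of \<beta>]] by (simp add: mult.commute)
      also have "pnorm (L * B1) \<le> 2 * pnorm B1"
        using pnorm_mult[of L B1] mult_right_mono[OF nL(2) pnorm_nonneg[of B1]] by linarith
      finally show ?thesis by simp
    qed
    moreover have "pnorm A * pnorm P \<le> 2 * (pnorm A * pnorm P2)"
    proof -
      have "pnorm P \<le> 2 * pnorm P2" unfolding P2(1)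
        using pnorm_mult[of L P2] mult_right_mono[OF nL(2) pnorm_nonneg[of P2]] by linarith
      then have "pnorm A * pnorm P \<le> pnorm A * (2 * pnorm P2)" by (rule mult_left_mono) simp
      then show ?thesis by simp
    qed
    moreover have "cmod \<beta> \<le> pnorm R / a ^ Suc e"
    proof -
      have "a ^ Suc e \<le> a ^ 1" using a by (intro power_decreasing) auto
      then have "pnorm R / a ^ 1 \<le> pnorm R / a ^ Suc e" using a by (intro divide_left_mono) auto
      then show ?thesis using beta by simp
    qed
    then have "2 ^ e * cmod \<beta> \<le> 2 ^ e * (pnorm R / a ^ Suc e)" by (rule mult_left_mono) simp
    ultimately have "pnorm A * pnorm P + pnorm B
        \<le> 2 * (K * W * T / a ^ Suc e * pnorm R) + 2 ^ e * (pnorm R / a ^ Suc e)"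
      using main by linarith
    also have "\<dots> = K' / a ^ Suc e * pnorm R"
      by (simp add: K'_def add_divide_distrib distrib_left distrib_right mult_ac)
    finally show "pnorm A * pnorm P + pnorm B \<le> K' / a ^ Suc e * pnorm (A * P + B * Q)"
      by (simp add: R_def)
  qed
qed

text \<open>At a zero of P the norm of the pair is |Q|, which is the hypothesis of the auxiliary
  bound. At a zero of Q it is |P|, so that \<open>pnorm P\<close> is at least a; this removes the
  weight \<open>pnorm P\<close> on A at the cost of one more power of a.\<close>

lemma bezout_bound:
  assumes d: "1 \<le> d" and K0: "0 \<le> K0"
  shows "\<exists>K>0. \<forall>P Q A B a. degree P \<le> d \<longrightarrow> degree Q \<le> d \<longrightarrow> pnorm Q \<le> K0 \<longrightarrow> 0 < a \<longrightarrow> a \<le> 1 \<longrightarrow>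
      (\<forall>w. norm w = 1 \<longrightarrow> a \<le> norm (hmap d (P, Q) w)) \<longrightarrow> degree A < d \<longrightarrow> degree B < d \<longrightarrow>
      pnorm A + pnorm B \<le> K / a ^ Suc d * pnorm (A * P + B * Q)"
proof -
  obtain D where D: "d = Suc D" using d by (cases d) auto
  obtain K where K: "K > 0" and *: "\<And>P Q A B a. \<lbrakk>degree P \<le> d; degree Q \<le> d; pnorm Q \<le> K0;
      0 < a; a \<le> 1;
      \<And>u v. cmod u ^ 2 + cmod v ^ 2 = 1 \<Longrightarrow> hev d P (u, v) = 0 \<Longrightarrow> a \<le> cmod (hev d Q (u, v));
      degree A \<le> D; degree B \<le> D\<rbrakk> \<Longrightarrow>
      pnorm A * pnorm P + pnorm B \<le> K / a ^ d * pnorm (A * P + B * Q)"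
    using bezout_bound_aux[OF K0, of d D] unfolding D by auto
  show ?thesis
  proof (intro exI[of _ K] conjI allI impI K)
    fix P Q A B :: "complex poly" and a :: real
    assume P: "degree P \<le> d" and Q: "degree Q \<le> d" "pnorm Q \<le> K0" and a: "0 < a" "a \<le> 1"
      and low: "\<forall>w. norm w = 1 \<longrightarrow> a \<le> norm (hmap d (P, Q) w)"
      and A: "degree A < d" and B: "degree B < d"
    have main: "pnorm A * pnorm P + pnorm B \<le> K / a ^ d * pnorm (A * P + B * Q)"
    proof (rule *)
      fix u v assume "cmod u ^ 2 + cmod v ^ 2 = 1" and "hev d P (u, v) = 0"
      then show "a \<le> cmod (hev d Q (u, v))"
        using low[rule_format, of "(u, v)"] by (simp add: norm_Pair hmap_def)
    qed (use P Q a A B D in auto)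
    obtain u v where uv: "cmod u ^ 2 + cmod v ^ 2 = 1" and Q0: "hev d Q (u, v) = 0"
      using hev_zero_exists[OF Q(1) d] by auto
    have "a \<le> cmod (hev d P (u, v))"
      using low[rule_format, of "(u, v)"] uv Q0 by (simp add: norm_Pair hmap_def)
    also have "\<dots> \<le> pnorm P" using norm_hev_le[OF P, of "(u, v)"] uv by (simp add: norm_Pair)
    finally have "a * pnorm A \<le> pnorm A * pnorm P"
      using mult_left_mono[of a "pnorm P" "pnorm A"] by (simp add: mult.commute)
    moreover have "a * pnorm B \<le> pnorm B" using a by (simp add: mult_left_le_one_le)
    ultimately have "a * (pnorm A + pnorm B) \<le> K / a ^ d * pnorm (A * P + B * Q)"
      using main by (simp add: distrib_left)
    then show "pnorm A + pnorm B \<le> K / a ^ Suc d * pnorm (A * P + B * Q)"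
      using a by (simp add: field_simps)
  qed
qed

section \<open>Determinant estimates and the Sylvester matrix\<close>

lemma det_fun_eq_det: "det_fun n A = Determinant.det (Matrix.mat n n (\<lambda>(i, j). A i j))"
proof -
  have "(\<Prod>i<n. A i (p i)) = (\<Prod>i = 0..<n. Matrix.mat n n (\<lambda>(i, j). A i j) $$ (i, p i))"
    if "p permutes {..<n}" for p
  proof (rule prod.cong)
    fix i assume i: "i \<in> {0..<n}"
    then have "p i < n" using permutes_in_image[OF that, of i] by simp
    then show "A i (p i) = Matrix.mat n n (\<lambda>(i, j). A i j) $$ (i, p i)" using i by simp
  qed (rule lessThan_atLeast0)
  then show ?thesis
    unfolding det_fun_def Determinant.det_def lessThan_atLeast0
    by (auto intro!: sum.cong)
qed

lemma det_bound:
  assumes A: "A \<in> carrier_mat n n" and K: "\<And>i j. i < n \<Longrightarrow> j < n \<Longrightarrow> cmod (A $$ (i, j)) \<le> K"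
  shows "cmod (Determinant.det A) \<le> fact n * K ^ n"
proof -
  have "cmod (Determinant.det A) \<le> (\<Sum>p | p permutes {0..<n}. cmod (signof p * (\<Prod>i = 0..<n. A $$ (i, p i))))"
    using A unfolding Determinant.det_def by (simp add: norm_sum)
  also have "\<dots> \<le> (\<Sum>p | p permutes {0..<n}. K ^ n)"
  proof (rule sum_mono)
    fix p assume "p \<in> {p. p permutes {0..<n}}"
    then have p: "p i < n" if "i < n" for i using that permutes_in_image[of p "{0..<n}" i] by auto
    have "cmod (signof p * (\<Prod>i = 0..<n. A $$ (i, p i))) = (\<Prod>i = 0..<n. cmod (A $$ (i, p i)))"
      by (simp add: norm_mult sign_def prod_norm)
    also have "\<dots> \<le> (\<Prod>i = 0..<n. K)" using K p by (intro prod_mono) auto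
    finally show "cmod (signof p * (\<Prod>i = 0..<n. A $$ (i, p i))) \<le> K ^ n" by simp
  qed
  also have "\<dots> = fact n * K ^ n" by (simp add: card_permutations[of "{0..<n}" n])
  finally show ?thesis .
qed

text \<open>Each permutation picks exactly one entry of column k, so every term of the Leibniz
  expansion is at most \<eta>.\<close>

lemma det_bound_col:
  assumes A: "A \<in> carrier_mat n n" and k: "k < n" and \<eta>: "0 \<le> \<eta>"
    and 1: "\<And>i j. i < n \<Longrightarrow> j < n \<Longrightarrow> j \<noteq> k \<Longrightarrow> cmod (A $$ (i, j)) \<le> 1"
    and 2: "\<And>i. i < n \<Longrightarrow> cmod (A $$ (i, k)) \<le> \<eta>"
  shows "cmod (Determinant.det A) \<le> fact n * \<eta>"
proof -
  have "cmod (Determinant.det A) \<le> (\<Sum>p | p permutes {0..<n}. cmod (signof p * (\<Prod>i = 0..<n. A $$ (i, p i))))"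
    using A unfolding Determinant.det_def by (simp add: norm_sum)
  also have "\<dots> \<le> (\<Sum>p | p permutes {0..<n}. \<eta>)"
  proof (rule sum_mono)
    fix p assume "p \<in> {p. p permutes {0..<n}}"
    then have pp: "p permutes {0..<n}" by simp
    then have p: "p i < n" if "i < n" for i using that permutes_in_image[of p "{0..<n}" i] by auto
    have "cmod (signof p * (\<Prod>i = 0..<n. A $$ (i, p i))) = (\<Prod>i = 0..<n. cmod (A $$ (i, p i)))"
      by (simp add: norm_mult sign_def prod_norm)
    also have "\<dots> \<le> (\<Prod>i = 0..<n. if p i = k then \<eta> else 1)"
      using 1 2 p by (intro prod_mono) auto
    also have "\<dots> = (\<Prod>i = 0..<n. if i = k then \<eta> else 1)"
      using prod.permute[OF pp, of "\<lambda>i. if i = k then \<eta> else 1"] by (simp add: o_def)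
    also have "\<dots> = \<eta>" using k by simp
    finally show "cmod (signof p * (\<Prod>i = 0..<n. A $$ (i, p i))) \<le> \<eta>" .
  qed
  also have "\<dots> = fact n * \<eta>" by (simp add: card_permutations[of "{0..<n}" n])
  finally show ?thesis .
qed

text \<open>The hypothesis says that the row action x -> x S is injective with inverse bounded by K
  in the l1 norm. The rows of the inverse are preimages of unit vectors, so its entries are at most
  K and its determinant is at most n! K^n.\<close>

lemma det_lower_bound:
  assumes S: "S \<in> carrier_mat n n" and K: "0 < K"
    and b: "\<And>x. (\<Sum>i<n. cmod (x i)) \<le> K * (\<Sum>j<n. cmod (\<Sum>i<n. x i * S $$ (i, j)))"
  shows "1 / (fact n * K ^ n) \<le> cmod (Determinant.det S)"
proof -
  have "Determinant.det S \<noteq> 0"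
  proof
    assume "Determinant.det S = 0"
    then have "Determinant.det (transpose_mat S) = 0" using S by (simp add: Determinant.det_transpose)
    then obtain v where v: "v \<in> carrier_vec n" "v \<noteq> 0\<^sub>v n" "transpose_mat S *\<^sub>v v = 0\<^sub>v n"
      using det_0_iff_vec_prod_zero[of "transpose_mat S" n] S by auto
    have "(\<Sum>i<n. v $ i * S $$ (i, j)) = 0" if "j < n" for j
    proof -
      have "(transpose_mat S *\<^sub>v v) $ j = (\<Sum>i<n. v $ i * S $$ (i, j))"
        using that S v(1) by (auto simp: scalar_prod_def lessThan_atLeast0 mult.commute intro!: sum.cong)
      then show ?thesis using v that by simp
    qed
    then have "(\<Sum>i<n. cmod (v $ i)) \<le> 0" using b[of "\<lambda>i. v $ i"] by simp
    then have "v $ i = 0" if "i < n" for i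
      using that sum_nonneg_eq_0_iff[of "{..<n}" "\<lambda>i. cmod (v $ i)"]
      by (metis (no_types, lifting) finite_lessThan lessThan_iff norm_eq_zero norm_ge_zero order_antisym sum_nonneg)
    then have "v = 0\<^sub>v n" using v by (intro eq_vecI) auto
    then show False using v by simp
  qed
  from det_non_zero_imp_unit[OF S this, of "()"]
  obtain T where T: "T \<in> carrier_mat n n" "T * S = 1\<^sub>m n"
    unfolding Units_def ring_mat_def by auto
  have "cmod (T $$ (r, k)) \<le> K" if r: "r < n" and k: "k < n" for r k
  proof -
    have "(\<Sum>i<n. T $$ (r, i) * S $$ (i, j)) = (if j = r then 1 else 0)" if "j < n" for j
    proof -
      have "(T * S) $$ (r, j) = (\<Sum>i<n. T $$ (r, i) * S $$ (i, j))"
        using that r S T(1) by (auto simp: scalar_prod_def lessThan_atLeast0 intro!: sum.cong)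
      then show ?thesis using T(2) that r by auto
    qed
    then have "(\<Sum>j<n. cmod (\<Sum>i<n. T $$ (r, i) * S $$ (i, j))) = (\<Sum>j<n. if j = r then 1 else 0)"
      by (intro sum.cong) auto
    also have "\<dots> = 1" using r by simp
    finally have "(\<Sum>i<n. cmod (T $$ (r, i))) \<le> K" using b[of "\<lambda>i. T $$ (r, i)"] by simp
    moreover have "cmod (T $$ (r, k)) \<le> (\<Sum>i<n. cmod (T $$ (r, i)))"
      using k by (intro member_le_sum) auto
    ultimately show ?thesis by linarith
  qed
  then have "cmod (Determinant.det T) \<le> fact n * K ^ n" by (rule det_bound[OF T(1)])
  moreover have "Determinant.det T * Determinant.det S = 1"
    using det_mult[OF T(1) S] T(2) by simp
  then have "cmod (Determinant.det T) * cmod (Determinant.det S) = 1" by (metis norm_mult norm_one)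
  ultimately have "1 \<le> fact n * K ^ n * cmod (Determinant.det S)"
    by (metis mult_right_mono norm_ge_zero)
  then show ?thesis using K by (simp add: divide_le_eq mult.commute)
qed

text \<open>Column j stands for the degree 2d - 1 - j. This gives the matrix two actions: on row
  vectors it yields the coefficients of A P + B Q, and on the column of monomials at a point it
  yields monomial multiples of the values of P and Q there.\<close>

lemma sylvester_eq_coeff:
  assumes "i < 2 * d" "j < 2 * d" "degree P \<le> d" "degree Q \<le> d"
  shows "sylvester d P Q i j =
    coeff (if i < d then monom 1 (d - Suc i) * P else monom 1 (2 * d - Suc i) * Q) (2 * d - Suc j)"
proof (cases "i < d")
  case True
  then have "d - Suc i \<le> 2 * d - Suc j \<longleftrightarrow> j \<le> i + d" using assms by auto
  moreover have "2 * d - Suc j - (d - Suc i) = d + i - j" using True assms by auto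
  moreover have "d - (j - i) = d + i - j" if "i \<le> j" using that by auto
  moreover have "coeff P (d + i - j) = 0" if "j < i"
    using that \<open>degree P \<le> d\<close> by (intro coeff_eq_0) auto
  ultimately show ?thesis using True
    by (cases "i \<le> j") (auto simp: sylvester_def coeff_monom_mult)
next
  case False
  then have "2 * d - Suc i \<le> 2 * d - Suc j \<longleftrightarrow> j \<le> i" using assms by auto
  moreover have "2 * d - Suc j - (2 * d - Suc i) = i - j" using False assms by auto
  moreover have "d - (j - (i - d)) = i - j" if "i - d \<le> j" "j \<le> i" using that False by auto
  moreover have "coeff Q (i - j) = 0" if "j < i - d"
    using that \<open>degree Q \<le> d\<close> by (intro coeff_eq_0) auto
  ultimately show ?thesis using False
    by (cases "i - d \<le> j") (auto simp: sylvester_def coeff_monom_mult)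
qed

lemma hres_eq_det: "hres d P Q = Determinant.det (Matrix.mat (2 * d) (2 * d) (\<lambda>(i, j). sylvester d P Q i j))"
  unfolding hres_def by (rule det_fun_eq_det)

lemma sum_lessThan_add:
  fixes f :: "nat \<Rightarrow> 'a :: comm_monoid_add"
  shows "(\<Sum>i<d + e. f i) = (\<Sum>i<d. f i) + (\<Sum>i<e. f (d + i))"
  by (induction e) (auto simp: add.assoc)

lemma hres_smult: "hres d (smult c P) (smult c Q) = c ^ (2 * d) * hres d P Q"
proof -
  have "sylvester d (smult c P) (smult c Q) i j = c * sylvester d P Q i j" for i j
    by (simp add: sylvester_def)
  then show ?thesis
    by (simp add: hres_def det_fun_def prod.distrib sum_distrib_left mult_ac)
qed

text \<open>The Sylvester matrix maps the vector x of monomials of degree 2d - 1 at w to a vector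
  with entries of modulus at most \<eta> = |(P(w), Q(w))|. By Cramer's rule x_k times the resultant
  is a determinant with one column of that size, and some x_k is not small.\<close>

lemma hres_upper:
  assumes d: "1 \<le> d" and P: "degree P \<le> d" "\<And>i. cmod (coeff P i) \<le> 1"
    and Q: "degree Q \<le> d" "\<And>i. cmod (coeff Q i) \<le> 1" and w: "norm w = 1"
  shows "cmod (hres d P Q) \<le> fact (2 * d) * 2 ^ (2 * d) * norm (hmap d (P, Q) w)"
proof -
  define n where "n = 2 * d"
  obtain u v where uv: "w = (u, v)" by fastforce
  define \<eta> where "\<eta> = norm (hmap d (P, Q) w)"
  define S where "S = Matrix.mat n n (\<lambda>(i, j). sylvester d P Q i j)"
  have S: "S \<in> carrier_mat n n" by (simp add: S_def)
  define x where "x = Matrix.vec n (\<lambda>j. u ^ (n - Suc j) * v ^ j)"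
  have x: "x \<in> carrier_vec n" by (simp add: x_def)
  have le1: "cmod u \<le> 1" "cmod v \<le> 1" using w uv norm_fst_le[of u v] norm_snd_le[of v u] by auto
  have hPQ: "cmod (hev d P w) \<le> \<eta>" "cmod (hev d Q w) \<le> \<eta>"
    unfolding \<eta>_def hmap_def using norm_fst_le norm_snd_le by auto
  have Sx: "cmod ((S *\<^sub>v x) $ i) \<le> \<eta>" if i: "i < n" for i
  proof -
    define k where "k = (if i < d then d - Suc i else n - Suc i)"
    have k: "k \<le> d - 1" using i by (auto simp: k_def n_def)
    define F where "F = (if i < d then P else Q)"
    have F: "degree F \<le> d" "cmod (hev d F w) \<le> \<eta>" using P Q hPQ by (auto simp: F_def)
    have "(S *\<^sub>v x) $ i = (\<Sum>j<n. sylvester d P Q i j * (u ^ (n - Suc j) * v ^ j))"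
      using i S x by (auto simp: scalar_prod_def lessThan_atLeast0 S_def x_def intro!: sum.cong)
    also have "\<dots> = (\<Sum>j<n. coeff (monom 1 k * F) (n - Suc j) * u ^ (n - Suc j) * v ^ (n - Suc (n - Suc j)))"
      using i sylvester_eq_coeff[OF _ _ P(1) Q(1), of i]
      by (intro sum.cong) (auto simp: n_def k_def F_def)
    also have "\<dots> = (\<Sum>j<n. coeff (monom 1 k * F) j * u ^ j * v ^ (n - Suc j))"
      by (rule sum.nat_diff_reindex)
    also have "\<dots> = hev (d - 1 + d) (monom 1 k * F) w"
      unfolding hev_def using d by (intro sum.cong) (auto simp: n_def uv mult_2)
    also have "\<dots> = hev (d - 1) (monom 1 k) w * hev d F w"
      using degree_monom_le[of "1::complex" k] k F by (intro hev_mult) auto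
    also have "cmod \<dots> \<le> (1 * 1 ^ (d - 1)) * \<eta>"
    proof -
      have "cmod (hev (d - 1) (monom 1 k) w) \<le> 1 * 1 ^ (d - 1)"
        using norm_hev_le[of "monom 1 k" "d - 1" w] w k degree_monom_le[of "1::complex" k] by simp
      then show ?thesis unfolding norm_mult using F by (intro mult_mono) auto
    qed
    finally show ?thesis by simp
  qed
  have ent: "cmod (S $$ (i, j)) \<le> 1" if "i < n" "j < n" for i j
    using that P Q by (auto simp: S_def sylvester_def)
  have cr: "cmod (x $ k) * cmod (hres d P Q) \<le> fact n * \<eta>" if k: "k < n" for k
  proof -
    have "x $ k * Determinant.det S = Determinant.det (replace_col S (S *\<^sub>v x) k)"
      by (rule cramer_lemma_mat[OF S x k, symmetric])
    also have "cmod \<dots> \<le> fact n * \<eta>"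
    proof (rule det_bound_col[OF _ k])
      show "replace_col S (S *\<^sub>v x) k \<in> carrier_mat n n" using S by (auto simp: replace_col_def)
    qed (use S k Sx ent in \<open>auto simp: replace_col_def \<eta>_def\<close>)
    finally show ?thesis by (simp add: norm_mult hres_eq_det S_def n_def)
  qed
  \<comment> \<open>The first and the last monomial are u^(n-1) and v^(n-1), and one of u, v has
    modulus at least 1/2.\<close>
  have "\<exists>k<n. 1 / 2 ^ n \<le> cmod (x $ k)"
  proof -
    have big: "1 / 2 ^ n \<le> t ^ (n - 1)" if "1 / 2 \<le> t" for t :: real
    proof -
      have "(1 / 2 :: real) ^ n \<le> (1 / 2) ^ (n - 1)" by (intro power_decreasing) auto
      also have "\<dots> \<le> t ^ (n - 1)" using that by (intro power_mono) auto
      finally show ?thesis by (simp add: power_divide)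
    qed
    have "1 \<le> cmod u + cmod v" using norm_Pair_le[of u v] w uv by simp
    then consider "1 / 2 \<le> cmod u" | "1 / 2 \<le> cmod v" by linarith
    then show ?thesis
    proof cases
      case 1
      then show ?thesis using big[OF 1] d
        by (intro exI[of _ 0]) (auto simp: x_def n_def norm_power)
    next
      case 2
      then show ?thesis using big[OF 2] d
        by (intro exI[of _ "n - 1"]) (auto simp: x_def n_def norm_power)
    qed
  qed
  then obtain k where k: "k < n" "1 / 2 ^ n \<le> cmod (x $ k)" by blast
  have "1 / 2 ^ n * cmod (hres d P Q) \<le> cmod (x $ k) * cmod (hres d P Q)"
    using k by (intro mult_right_mono) auto
  also have "\<dots> \<le> fact n * \<eta>" using cr k by simp
  finally show ?thesis by (simp add: n_def \<eta>_def field_simps)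
qed

text \<open>The effective Bezout identity says that (A, B) -> A P + B Q, the row action of the
  Sylvester matrix, has an inverse bounded by K / a^(d+1). The determinant has size 2d, hence the
  exponent (d+1) 2d.\<close>

lemma hres_lower:
  assumes d: "1 \<le> d" and K0: "0 \<le> K0"
  shows "\<exists>c>0. \<forall>P Q a. degree P \<le> d \<longrightarrow> degree Q \<le> d \<longrightarrow> pnorm Q \<le> K0 \<longrightarrow> 0 < a \<longrightarrow> a \<le> 1 \<longrightarrow>
      (\<forall>w. norm w = 1 \<longrightarrow> a \<le> norm (hmap d (P, Q) w)) \<longrightarrow>
      c * a ^ (Suc d * (2 * d)) \<le> cmod (hres d P Q)"
proof -
  obtain K where K: "K > 0" and *: "\<And>P Q A B a. \<lbrakk>degree P \<le> d; degree Q \<le> d; pnorm Q \<le> K0;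
      0 < a; a \<le> 1; \<And>w. norm w = 1 \<Longrightarrow> a \<le> norm (hmap d (P, Q) w); degree A < d; degree B < d\<rbrakk> \<Longrightarrow>
      pnorm A + pnorm B \<le> K / a ^ Suc d * pnorm (A * P + B * Q)"
    using bezout_bound[OF d K0] by blast
  define n where "n = 2 * d"
  show ?thesis
  proof (intro exI[of _ "1 / (fact n * K ^ n)"] conjI allI impI)
    fix P Q :: "complex poly" and a :: real
    assume P: "degree P \<le> d" and Q: "degree Q \<le> d" "pnorm Q \<le> K0" and a: "0 < a" "a \<le> 1"
      and low: "\<forall>w. norm w = 1 \<longrightarrow> a \<le> norm (hmap d (P, Q) w)"
    define S where "S = Matrix.mat n n (\<lambda>(i, j). sylvester d P Q i j)"
    have S: "S \<in> carrier_mat n n" by (simp add: S_def)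
    have "1 / (fact n * (K / a ^ Suc d) ^ n) \<le> cmod (Determinant.det S)"
    proof (rule det_lower_bound[OF S])
      show "0 < K / a ^ Suc d" using K a by simp
      fix x :: "nat \<Rightarrow> complex"
      \<comment> \<open>The row vector x lists the coefficients of A and then those of B, each from
        degree d - 1 downwards.\<close>
      define A where "A = (\<Sum>i<d. monom (x i) (d - Suc i))"
      define B where "B = (\<Sum>i<d. monom (x (d + i)) (d - Suc i))"
      define R where "R = A * P + B * Q"
      have deg: "degree A < d" "degree B < d" unfolding A_def B_def
        using d by (auto intro!: degree_sum_less order.strict_trans1[OF degree_monom_le])
      have nA: "pnorm (\<Sum>i<d. monom (y i) (d - Suc i)) = (\<Sum>i<d. cmod (y i))" for y :: "nat \<Rightarrow> complex"
      proof -
        define X where "X = (\<Sum>i<d. monom (y i) (d - Suc i))"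
        have "degree X < d" unfolding X_def
          using d by (auto intro!: degree_sum_less order.strict_trans1[OF degree_monom_le])
        then have "pnorm X = (\<Sum>k\<le>d - 1. cmod (coeff X k))" by (intro pnorm_eq) simp
        also have "\<dots> = (\<Sum>k<d. cmod (coeff X k))" using d by (intro sum.cong) auto
        also have "\<dots> = (\<Sum>i<d. cmod (coeff X (d - Suc i)))" by (rule sum.nat_diff_reindex [symmetric])
        also have "\<dots> = (\<Sum>i<d. cmod (y i))"
        proof (intro sum.cong refl)
          fix i assume i: "i \<in> {..<d}"
          have "coeff X (d - Suc i) = (\<Sum>k<d. if k = i then y i else 0)"
            unfolding X_def coeff_sum using i by (intro sum.cong) auto
          then show "cmod (coeff X (d - Suc i)) = cmod (y i)" using i by simp
        qed
        finally show ?thesis by (simp add: X_def)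
      qed
      have "(\<Sum>i<n. cmod (x i)) = (\<Sum>i<d. cmod (x i)) + (\<Sum>i<d. cmod (x (d + i)))"
        unfolding n_def mult_2 by (rule sum_lessThan_add)
      then have "(\<Sum>i<n. cmod (x i)) = pnorm A + pnorm B"
        unfolding A_def B_def by (simp add: nA)
      also have "\<dots> \<le> K / a ^ Suc d * pnorm R" unfolding R_def
        using * P Q a low deg by blast
      also have "pnorm R = (\<Sum>j<n. cmod (\<Sum>i<n. x i * S $$ (i, j)))"
      proof -
        have "degree (A * P) \<le> n - 1" "degree (B * Q) \<le> n - 1"
          using degree_mult_le[of A P] degree_mult_le[of B Q] deg P Q by (auto simp: n_def)
        then have "degree R \<le> n - 1" unfolding R_def by (rule degree_add_le)
        then have "pnorm R = (\<Sum>k\<le>n - 1. cmod (coeff R k))" by (rule pnorm_eq)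
        also have "\<dots> = (\<Sum>k<n. cmod (coeff R k))" using d by (intro sum.cong) (auto simp: n_def)
        also have "\<dots> = (\<Sum>j<n. cmod (coeff R (n - Suc j)))" by (rule sum.nat_diff_reindex [symmetric])
        also have "\<dots> = (\<Sum>j<n. cmod (\<Sum>i<n. x i * S $$ (i, j)))"
        proof (intro sum.cong refl arg_cong[of _ _ cmod])
          fix j assume j: "j \<in> {..<n}"
          have "(\<Sum>i<n. x i * S $$ (i, j))
              = (\<Sum>i<d. x i * S $$ (i, j)) + (\<Sum>i<d. x (d + i) * S $$ (d + i, j))"
            unfolding n_def mult_2 by (rule sum_lessThan_add)
          also have "(\<Sum>i<d. x i * S $$ (i, j)) = coeff (A * P) (n - Suc j)"
            unfolding A_def sum_distrib_right coeff_sum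
          proof (intro sum.cong refl)
            fix i assume "i \<in> {..<d}"
            then show "x i * S $$ (i, j) = coeff (monom (x i) (d - Suc i) * P) (n - Suc j)"
              using j sylvester_eq_coeff[OF _ _ P Q(1), of i j]
              by (auto simp: S_def n_def coeff_monom_mult)
          qed
          also have "(\<Sum>i<d. x (d + i) * S $$ (d + i, j)) = coeff (B * Q) (n - Suc j)"
            unfolding B_def sum_distrib_right coeff_sum
          proof (intro sum.cong refl)
            fix i assume "i \<in> {..<d}"
            then show "x (d + i) * S $$ (d + i, j) = coeff (monom (x (d + i)) (d - Suc i) * Q) (n - Suc j)"
              using j sylvester_eq_coeff[OF _ _ P Q(1), of "d + i" j]
              by (auto simp: S_def n_def coeff_monom_mult)
          qed
          finally show "coeff R (n - Suc j) = (\<Sum>i<n. x i * S $$ (i, j))" by (simp add: R_def)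
        qed
        finally show ?thesis .
      qed
      finally show "(\<Sum>i<n. cmod (x i)) \<le> K / a ^ Suc d * (\<Sum>j<n. cmod (\<Sum>i<n. x i * S $$ (i, j)))" .
    qed
    moreover have "1 / (fact n * (K / a ^ Suc d) ^ n) = 1 / (fact n * K ^ n) * a ^ (Suc d * n)"
      unfolding power_divide power_mult by simp
    ultimately show "1 / (fact n * K ^ n) * a ^ (Suc d * (2 * d)) \<le> cmod (hres d P Q)"
      by (simp add: hres_eq_det S_def n_def)
  qed (use K in simp)
qed

section \<open>Resultants and distortion on the unit sphere\<close>

definition cscale :: "complex \<Rightarrow> complex \<times> complex \<Rightarrow> complex \<times> complex" where
  "cscale c w = (c * fst w, c * snd w)"

lemma norm_cscale [simp]: "norm (cscale c w) = cmod c * norm w"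
proof (cases w)
  case (Pair u v)
  have "norm (cscale c w) = sqrt (cmod c ^ 2 * (cmod u ^ 2 + cmod v ^ 2))"
    by (simp add: cscale_def Pair norm_Pair norm_mult power_mult_distrib distrib_left)
  then show ?thesis by (simp add: real_sqrt_mult Pair norm_Pair)
qed

lemma hmap_cscale: "hmap d h (cscale c w) = cscale (c ^ d) (hmap d h w)"
  using hev_scale[of d _ c "fst w" "snd w"] by (simp add: hmap_def cscale_def)

lemma cscale_unit:
  assumes "w \<noteq> 0"
  shows "w = cscale (of_real (norm w)) (cscale (of_real (1 / norm w)) w)"
    and "norm (cscale (of_real (1 / norm w)) w) = 1"
proof -
  show "w = cscale (of_real (norm w)) (cscale (of_real (1 / norm w)) w)"
    using assms by (simp add: cscale_def)
  show "norm (cscale (of_real (1 / norm w)) w) = 1"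
    using assms unfolding norm_cscale by (simp add: norm_divide)
qed

lemma hmap_smult: "hmap d (smult c P, smult c Q) w = cscale c (hmap d (P, Q) w)"
  by (simp add: hmap_def cscale_def hev_smult)

lemma norm_hmap_lower:
  assumes "\<And>w. norm w = 1 \<Longrightarrow> a \<le> norm (hmap d h w)" "w \<noteq> 0"
  shows "a * norm w ^ d \<le> norm (hmap d h w)"
proof -
  define x where "x = cscale (of_real (1 / norm w)) w"
  have x: "w = cscale (of_real (norm w)) x" "norm x = 1"
    using cscale_unit[OF assms(2)] by (simp_all add: x_def)
  have "norm (hmap d h w) = norm w ^ d * norm (hmap d h x)"
    by (subst x(1)) (simp add: hmap_cscale norm_power)
  then show ?thesis using mult_right_mono[OF assms(1)[OF x(2)], of "norm w ^ d"]
    by (simp add: mult.commute)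
qed

lemma norm_hmap_upper:
  assumes "\<And>w. norm w = 1 \<Longrightarrow> norm (hmap d h w) \<le> b" "w \<noteq> 0"
  shows "norm (hmap d h w) \<le> b * norm w ^ d"
proof -
  define x where "x = cscale (of_real (1 / norm w)) w"
  have x: "w = cscale (of_real (norm w)) x" "norm x = 1"
    using cscale_unit[OF assms(2)] by (simp_all add: x_def)
  have "norm (hmap d h w) = norm w ^ d * norm (hmap d h x)"
    by (subst x(1)) (simp add: hmap_cscale norm_power)
  then show ?thesis using mult_right_mono[OF assms(1)[OF x(2)], of "norm w ^ d"]
    by (simp add: mult.commute)
qed

section \<open>Normalised resultant versus extreme values on the sphere\<close>

lemma coeff_le_maxcoef:
  "i \<le> d \<Longrightarrow> cmod (coeff (fst h) i) \<le> maxcoef d h"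
  "i \<le> d \<Longrightarrow> cmod (coeff (snd h) i) \<le> maxcoef d h"
  unfolding maxcoef_def by (auto intro!: Max_ge)

lemma maxcoef_nonneg [simp]: "0 \<le> maxcoef d h"
  using coeff_le_maxcoef(1)[of 0 d h] norm_ge_zero order_trans by blast

lemma maxcoef_le:
  assumes "\<And>i. i \<le> d \<Longrightarrow> cmod (coeff (fst h) i) \<le> b" "\<And>i. i \<le> d \<Longrightarrow> cmod (coeff (snd h) i) \<le> b"
  shows "maxcoef d h \<le> b"
  unfolding maxcoef_def using assms by (subst Max_le_iff) auto

lemma coeff_le_maxcoef_deg:
  "degree (fst h) \<le> d \<Longrightarrow> cmod (coeff (fst h) i) \<le> maxcoef d h"
  "degree (snd h) \<le> d \<Longrightarrow> cmod (coeff (snd h) i) \<le> maxcoef d h"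
  using coeff_le_maxcoef[of i d h] by (cases "i \<le> d"; auto simp: coeff_eq_0)+

lemma pnorm_le_coeff_bound:
  assumes "degree P \<le> d" "\<And>i. i \<le> d \<Longrightarrow> cmod (coeff P i) \<le> b"
  shows "pnorm P \<le> real (Suc d) * b"
proof -
  have "pnorm P \<le> (\<Sum>i\<le>d. b)" unfolding pnorm_eq[OF assms(1)] by (intro sum_mono assms) auto
  then show ?thesis by simp
qed

lemma maxcoef_smult: "maxcoef d (smult c P, smult c Q) = cmod c * maxcoef d (P, Q)"
proof (rule antisym)
  show "maxcoef d (smult c P, smult c Q) \<le> cmod c * maxcoef d (P, Q)"
    using coeff_le_maxcoef[of _ d "(P, Q)"]
    by (intro maxcoef_le) (auto simp: norm_mult intro!: mult_left_mono)
  show "cmod c * maxcoef d (P, Q) \<le> maxcoef d (smult c P, smult c Q)"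
  proof (cases "c = 0")
    case False
    have "maxcoef d (P, Q) \<le> maxcoef d (smult c P, smult c Q) / cmod c"
      using False coeff_le_maxcoef[of _ d "(smult c P, smult c Q)"]
      by (intro maxcoef_le) (auto simp: norm_mult pos_le_divide_eq mult.commute)
    then show ?thesis using False by (simp add: pos_le_divide_eq mult.commute)
  qed simp
qed

lemma normRes_smult: "c \<noteq> 0 \<Longrightarrow> normRes d (smult c P, smult c Q) = normRes d (P, Q)"
  by (simp add: normRes_def hres_smult maxcoef_smult norm_mult norm_power power_mult_distrib)

lemma normRes_nonneg [simp]: "0 \<le> normRes d h"
  by (simp add: normRes_def)

lemma norm_hmap_le:
  assumes "degree (fst h) \<le> d" "degree (snd h) \<le> d"
  shows "norm (hmap d h w) \<le> 2 * real (Suc d) * maxcoef d h * norm w ^ d"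
proof -
  have 1: "cmod (hev d F w) \<le> real (Suc d) * maxcoef d h * norm w ^ d"
    if "F = fst h \<or> F = snd h" for F
  proof -
    have "degree F \<le> d" "pnorm F \<le> real (Suc d) * maxcoef d h"
      using that assms coeff_le_maxcoef[of _ d h] by (auto simp del: of_nat_Suc intro!: pnorm_le_coeff_bound)
    then show ?thesis using norm_hev_le[of F d w]
      by (meson mult_right_mono norm_ge_zero order_trans zero_le_power)
  qed
  have "norm (hmap d h w) \<le> cmod (hev d (fst h) w) + cmod (hev d (snd h) w)"
    unfolding hmap_def by (rule norm_Pair_le)
  then show ?thesis using 1[of "fst h"] 1[of "snd h"] by (simp del: of_nat_Suc)
qed

text \<open>Scaling to \<open>maxcoef\<close> 1 turns \<open>normRes\<close> into the modulus of the
  resultant, to which the Cramer estimate applies; homogeneity then leaves the sphere.\<close>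

lemma normRes_le_norm_hmap:
  assumes d: "1 \<le> d" and h: "degree (fst h) \<le> d" "degree (snd h) \<le> d" and w: "w \<noteq> 0"
  shows "normRes d h / (fact (2 * d) * 2 ^ (2 * d)) * maxcoef d h * norm w ^ d \<le> norm (hmap d h w)"
proof (cases "maxcoef d h = 0")
  case False
  obtain P Q where PQ: "h = (P, Q)" by fastforce
  define m where "m = maxcoef d h"
  have m: "m > 0" using False maxcoef_nonneg[of d h] unfolding m_def by linarith
  define c where "c = complex_of_real (1 / m)"
  have cm: "cmod c = 1 / m" using m by (simp add: c_def norm_divide)
  have co: "cmod (coeff (smult c P) i) \<le> 1" "cmod (coeff (smult c Q) i) \<le> 1" for i
    using coeff_le_maxcoef_deg(1)[OF h(1), of i] coeff_le_maxcoef_deg(2)[OF h(2), of i] m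
    by (simp_all add: norm_mult cm PQ m_def)
  have mx: "maxcoef d (smult c P, smult c Q) = 1"
    using m by (simp add: maxcoef_smult cm m_def PQ)
  have "normRes d h = normRes d (smult c P, smult c Q)"
    using m by (simp add: PQ normRes_smult c_def)
  also have "\<dots> = cmod (hres d (smult c P) (smult c Q))"
    by (simp add: normRes_def mx)
  finally have nr: "normRes d h = cmod (hres d (smult c P) (smult c Q))" .
  have "normRes d h / (fact (2 * d) * 2 ^ (2 * d)) * m \<le> norm (hmap d h x)" if x: "norm x = 1" for x
  proof -
    have "normRes d h \<le> fact (2 * d) * 2 ^ (2 * d) * norm (hmap d (smult c P, smult c Q) x)"
      unfolding nr using h x co by (intro hres_upper d) (auto simp: PQ intro: order_trans[OF degree_smult_le])
    then have "normRes d h \<le> fact (2 * d) * 2 ^ (2 * d) * (norm (hmap d h x) / m)"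
      by (simp add: hmap_smult cm PQ)
    then show ?thesis using m by (simp add: field_simps)
  qed
  from norm_hmap_lower[OF this w] show ?thesis by (simp add: m_def)
qed simp

text \<open>The lower and the upper bound for |h| at the single point (1, 0) are compared. This
  makes the supremum in \<open>minRes\<close> a genuine one.\<close>

lemma normRes_bounded:
  assumes d: "1 \<le> d" and h: "degree (fst h) \<le> d" "degree (snd h) \<le> d"
  shows "normRes d h \<le> 2 * real (Suc d) * (fact (2 * d) * 2 ^ (2 * d))"
proof (cases "maxcoef d h = 0")
  case True
  then show ?thesis using d by (simp add: normRes_def power_0_left)
next
  case False
  then have m: "maxcoef d h > 0" using maxcoef_nonneg[of d h] by linarith
  define w where "w = (1 :: complex, 0 :: complex)"
  have w: "w \<noteq> 0" "norm w = 1" by (auto simp: w_def zero_prod_def norm_Pair)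
  have "normRes d h / (fact (2 * d) * 2 ^ (2 * d)) * maxcoef d h \<le> 2 * real (Suc d) * maxcoef d h"
    using normRes_le_norm_hmap[OF d h w(1)] norm_hmap_le[OF h, of w] w(2) by simp
  then have "normRes d h / (fact (2 * d) * 2 ^ (2 * d)) \<le> 2 * real (Suc d)"
    using m by (simp only: mult_le_cancel_right_pos)
  then show ?thesis by (simp only: divide_le_eq) (simp split: if_splits)
qed

text \<open>Points (z, 1) over the closed unit disc have norm at most 2, so the bound on the sphere
  controls the dehomogenised polynomials on the disc with a factor 2^d.\<close>

lemma maxcoef_le_sup:
  "\<exists>C>0. \<forall>h b. degree (fst h) \<le> d \<longrightarrow> degree (snd h) \<le> d \<longrightarrow>
      (\<forall>w. norm w = 1 \<longrightarrow> norm (hmap d h w) \<le> b) \<longrightarrow> maxcoef d h \<le> C * b"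
proof -
  obtain C where C: "C > 0" and Cb: "\<And>P b i. degree P \<le> d \<Longrightarrow>
      (\<And>z. cmod z \<le> 1 \<Longrightarrow> cmod (poly P z) \<le> b) \<Longrightarrow> cmod (coeff P i) \<le> C * b"
    using coeff_le_sup[of d] by blast
  show ?thesis
  proof (intro exI[of _ "C * 2 ^ d"] conjI allI impI)
    fix h :: rmap and b :: real
    assume h: "degree (fst h) \<le> d" "degree (snd h) \<le> d"
      and b: "\<forall>w. norm w = 1 \<longrightarrow> norm (hmap d h w) \<le> b"
    have b0: "0 \<le> b" using b[rule_format, of "(1, 0)"] norm_ge_zero[of "hmap d h (1, 0)"]
      by (simp add: norm_Pair del: norm_ge_zero)
    have coef: "cmod (coeff F i) \<le> C * (2 ^ d * b)" if F: "F = fst h \<or> F = snd h" for F i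
    proof (rule Cb)
      show "degree F \<le> d" using F h by auto
      fix z :: complex assume z: "cmod z \<le> 1"
      define w where "w = (z, 1 :: complex)"
      have w0: "w \<noteq> 0" by (simp add: w_def zero_prod_def)
      define x where "x = cscale (of_real (1 / norm w)) w"
      have x: "w = cscale (of_real (norm w)) x" "norm x = 1"
        using cscale_unit[OF w0] by (simp_all add: x_def)
      have "norm w \<le> 2" using norm_Pair_le[of z "1::complex"] z by (simp add: w_def)
      have "cmod (poly F z) = cmod (hev d F w)" using F h by (auto simp: poly_eq_hev w_def)
      also have "\<dots> \<le> norm (hmap d h w)"
        using F norm_fst_le norm_snd_le unfolding hmap_def by auto
      also have "\<dots> = norm w ^ d * norm (hmap d h x)"
        by (subst x(1)) (simp add: hmap_cscale norm_power)
      also have "\<dots> \<le> 2 ^ d * b"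
        using b[rule_format, OF x(2)] \<open>norm w \<le> 2\<close> by (intro mult_mono power_mono) auto
      finally show "cmod (poly F z) \<le> 2 ^ d * b" .
    qed
    then show "maxcoef d h \<le> C * 2 ^ d * b" by (intro maxcoef_le) (auto simp: mult.assoc)
  qed (use C in simp)
qed

text \<open>Divided by b, the map is at most 1 on the sphere, so its coefficients are at most K and
  the resultant bound applies with a/b. The factor K^(2d) bounds the denominator of
  \<open>normRes\<close>.\<close>

lemma normRes_lower:
  assumes d: "1 \<le> d"
  shows "\<exists>c k. 0 < c \<and> (\<forall>h a b. degree (fst h) \<le> d \<longrightarrow> degree (snd h) \<le> d \<longrightarrow> 0 < a \<longrightarrow>
      (\<forall>w. norm w = 1 \<longrightarrow> a \<le> norm (hmap d h w) \<and> norm (hmap d h w) \<le> b) \<longrightarrow>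
      c * (a / b) ^ k \<le> normRes d h)"
proof -
  obtain K where K: "K > 0" and Kb: "\<And>h b. degree (fst h) \<le> d \<Longrightarrow> degree (snd h) \<le> d \<Longrightarrow>
      (\<And>w. norm w = 1 \<Longrightarrow> norm (hmap d h w) \<le> b) \<Longrightarrow> maxcoef d h \<le> K * b"
    using maxcoef_le_sup[of d] by blast
  obtain c where c: "c > 0" and lower: "\<And>P Q a. \<lbrakk>degree P \<le> d; degree Q \<le> d; pnorm Q \<le> real (Suc d) * K;
      0 < a; a \<le> 1; \<And>w. norm w = 1 \<Longrightarrow> a \<le> norm (hmap d (P, Q) w)\<rbrakk> \<Longrightarrow>
      c * a ^ (Suc d * (2 * d)) \<le> cmod (hres d P Q)"
    using hres_lower[OF d, of "real (Suc d) * K"] K by auto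
  show ?thesis
  proof (intro exI[of _ "c / K ^ (2 * d)"] exI[of _ "Suc d * (2 * d)"] conjI allI impI)
    fix h :: rmap and a b :: real
    assume h: "degree (fst h) \<le> d" "degree (snd h) \<le> d" and a: "0 < a"
      and ab: "\<forall>w. norm w = 1 \<longrightarrow> a \<le> norm (hmap d h w) \<and> norm (hmap d h w) \<le> b"
    obtain P Q where PQ: "h = (P, Q)" by fastforce
    have "a \<le> b" using ab[rule_format, of "(1, 0)"] by (simp add: norm_Pair)
    then have b: "b > 0" using a by linarith
    define c1 where "c1 = complex_of_real (1 / b)"
    have c1: "cmod c1 = 1 / b" "c1 \<noteq> 0" using b by (simp_all add: c1_def norm_divide)
    define h1 where "h1 = (smult c1 P, smult c1 Q)"
    have deg: "degree (fst h1) \<le> d" "degree (snd h1) \<le> d"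
      using h by (auto simp: h1_def PQ intro: order_trans[OF degree_smult_le])
    have hm: "norm (hmap d h1 w) = norm (hmap d h w) / b" for w
      by (simp add: h1_def hmap_smult PQ c1)
    have low: "a / b \<le> norm (hmap d h1 w)" if "norm w = 1" for w
      using ab[rule_format, OF that] b unfolding hm by (intro divide_right_mono) auto
    have "norm (hmap d h1 w) \<le> 1" if "norm w = 1" for w
      using ab[rule_format, OF that] b by (simp add: hm)
    from Kb[OF deg this] have mx: "maxcoef d h1 \<le> K" by simp
    have "maxcoef d h1 \<noteq> 0"
    proof
      assume "maxcoef d h1 = 0"
      then have "norm (hmap d h1 (1, 0)) \<le> 0"
        using norm_hmap_le[OF deg, of "(1, 0)"] by simp
      moreover have "a / b \<le> norm (hmap d h1 (1, 0))" by (rule low) (simp add: norm_Pair)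
      moreover have "0 < a / b" using a b by simp
      ultimately show False by linarith
    qed
    then have mx0: "maxcoef d h1 > 0" using maxcoef_nonneg[of d h1] by linarith
    have "c * (a / b) ^ (Suc d * (2 * d)) \<le> cmod (hres d (fst h1) (snd h1))"
    proof (rule lower)
      show "pnorm (snd h1) \<le> real (Suc d) * K"
        using deg coeff_le_maxcoef(2)[of _ d h1] mx by (intro pnorm_le_coeff_bound) (auto intro: order_trans)
    qed (use deg a b \<open>a \<le> b\<close> low in auto)
    then have "c * (a / b) ^ (Suc d * (2 * d)) / K ^ (2 * d)
        \<le> cmod (hres d (fst h1) (snd h1)) / maxcoef d h1 ^ (2 * d)"
      using mx mx0 by (intro frac_le power_mono) auto
    also have "\<dots> = normRes d h1" by (simp add: normRes_def)
    also have "\<dots> = normRes d h" unfolding h1_def PQ by (rule normRes_smult) fact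
    finally show "c / K ^ (2 * d) * (a / b) ^ (Suc d * (2 * d)) \<le> normRes d h" by simp
  qed (use c K in simp)
qed

section \<open>Conjugation and the minimal resultant\<close>

text \<open>A quadruple \<open>(a, b, c, e)\<close> stands for the matrix with rows \<open>(a, b)\<close> and \<open>(c, e)\<close>, as in the definition of
  \<^const>\<open>minRes\<close>.\<close>
definition mact :: "complex \<times> complex \<times> complex \<times> complex \<Rightarrow> complex \<times> complex \<Rightarrow> complex \<times> complex" where
  "mact M w = (case M of (a, b, c, e) \<Rightarrow> (a * fst w + b * snd w, c * fst w + e * snd w))"

text \<open>The adjugate stands in for the inverse: it differs by the scalar \<open>mdet M\<close>,
  and \<open>normRes\<close> ignores nonzero scalars.\<close>

definition madj :: "complex \<times> complex \<times> complex \<times> complex \<Rightarrow> complex \<times> complex \<times> complex \<times> complex" where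
  "madj M = (case M of (a, b, c, e) \<Rightarrow> (e, - b, - c, a))"

definition mdet :: "complex \<times> complex \<times> complex \<times> complex \<Rightarrow> complex" where
  "mdet M = (case M of (a, b, c, e) \<Rightarrow> a * e - b * c)"

definition mconj :: "nat \<Rightarrow> complex \<times> complex \<times> complex \<times> complex \<Rightarrow> rmap \<Rightarrow> rmap" where
  "mconj d M g = (case M of (a, b, c, e) \<Rightarrow> conj_map d a b c e g)"

lemma mact_madj: "mact M (mact (madj M) w) = cscale (mdet M) w" "mact (madj M) (mact M w) = cscale (mdet M) w"
  by (cases M; simp add: mact_def madj_def mdet_def cscale_def algebra_simps)+

lemma mact_cscale: "mact M (cscale c w) = cscale c (mact M w)"
  by (cases M) (simp add: mact_def cscale_def algebra_simps)

lemma cscale_cscale [simp]: "cscale c (cscale k w) = cscale (c * k) w"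
  by (simp add: cscale_def mult.assoc)

lemma cscale_1 [simp]: "cscale 1 w = w"
  by (simp add: cscale_def)

lemma hmap_rcomp:
  assumes "degree (fst h2) \<le> d2" "degree (snd h2) \<le> d2"
  shows "hmap (d1 * d2) (rcomp d1 h1 h2) w = hmap d1 h1 (hmap d2 h2 w)"
  using assms by (simp add: hmap_def rcomp_def hev_hsubst)

lemma degree_rcomp:
  assumes "degree (fst h2) \<le> d2" "degree (snd h2) \<le> d2"
  shows "degree (fst (rcomp d1 h1 h2)) \<le> d1 * d2" "degree (snd (rcomp d1 h1 h2)) \<le> d1 * d2"
  using assms by (simp_all add: rcomp_def degree_hsubst)

text \<open>\<open>[:b, a:]\<close> and \<open>[:e, c:]\<close> are the forms a X + b Y and c X + e
  Y at Y = 1, so this lifts h o M.\<close>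

definition premap :: "nat \<Rightarrow> complex \<times> complex \<times> complex \<times> complex \<Rightarrow> rmap \<Rightarrow> rmap" where
  "premap d M h = (case M of (a, b, c, e) \<Rightarrow> rcomp d h ([:b, a:], [:e, c:]))"

definition postmap :: "complex \<times> complex \<times> complex \<times> complex \<Rightarrow> rmap \<Rightarrow> rmap" where
  "postmap M h = (case M of (a, b, c, e) \<Rightarrow>
     (smult a (fst h) + smult b (snd h), smult c (fst h) + smult e (snd h)))"

lemma hmap_postmap: "hmap d (postmap M h) w = mact M (hmap d h w)"
  by (cases M) (simp add: postmap_def hmap_def mact_def hev_add hev_smult)

lemma degree_postmap:
  assumes "degree (fst h) \<le> d" "degree (snd h) \<le> d"
  shows "degree (fst (postmap M h)) \<le> d" "degree (snd (postmap M h)) \<le> d"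
  using assms by (cases M; auto simp: postmap_def intro!: degree_add_le intro: order_trans[OF degree_smult_le])+

lemma hmap_premap: "hmap d (premap d M h) w = hmap d h (mact M w)"
proof (cases M)
  case (fields a b c e)
  have "hmap 1 ([:b, a:], [:e, c:]) w = mact M w"
    by (simp add: hmap_def hev_def mact_def fields add.commute)
  then show ?thesis
    using hmap_rcomp[of "([:b, a:], [:e, c:])" 1 d h w] by (simp add: premap_def fields)
qed

lemma degree_premap: "degree (fst (premap d M h)) \<le> d" "degree (snd (premap d M h)) \<le> d"
  using degree_rcomp[of "([:_, _:], [:_, _:])" 1 d h]
  by (cases M; simp add: premap_def)+

lemma mconj_eq: "mconj d M g = postmap M (premap d (madj M) g)"
  by (cases M) (simp add: mconj_def conj_map_def postmap_def premap_def madj_def rcomp_def Let_def)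

lemma hmap_mconj: "hmap d (mconj d M g) w = mact M (hmap d g (mact (madj M) w))"
  by (simp add: mconj_eq hmap_postmap hmap_premap)

lemma degree_mconj: "degree (fst (mconj d M g)) \<le> d" "degree (snd (mconj d M g)) \<le> d"
  by (simp_all add: mconj_eq degree_postmap degree_premap)

lemma rmap_eqI:
  assumes "degree (fst g) \<le> d" "degree (snd g) \<le> d" "degree (fst h) \<le> d" "degree (snd h) \<le> d"
    and "\<And>w. hmap d g w = hmap d h w"
  shows "g = h"
proof -
  have "fst g = fst h" "snd g = snd h"
    using assms by (auto intro!: hev_eqI[of _ d] simp: hmap_def)
  then show ?thesis by (simp add: prod_eq_iff)
qed

lemma mconj_id:
  assumes "degree (fst g) \<le> d" "degree (snd g) \<le> d"
  shows "mconj d (1, 0, 0, 1) g = g"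
  by (rule rmap_eqI[of _ d]) (auto simp: assms degree_mconj hmap_mconj mact_def madj_def)

lemma minRes_eq: "minRes d g = (SUP M \<in> {M. mdet M \<noteq> 0}. normRes d (mconj d M g))"
proof -
  have "{(a, b, c, e). a * e - b * c \<noteq> (0::complex)} = {M. mdet M \<noteq> 0}"
    by (auto simp: mdet_def)
  then show ?thesis unfolding minRes_def mconj_def by simp
qed

lemma normRes_mconj_bdd: "1 \<le> d \<Longrightarrow> bdd_above ((\<lambda>M. normRes d (mconj d M g)) ` {M. mdet M \<noteq> 0})"
  by (rule bdd_aboveI2[OF normRes_bounded[OF _ degree_mconj]])

lemma normRes_mconj_le_minRes: "1 \<le> d \<Longrightarrow> mdet M \<noteq> 0 \<Longrightarrow> normRes d (mconj d M g) \<le> minRes d g"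
  unfolding minRes_eq by (intro cSUP_upper normRes_mconj_bdd) auto

lemma normRes_le_minRes:
  assumes "1 \<le> d" "degree (fst g) \<le> d" "degree (snd g) \<le> d"
  shows "normRes d g \<le> minRes d g"
  using normRes_mconj_le_minRes[OF assms(1), of "(1, 0, 0, 1)" g] mconj_id[OF assms(2,3)]
  by (simp add: mdet_def)

text \<open>Positivity puts half of the supremum strictly below it, so no attainment of the supremum
  has to be shown.\<close>

lemma minRes_witness:
  assumes "1 \<le> d" "0 < minRes d g"
  obtains M where "mdet M \<noteq> 0" "minRes d g / 2 \<le> normRes d (mconj d M g)"
proof -
  have "mdet (1, 0, 0, 1) \<noteq> 0" by (simp add: mdet_def)
  then have "{M. mdet M \<noteq> 0} \<noteq> {}" by blast
  moreover have "minRes d g / 2 < (SUP M \<in> {M. mdet M \<noteq> 0}. normRes d (mconj d M g))"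
    unfolding minRes_eq[symmetric] using assms by simp
  ultimately obtain M where "mdet M \<noteq> 0" "minRes d g / 2 < normRes d (mconj d M g)"
    using less_cSUP_iff[OF _ normRes_mconj_bdd[OF assms(1)]] by blast
  then show thesis using that by fastforce
qed

section \<open>The semiconjugate normal form\<close>

lemma unit_zero_factor:
  assumes "degree F \<le> Suc d"
  obtains u v G where "cmod u ^ 2 + cmod v ^ 2 = 1" "F = [:- u, v:] * G" "degree G \<le> d"
proof -
  obtain u v where uv: "cmod u ^ 2 + cmod v ^ 2 = 1" and z: "hev (Suc d) F (u, v) = 0"
    using hev_zero_exists[OF assms] by auto
  have "(u, v) \<noteq> 0" using uv by (auto simp: zero_prod_def)
  from hev_zero_factor[OF assms z this] obtain G where "F = [:- u, v:] * G" "degree G \<le> d"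
    by (metis diff_Suc_1)
  then show thesis using that uv by blast
qed

text \<open>A reverse of submultiplicativity, obtained by splitting A into linear factors and
  removing them one at a time.\<close>

lemma pnorm_mult_lower:
  "\<exists>C>0. \<forall>A B. degree A \<le> k \<longrightarrow> degree B \<le> D \<longrightarrow> pnorm A * pnorm B \<le> C * pnorm (A * B)"
proof (induction k)
  case 0
  show ?case
  proof (intro exI[of _ 1] conjI allI impI)
    fix A B :: "complex poly" assume "degree A \<le> 0"
    then obtain p where "A = [:p:]" using degree_eq_zeroE[of A] by auto
    then show "pnorm A * pnorm B \<le> 1 * pnorm (A * B)" by (simp add: pnorm_pCons)
  qed auto
next
  case (Suc k)
  then obtain C where C: "C > 0" and IH: "\<And>A B. degree A \<le> k \<Longrightarrow> degree B \<le> D \<Longrightarrow>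
    pnorm A * pnorm B \<le> C * pnorm (A * B)" by blast
  define W where "W = 2 * real (Suc (k + D))"
  show ?case
  proof (intro exI[of _ "C * W"] conjI allI impI)
    fix A B :: "complex poly" assume A: "degree A \<le> Suc k" and B: "degree B \<le> D"
    obtain u v G where G: "A = [:- u, v:] * G" "degree G \<le> k" by (rule unit_zero_factor[OF A])
    define L where "L = [:- u, v:]"
    have "pnorm A * pnorm B \<le> (pnorm L * pnorm G) * pnorm B"
      unfolding G L_def by (intro mult_right_mono pnorm_mult) auto
    also have "\<dots> = pnorm L * (pnorm G * pnorm B)" by simp
    also have "\<dots> \<le> pnorm L * (C * pnorm (G * B))"
      using IH G B by (intro mult_left_mono) auto
    also have "\<dots> = C * (pnorm L * pnorm (G * B))" by simp
    also have "\<dots> \<le> C * (W * pnorm (L * (G * B)))"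
    proof -
      have "degree (G * B) \<le> k + D" using degree_mult_le[of G B] G B by simp
      then show ?thesis unfolding L_def W_def
        using C by (intro mult_left_mono pnorm_linear_mult) auto
    qed
    also have "\<dots> = C * W * pnorm (A * B)" unfolding G L_def by (simp only: mult.assoc)
    finally show "pnorm A * pnorm B \<le> C * W * pnorm (A * B)" .
  qed (use C in \<open>simp add: W_def\<close>)
qed

text \<open>A linear factor v X - u Y of F becomes v P - u Q, whose norm is at least |u| + |v| by
  the quantified hypothesis. Splitting F completely and reversing submultiplicativity gives the
  bound. Only quantitative linear independence of P and Q enters, so they may have common
  zeros.\<close>

lemma pnorm_hsubst_lower:
  "\<exists>C>0. \<forall>F P Q. degree F \<le> d \<longrightarrow> degree P \<le> k \<longrightarrow> degree Q \<le> k \<longrightarrow>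
     (\<forall>x y. cmod x + cmod y \<le> pnorm (smult x P + smult y Q)) \<longrightarrow>
     pnorm F \<le> C * pnorm (hsubst d F P Q)"
proof (induction d)
  case 0
  show ?case
  proof (intro exI[of _ 1] conjI allI impI)
    fix F P Q :: "complex poly" assume "degree F \<le> 0"
    then obtain p where "F = [:p:]" using degree_eq_zeroE[of F] by auto
    then show "pnorm F \<le> 1 * pnorm (hsubst 0 F P Q)" by (simp add: pnorm_pCons hsubst_def)
  qed auto
next
  case (Suc d)
  then obtain C where C: "C > 0" and IH: "\<And>F P Q. \<lbrakk>degree F \<le> d; degree P \<le> k; degree Q \<le> k;
     \<And>x y. cmod x + cmod y \<le> pnorm (smult x P + smult y Q)\<rbrakk> \<Longrightarrow>
     pnorm F \<le> C * pnorm (hsubst d F P Q)" by blast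
  obtain W where W: "W > 0" and prod: "\<And>A B. degree A \<le> k \<Longrightarrow> degree B \<le> d * k \<Longrightarrow>
    pnorm A * pnorm B \<le> W * pnorm (A * B)" using pnorm_mult_lower[of k "d * k"] by blast
  show ?case
  proof (intro exI[of _ "C * W"] conjI allI impI)
    fix F P Q :: "complex poly"
    assume F: "degree F \<le> Suc d" and P: "degree P \<le> k" and Q: "degree Q \<le> k"
      and ind: "\<forall>x y. cmod x + cmod y \<le> pnorm (smult x P + smult y Q)"
    obtain u v G where G: "F = [:- u, v:] * G" "degree G \<le> d" by (rule unit_zero_factor[OF F])
    \<comment> \<open>The linear factor v X - u Y of F evaluated at the pair (P, Q).\<close>
    define A where "A = smult v P + smult (- u) Q"
    define B where "B = hsubst d G P Q"
    have A: "degree A \<le> k" unfolding A_def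
      using P Q by (intro degree_add_le) (auto intro: order_trans[OF degree_smult_le])
    have B: "degree B \<le> d * k" unfolding B_def using P Q by (rule degree_hsubst)
    have AB: "hsubst (Suc d) F P Q = A * B"
    proof (rule hev_eqI)
      show "degree (hsubst (Suc d) F P Q) \<le> Suc d * k" using P Q by (rule degree_hsubst)
      show "degree (A * B) \<le> Suc d * k" using degree_mult_le[of A B] A B by simp
      fix w
      have "hev (Suc d * k) (hsubst (Suc d) F P Q) w = hev (1 + d) F (hev k P w, hev k Q w)"
        using hev_hsubst[OF P Q, of "Suc d" F w] by simp
      also have "\<dots> = hev 1 [:- u, v:] (hev k P w, hev k Q w) * hev d G (hev k P w, hev k Q w)"
        unfolding G(1) by (rule hev_mult) (use G in auto)
      also have "hev 1 [:- u, v:] (hev k P w, hev k Q w) = hev k A w"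
        by (simp add: hev_def[of "Suc 0"] A_def hev_add hev_diff hev_smult)
      also have "hev d G (hev k P w, hev k Q w) = hev (d * k) B w"
        unfolding B_def by (rule hev_hsubst[OF P Q, symmetric])
      also have "hev k A w * hev (d * k) B w = hev (k + d * k) (A * B) w"
        by (rule hev_mult[OF A B, symmetric])
      finally show "hev (Suc d * k) (hsubst (Suc d) F P Q) w = hev (Suc d * k) (A * B) w" by simp
    qed
    have "pnorm F \<le> pnorm [:- u, v:] * pnorm G" unfolding G(1) by (rule pnorm_mult)
    also have "\<dots> \<le> pnorm A * (C * pnorm B)"
    proof (rule mult_mono)
      show "pnorm [:- u, v:] \<le> pnorm A"
        using ind[rule_format, of v "- u"] unfolding pnorm_linear A_def by (simp add: add.commute)
      show "pnorm G \<le> C * pnorm B" unfolding B_def using IH[OF G(2) P Q] ind by blast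
    qed auto
    also have "\<dots> = C * (pnorm A * pnorm B)" by simp
    also have "\<dots> \<le> C * (W * pnorm (A * B))" using C by (intro mult_left_mono prod A B) auto
    finally show "pnorm F \<le> C * W * pnorm (hsubst (Suc d) F P Q)" by (simp add: AB mult.assoc)
  qed (use C W in simp)
qed

section \<open>Minors of the coefficient matrix\<close>

definition minor :: "rmap \<Rightarrow> nat \<Rightarrow> nat \<Rightarrow> complex" where
  "minor h i j = coeff (fst h) i * coeff (snd h) j - coeff (fst h) j * coeff (snd h) i"

text \<open>The adjugate of the block with columns i and j of the coefficient matrix, whose rows are
  \<open>fst h\<close> and \<open>snd h\<close>. It sends column k to two minors, one per replaced
  column.\<close>

definition minor_mat :: "rmap \<Rightarrow> nat \<Rightarrow> nat \<Rightarrow> complex \<times> complex \<times> complex \<times> complex" where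
  "minor_mat h i j = (coeff (snd h) j, - coeff (fst h) j, - coeff (snd h) i, coeff (fst h) i)"

lemma mdet_minor_mat: "mdet (minor_mat h i j) = minor h i j"
  by (simp add: mdet_def minor_mat_def minor_def mult.commute)

lemma mact_minor_mat:
  "mact (minor_mat h i j) (coeff (fst h) k, coeff (snd h) k) = (minor h k j, minor h i k)"
  by (simp add: mact_def minor_mat_def minor_def algebra_simps)

lemma coeff_postmap:
  "(coeff (fst (postmap M h)) k, coeff (snd (postmap M h)) k) = mact M (coeff (fst h) k, coeff (snd h) k)"
  by (cases M) (simp add: postmap_def mact_def)

lemma maximal_minor:
  obtains i j where "i \<le> d" "j \<le> d" "\<And>k l. k \<le> d \<Longrightarrow> l \<le> d \<Longrightarrow> cmod (minor h k l) \<le> cmod (minor h i j)"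
proof -
  define f where "f = (\<lambda>(i, j). cmod (minor h i j))"
  have "finite (f ` ({..d} \<times> {..d}))" "f ` ({..d} \<times> {..d}) \<noteq> {}" by auto
  from Max_in[OF this] obtain x where x: "Max (f ` ({..d} \<times> {..d})) = f x" "x \<in> {..d} \<times> {..d}"
    by (rule imageE)
  have "f y \<le> f x" if "y \<in> {..d} \<times> {..d}" for y
    unfolding x(1)[symmetric] using that by (intro Max_ge) auto
  then show thesis using that[of "fst x" "snd x"] x(2) by (force simp: f_def split: prod.splits)
qed

text \<open>Vanishing minors make the two forms proportional, so a zero of one that is not
  identically 0 is a zero of both.\<close>

lemma hmap_zero_if_minors_zero:
  assumes d: "1 \<le> d" and h: "degree (fst h) \<le> d" "degree (snd h) \<le> d"
    and z: "\<And>k l. k \<le> d \<Longrightarrow> l \<le> d \<Longrightarrow> minor h k l = 0"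
  shows "\<exists>w. norm w = 1 \<and> hmap d h w = 0"
proof (cases "fst h = 0")
  case True
  obtain u v where "cmod u ^ 2 + cmod v ^ 2 = 1" "hev d (snd h) (u, v) = 0"
    using hev_zero_exists[OF h(2) d] by blast
  then show ?thesis using True
    by (intro exI[of _ "(u, v)"]) (auto simp: hmap_def norm_Pair zero_prod_def)
next
  case False
  define k where "k = degree (fst h)"
  have k: "coeff (fst h) k \<noteq> 0" "k \<le> d" using False h by (simp_all add: k_def)
  obtain u v where uv: "cmod u ^ 2 + cmod v ^ 2 = 1" "hev d (fst h) (u, v) = 0"
    using hev_zero_exists[OF h(1) d] by blast
  have "coeff (fst h) k * hev d (snd h) (u, v) = coeff (snd h) k * hev d (fst h) (u, v)"
    unfolding hev_def sum_distrib_left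
  proof (intro sum.cong refl)
    fix l assume "l \<in> {..d}"
    then have "coeff (fst h) k * coeff (snd h) l = coeff (snd h) k * coeff (fst h) l"
      using z[of k l] k by (simp add: minor_def)
    then show "coeff (fst h) k * (coeff (snd h) l * fst (u, v) ^ l * snd (u, v) ^ (d - l))
        = coeff (snd h) k * (coeff (fst h) l * fst (u, v) ^ l * snd (u, v) ^ (d - l))"
      by (simp only: mult.assoc[symmetric])
  qed
  then have "hev d (snd h) (u, v) = 0" using uv k by simp
  then show ?thesis using uv
    by (intro exI[of _ "(u, v)"]) (auto simp: hmap_def norm_Pair zero_prod_def)
qed

text \<open>Surjectivity on the projective line: the point is a zero of the form obtained by pairing
  h with w. The value \<kappa> = 0, a common zero of h, is allowed. This transfers lower bounds for
  a composition to its outer factor.\<close>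

lemma hmap_attains_direction:
  assumes d: "1 \<le> d" and h: "degree (fst h) \<le> d" "degree (snd h) \<le> d" and w: "norm w = 1"
  obtains v \<kappa> where "norm v = 1" "hmap d h v = cscale \<kappa> w"
proof -
  define F where "F = smult (snd w) (fst h) - smult (fst w) (snd h)"
  have "degree F \<le> d" unfolding F_def
    using h by (intro degree_diff_le) (auto intro: order_trans[OF degree_smult_le])
  then obtain x y where xy: "cmod x ^ 2 + cmod y ^ 2 = 1" "hev d F (x, y) = 0"
    using hev_zero_exists d by blast
  have eq: "snd w * hev d (fst h) (x, y) = fst w * hev d (snd h) (x, y)"
    using xy(2) by (simp add: F_def hev_diff hev_smult)
  have "norm (x, y) = 1" using xy by (simp add: norm_Pair)
  moreover have "\<exists>\<kappa>. hmap d h (x, y) = cscale \<kappa> w"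
  proof (cases "fst w = 0")
    case True
    then have "snd w \<noteq> 0" using w by (metis norm_zero prod_eq_iff fst_zero snd_zero zero_neq_one)
    then show ?thesis using eq True
      by (intro exI[of _ "hev d (snd h) (x, y) / snd w"]) (simp add: hmap_def cscale_def)
  next
    case False
    then show ?thesis using eq
      by (intro exI[of _ "hev d (fst h) (x, y) / fst w"]) (simp add: hmap_def cscale_def field_simps)
  qed
  ultimately show thesis using that by blast
qed

text \<open>Spares an n-th root: for y at most 1 the sharper bound y^(1/n) may be weakened to
  y.\<close>

lemma root_bound:
  fixes x y :: real
  assumes "1 \<le> n" "0 \<le> x" "y \<le> 1" "y \<le> x ^ n"
  shows "y \<le> x"
proof (rule ccontr)
  assume "\<not> y \<le> x"
  then have "x ^ n \<le> x ^ 1" using assms by (intro power_decreasing) auto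
  then show False using \<open>\<not> y \<le> x\<close> assms by simp
qed

text \<open>The conjugating matrix is, up to a scalar, the inverse of the \<open>2 \<times> 2\<close> block of the coefficient matrix of
  \<open>h2\<close> on which the minor is maximal: after applying it all coefficients are bounded by \<open>1\<close> and the
  block becomes the identity, so substitution into a form decreases its norm by at most a constant factor.\<close>
lemma semiconjugate_distortion:
  assumes d: "1 \<le> d1" "1 \<le> d2"
  shows "\<exists>c. 0 < c \<and> (\<forall>h1 h2 a b. degree (fst h1) \<le> d1 \<longrightarrow> degree (snd h1) \<le> d1 \<longrightarrow>
      degree (fst h2) \<le> d2 \<longrightarrow> degree (snd h2) \<le> d2 \<longrightarrow> 0 < a \<longrightarrow>
      (\<forall>w. norm w = 1 \<longrightarrow> a \<le> norm (hmap d1 h1 (hmap d2 h2 w)) \<and> norm (hmap d1 h1 (hmap d2 h2 w)) \<le> b) \<longrightarrow>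
      (\<exists>i\<le>d2. \<exists>j\<le>d2. \<exists>s>0. minor h2 i j \<noteq> 0 \<and>
         (\<forall>k\<le>d2. \<forall>l\<le>d2. cmod (minor h2 k l) \<le> cmod (minor h2 i j)) \<and>
         (\<forall>w. norm w = 1 \<longrightarrow>
            s * (c * (a / b) ^ Suc d2) \<le> norm (hmap (d2 * d1) (mconj (d2 * d1) (minor_mat h2 i j) (rcomp d2 h2 h1)) w) \<and>
            norm (hmap (d2 * d1) (mconj (d2 * d1) (minor_mat h2 i j) (rcomp d2 h2 h1)) w) \<le> s)))"
proof -
  obtain K where K: "K > 0" and sup: "\<And>h b. degree (fst h) \<le> d1 * d2 \<Longrightarrow> degree (snd h) \<le> d1 * d2 \<Longrightarrow>
      (\<And>w. norm w = 1 \<Longrightarrow> norm (hmap (d1 * d2) h w) \<le> b) \<Longrightarrow> maxcoef (d1 * d2) h \<le> K * b"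
    using maxcoef_le_sup[of "d1 * d2"] by blast
  obtain C3 where C3: "C3 > 0" and sub: "\<And>F P Q. \<lbrakk>degree F \<le> d1; degree P \<le> d2; degree Q \<le> d2;
     \<And>x y. cmod x + cmod y \<le> pnorm (smult x P + smult y Q)\<rbrakk> \<Longrightarrow>
     pnorm F \<le> C3 * pnorm (hsubst d1 F P Q)"
    using pnorm_hsubst_lower[of d1 d2] by blast
  define C2 where "C2 = 2 * real (Suc d2)"
  define C1 where "C1 = 1 + 2 * real (Suc d1) * (C3 * (real (Suc (d1 * d2)) * K))"
  have C2: "C2 \<ge> 1" by (simp add: C2_def)
  have C1: "C1 \<ge> 1" using C3 K by (simp add: C1_def)
  \<comment> \<open>The lower bound y (a / C2^d1)^d2 for h2' o h1', with y = a / (C1 b), divided by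
    its upper bound C2 (C1 b)^d2 is exactly c (a/b)^(d2+1). The summand 1 in \<open>C1\<close>
    ensures y <= 1.\<close>
  define c where "c = 1 / (C1 * (C2 ^ d1) ^ d2 * (C2 * C1 ^ d2))"
  show ?thesis
  proof (intro exI[of _ c] conjI allI impI)
    show "0 < c" using C1 C2 by (simp add: c_def)
    fix h1 h2 :: rmap and a b :: real
    assume h1: "degree (fst h1) \<le> d1" "degree (snd h1) \<le> d1"
      and h2: "degree (fst h2) \<le> d2" "degree (snd h2) \<le> d2" and a: "0 < a"
      and ab: "\<forall>w. norm w = 1 \<longrightarrow> a \<le> norm (hmap d1 h1 (hmap d2 h2 w)) \<and> norm (hmap d1 h1 (hmap d2 h2 w)) \<le> b"
    have "a \<le> b" using ab[rule_format, of "(1, 0)"] by (simp add: norm_Pair)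
    then have b: "b > 0" using a by linarith
    obtain i j where ij: "i \<le> d2" "j \<le> d2"
      and max: "\<And>k l. k \<le> d2 \<Longrightarrow> l \<le> d2 \<Longrightarrow> cmod (minor h2 k l) \<le> cmod (minor h2 i j)"
      using maximal_minor[of d2 h2] by blast
    define D where "D = minor h2 i j"
    define N where "N = minor_mat h2 i j"
    have D: "D \<noteq> 0"
    proof
      assume "D = 0"
      then have "minor h2 k l = 0" if "k \<le> d2" "l \<le> d2" for k l
        using max[OF that] by (simp add: D_def)
      from hmap_zero_if_minors_zero[OF d(2) h2 this] obtain w where w: "norm w = 1" "hmap d2 h2 w = 0"
        by blast
      have "hmap d1 h1 0 = 0"
        using hmap_cscale[of d1 h1 0 0] d by (simp add: cscale_def power_0_left flip: zero_prod_def)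
      then show False using ab[rule_format, OF w(1)] w(2) a by simp
    qed
    define P where "P = smult (1 / D) (fst (postmap N h2))"
    define Q where "Q = smult (1 / D) (snd (postmap N h2))"
    define h2' where "h2' = (P, Q)"
    have H2': "hmap d2 h2' w = cscale (1 / D) (mact N (hmap d2 h2 w))" for w
      unfolding h2'_def P_def Q_def hmap_smult by (simp add: hmap_postmap)
    have P: "degree P \<le> d2" and Q: "degree Q \<le> d2"
      using degree_postmap[OF h2, of N]
      by (auto simp: P_def Q_def intro: order_trans[OF degree_smult_le])
    have cP: "coeff P k = minor h2 k j / D" and cQ: "coeff Q k = minor h2 i k / D" for k
      using coeff_postmap[of N h2 k] by (simp_all add: P_def Q_def N_def mact_minor_mat)
    have "maxcoef d2 h2' \<le> 1"
      using max ij D by (intro maxcoef_le) (auto simp: h2'_def cP cQ D_def norm_divide)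
    then have C2m: "2 * real (Suc d2) * maxcoef d2 h2' \<le> C2" by (simp add: C2_def)
    have H2'_up: "norm (hmap d2 h2' w) \<le> C2 * norm w ^ d2" for w
    proof -
      have "norm (hmap d2 h2' w) \<le> 2 * real (Suc d2) * maxcoef d2 h2' * norm w ^ d2"
        by (rule norm_hmap_le) (simp_all add: h2'_def P Q)
      also have "\<dots> \<le> C2 * norm w ^ d2" using C2m by (rule mult_right_mono) simp
      finally show ?thesis .
    qed
    have "i \<noteq> j" using D by (auto simp: D_def minor_def)
    have ind: "cmod x + cmod y \<le> pnorm (smult x P + smult y Q)" for x y
    proof -
      define R where "R = smult x P + smult y Q"
      have "minor h2 i i = 0" "minor h2 j j = 0" by (simp_all add: minor_def)
      then have "coeff R i = x" "coeff R j = y"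
        using D by (simp_all add: R_def cP cQ flip: D_def)
      then have "cmod x + cmod y = (\<Sum>k\<in>{i, j}. cmod (coeff R k))" using \<open>i \<noteq> j\<close> by simp
      also have "\<dots> \<le> (\<Sum>k\<le>d2. cmod (coeff R k))" using ij by (intro sum_mono2) auto
      also have "\<dots> = pnorm R" unfolding R_def
        by (intro pnorm_eq[symmetric] degree_add_le) (auto intro: order_trans[OF degree_smult_le] P Q)
      finally show ?thesis by (simp add: R_def)
    qed
    \<comment> \<open>The adjugate of N contributes the scalar \<open>mdet N = D\<close>, which
      cancels the 1/D in \<open>h2'\<close>; thus h1' o h2' equals h1 o h2 on the nose.\<close>
    define h1' where "h1' = premap d1 (madj N) h1"
    have H1': "hmap d1 h1' w = hmap d1 h1 (mact (madj N) w)" for w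
      by (simp add: h1'_def hmap_premap)
    have h1': "degree (fst h1') \<le> d1" "degree (snd h1') \<le> d1" by (simp_all add: h1'_def degree_premap)
    have mdetN: "mdet N = D" by (simp add: N_def D_def mdet_minor_mat)
    have f: "hmap d1 h1' (hmap d2 h2' w) = hmap d1 h1 (hmap d2 h2 w)" for w
      using D by (simp add: H1' H2' mact_cscale mact_madj mdetN)
    have h2'_deg: "degree (fst h2') \<le> d2" "degree (snd h2') \<le> d2" using P Q by (simp_all add: h2'_def)
    have fdeg: "degree (fst (rcomp d1 h1' h2')) \<le> d1 * d2" "degree (snd (rcomp d1 h1' h2')) \<le> d1 * d2"
      using degree_rcomp[OF h2'_deg] by auto
    have fmax: "maxcoef (d1 * d2) (rcomp d1 h1' h2') \<le> K * b"
    proof (rule sup[OF fdeg])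
      fix w :: "complex \<times> complex" assume "norm w = 1"
      with ab show "norm (hmap (d1 * d2) (rcomp d1 h1' h2') w) \<le> b"
        unfolding hmap_rcomp[OF h2'_deg] f by blast
    qed
    define E where "E = C3 * (real (Suc (d1 * d2)) * (K * b))"
    have coef: "cmod (coeff F k) \<le> E" if F: "F = fst h1' \<or> F = snd h1'" for F k
    proof -
      have "hsubst d1 F P Q = fst (rcomp d1 h1' h2') \<or> hsubst d1 F P Q = snd (rcomp d1 h1' h2')"
        using F by (auto simp: rcomp_def h2'_def)
      then have "pnorm (hsubst d1 F P Q) \<le> real (Suc (d1 * d2)) * maxcoef (d1 * d2) (rcomp d1 h1' h2')"
        using pnorm_le_coeff_bound[OF fdeg(1) coeff_le_maxcoef(1)] pnorm_le_coeff_bound[OF fdeg(2) coeff_le_maxcoef(2)]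
        by auto
      also have "\<dots> \<le> real (Suc (d1 * d2)) * (K * b)" using fmax by (intro mult_left_mono) auto
      finally have "C3 * pnorm (hsubst d1 F P Q) \<le> E" unfolding E_def using C3 by (intro mult_left_mono) auto
      moreover have "pnorm F \<le> C3 * pnorm (hsubst d1 F P Q)" using F h1' P Q ind by (intro sub) auto
      ultimately show ?thesis using coeff_le_pnorm[of F k] by linarith
    qed
    have H1'_up: "norm (hmap d1 h1' w) \<le> C1 * b * norm w ^ d1" for w
    proof -
      have "2 * real (Suc d1) * maxcoef d1 h1' \<le> 2 * real (Suc d1) * E"
        using coef by (intro mult_left_mono maxcoef_le) auto
      also have "\<dots> \<le> C1 * b" using b by (simp add: C1_def E_def algebra_simps)
      finally have "2 * real (Suc d1) * maxcoef d1 h1' * norm w ^ d1 \<le> C1 * b * norm w ^ d1"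
        by (intro mult_right_mono) auto
      then show ?thesis using norm_hmap_le[OF h1', of w] by linarith
    qed
    define y where "y = a / (C1 * b)"
    have y: "0 < y" using a b C1 by (simp add: y_def)
    have "b \<le> C1 * b" using b C1 by simp
    then have "a \<le> C1 * b" using \<open>a \<le> b\<close> by linarith
    then have "y \<le> 1" unfolding y_def using b C1 by (simp add: divide_le_eq)
    \<comment> \<open>The outer factor grows at most like C1 b |v|^d1, so a value of f of norm at
      least a forces the inner value v to be large.\<close>
    have H2'_low1: "y \<le> norm (hmap d2 h2' w)" if w: "norm w = 1" for w
    proof (rule root_bound[OF d(1) _ \<open>y \<le> 1\<close>])
      have "a \<le> C1 * b * norm (hmap d2 h2' w) ^ d1"
        using ab[rule_format, OF w] H1'_up[of "hmap d2 h2' w"] unfolding f by linarith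
      then show "y \<le> norm (hmap d2 h2' w) ^ d1"
        unfolding y_def using C1 b by (simp add: divide_le_eq mult_ac)
    qed auto
    have H2'_low: "y * norm w ^ d2 \<le> norm (hmap d2 h2' w)" if "w \<noteq> 0" for w
      by (rule norm_hmap_lower[OF H2'_low1 that])
    \<comment> \<open>Every direction w is attained by h2' at some unit vector v, so the lower bound
      for f at v descends to h1' at w.\<close>
    have H1'_low: "a / C2 ^ d1 \<le> norm (hmap d1 h1' w)" if w: "norm w = 1" for w
    proof -
      obtain v \<kappa> where v: "norm v = 1" "hmap d2 h2' v = cscale \<kappa> w"
        by (rule hmap_attains_direction[OF d(2) h2'_deg w])
      have "cmod \<kappa> \<le> C2" using H2'_up[of v] v w by simp
      have "a \<le> norm (hmap d1 h1' (hmap d2 h2' v))" unfolding f using ab v(1) by blast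
      also have "\<dots> = cmod \<kappa> ^ d1 * norm (hmap d1 h1' w)" by (simp add: v hmap_cscale norm_power)
      also have "\<dots> \<le> C2 ^ d1 * norm (hmap d1 h1' w)"
        using \<open>cmod \<kappa> \<le> C2\<close> by (intro mult_right_mono power_mono) auto
      finally show ?thesis using C2 by (simp add: divide_le_eq mult.commute)
    qed
    \<comment> \<open>In the reverse order the same normalised factors compose to the conjugate of
      g; the single remaining scalar D is absorbed in s.\<close>
    have G: "norm (hmap (d2 * d1) (mconj (d2 * d1) N (rcomp d2 h2 h1)) w)
        = cmod D * norm (hmap d2 h2' (hmap d1 h1' w))" for w
      using D by (simp add: hmap_mconj hmap_rcomp[OF h1] H2' H1' norm_divide)
    define s where "s = cmod D * (C2 * (C1 * b) ^ d2)"
    have s: "s > 0" using D C1 C2 b by (simp add: s_def)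
    have main: "s * (c * (a / b) ^ Suc d2) \<le> norm (hmap (d2 * d1) (mconj (d2 * d1) N (rcomp d2 h2 h1)) w) \<and>
        norm (hmap (d2 * d1) (mconj (d2 * d1) N (rcomp d2 h2 h1)) w) \<le> s" if w: "norm w = 1" for w
    proof
      define v where "v = hmap d1 h1' w"
      have v1: "a / C2 ^ d1 \<le> norm v" "norm v \<le> C1 * b"
        using H1'_low[OF w] H1'_up[of w] w by (simp_all add: v_def)
      have "0 < a / C2 ^ d1" using a C2 by simp
      then have v0: "v \<noteq> 0" using v1 by auto
      have "norm (hmap d2 h2' v) \<le> C2 * norm v ^ d2" by (rule H2'_up)
      also have "\<dots> \<le> C2 * (C1 * b) ^ d2" using v1 C2 by (intro mult_left_mono power_mono) auto
      finally show "norm (hmap (d2 * d1) (mconj (d2 * d1) N (rcomp d2 h2 h1)) w) \<le> s"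
        unfolding G s_def v_def by (intro mult_left_mono) auto
      have "y * (a / C2 ^ d1) ^ d2 \<le> y * norm v ^ d2"
        using v1 y \<open>0 < a / C2 ^ d1\<close> by (intro mult_left_mono power_mono) auto
      also have "\<dots> \<le> norm (hmap d2 h2' v)" by (rule H2'_low[OF v0])
      finally have "cmod D * (y * (a / C2 ^ d1) ^ d2) \<le> cmod D * norm (hmap d2 h2' v)"
        by (intro mult_left_mono) auto
      moreover have "s * (c * (a / b) ^ Suc d2) = cmod D * (y * (a / C2 ^ d1) ^ d2)"
        using C1 C2 b unfolding s_def c_def y_def power_mult_distrib power_divide
        by (simp add: field_simps)
      ultimately show "s * (c * (a / b) ^ Suc d2)
          \<le> norm (hmap (d2 * d1) (mconj (d2 * d1) N (rcomp d2 h2 h1)) w)"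
        unfolding G v_def by simp
    qed
    show "\<exists>i\<le>d2. \<exists>j\<le>d2. \<exists>s>0. minor h2 i j \<noteq> 0 \<and>
         (\<forall>k\<le>d2. \<forall>l\<le>d2. cmod (minor h2 k l) \<le> cmod (minor h2 i j)) \<and>
         (\<forall>w. norm w = 1 \<longrightarrow>
            s * (c * (a / b) ^ Suc d2) \<le> norm (hmap (d2 * d1) (mconj (d2 * d1) (minor_mat h2 i j) (rcomp d2 h2 h1)) w) \<and>
            norm (hmap (d2 * d1) (mconj (d2 * d1) (minor_mat h2 i j) (rcomp d2 h2 h1)) w) \<le> s)"
      using ij s D max main unfolding D_def N_def by blast
  qed
qed

text \<open>Only the ratio a/b is prescribed, since \<open>normRes\<close> sees h up to scaling;
  both bounds are multiples of \<open>maxcoef\<close>.\<close>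

lemma hmap_bounds_of_normRes:
  assumes d: "1 \<le> d"
  shows "\<exists>c. 0 < c \<and> (\<forall>h r. degree (fst h) \<le> d \<longrightarrow> degree (snd h) \<le> d \<longrightarrow> 0 < r \<longrightarrow> r \<le> normRes d h \<longrightarrow>
    (\<exists>a b. 0 < a \<and> a / b = c * r \<and> (\<forall>w. norm w = 1 \<longrightarrow> a \<le> norm (hmap d h w) \<and> norm (hmap d h w) \<le> b)))"
proof -
  define X where "X = (fact (2 * d) * 2 ^ (2 * d) :: real)"
  define Y where "Y = 2 * real (Suc d)"
  have X: "X > 0" by (simp add: X_def)
  have Y: "Y > 0" by (simp add: Y_def)
  show ?thesis
  proof (rule exI[of _ "1 / (X * Y)"], intro conjI allI impI)
    fix h :: rmap and r :: real
    assume h: "degree (fst h) \<le> d" "degree (snd h) \<le> d" and r: "0 < r" "r \<le> normRes d h"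
    define m where "m = maxcoef d h"
    have "m \<noteq> 0" using r d by (auto simp: m_def normRes_def power_0_left)
    then have m: "m > 0" using maxcoef_nonneg[of d h] unfolding m_def by linarith
    show "\<exists>a b. 0 < a \<and> a / b = 1 / (X * Y) * r \<and>
        (\<forall>w. norm w = 1 \<longrightarrow> a \<le> norm (hmap d h w) \<and> norm (hmap d h w) \<le> b)"
    proof (rule exI[of _ "r / X * m"], rule exI[of _ "Y * m"], intro conjI allI impI)
      fix w :: "complex \<times> complex" assume w: "norm w = 1"
      then have "w \<noteq> 0" by auto
      have "r / X * m \<le> normRes d h / X * m"
        using r X m by (intro mult_right_mono divide_right_mono) auto
      also have "\<dots> \<le> norm (hmap d h w)"
        using normRes_le_norm_hmap[OF d h \<open>w \<noteq> 0\<close>] w by (simp add: X_def m_def)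
      finally show "r / X * m \<le> norm (hmap d h w)" .
      show "norm (hmap d h w) \<le> Y * m"
        using norm_hmap_le[OF h, of w] w by (simp add: Y_def m_def del: of_nat_Suc)
    qed (use r X Y m in auto)
  qed (use X Y in simp)
qed

text \<open>The normal form is applied to a nearly optimal conjugate of f. In the exponent, n = d2 +
  1 is the loss of the normal form and k the loss in returning from distortion to the
  resultant.\<close>

lemma minRes_comp_commute:
  assumes d: "1 \<le> d1" "1 \<le> d2"
  shows "\<exists>c k. 0 < c \<and> (\<forall>h1 h2. degree (fst h1) \<le> d1 \<longrightarrow> degree (snd h1) \<le> d1 \<longrightarrow>
      degree (fst h2) \<le> d2 \<longrightarrow> degree (snd h2) \<le> d2 \<longrightarrow> 0 < minRes (d1 * d2) (rcomp d1 h1 h2) \<longrightarrow>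
      c * minRes (d1 * d2) (rcomp d1 h1 h2) ^ k \<le> minRes (d2 * d1) (rcomp d2 h2 h1))"
proof -
  have dd: "1 \<le> d1 * d2" "1 \<le> d2 * d1" using d by (auto simp: Suc_le_eq)
  obtain c1 where c1: "c1 > 0" and bounds: "\<And>h r. \<lbrakk>degree (fst h) \<le> d1 * d2; degree (snd h) \<le> d1 * d2;
      0 < r; r \<le> normRes (d1 * d2) h\<rbrakk> \<Longrightarrow>
      \<exists>a b. 0 < a \<and> a / b = c1 * r \<and> (\<forall>w. norm w = 1 \<longrightarrow> a \<le> norm (hmap (d1 * d2) h w) \<and> norm (hmap (d1 * d2) h w) \<le> b)"
    using hmap_bounds_of_normRes[OF dd(1)] by blast
  obtain c2 where c2: "c2 > 0" and core: "\<And>h1 h2 a b. \<lbrakk>degree (fst h1) \<le> d1; degree (snd h1) \<le> d1;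
      degree (fst h2) \<le> d2; degree (snd h2) \<le> d2; 0 < a;
      \<forall>w. norm w = 1 \<longrightarrow> a \<le> norm (hmap d1 h1 (hmap d2 h2 w)) \<and> norm (hmap d1 h1 (hmap d2 h2 w)) \<le> b\<rbrakk> \<Longrightarrow>
      (\<exists>i\<le>d2. \<exists>j\<le>d2. \<exists>s>0. minor h2 i j \<noteq> 0 \<and>
         (\<forall>k\<le>d2. \<forall>l\<le>d2. cmod (minor h2 k l) \<le> cmod (minor h2 i j)) \<and>
         (\<forall>w. norm w = 1 \<longrightarrow>
            s * (c2 * (a / b) ^ Suc d2) \<le> norm (hmap (d2 * d1) (mconj (d2 * d1) (minor_mat h2 i j) (rcomp d2 h2 h1)) w) \<and>
            norm (hmap (d2 * d1) (mconj (d2 * d1) (minor_mat h2 i j) (rcomp d2 h2 h1)) w) \<le> s))"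
    using semiconjugate_distortion[OF d] by blast
  obtain c3 k where c3: "c3 > 0" and low: "\<And>h a b. \<lbrakk>degree (fst h) \<le> d2 * d1; degree (snd h) \<le> d2 * d1; 0 < a;
      \<forall>w. norm w = 1 \<longrightarrow> a \<le> norm (hmap (d2 * d1) h w) \<and> norm (hmap (d2 * d1) h w) \<le> b\<rbrakk> \<Longrightarrow>
      c3 * (a / b) ^ k \<le> normRes (d2 * d1) h"
    using normRes_lower[OF dd(2)] by blast
  define n where "n = Suc d2"
  show ?thesis
  proof (intro exI[of _ "c3 * (c2 * (c1 / 2) ^ n) ^ k"] exI[of _ "n * k"] conjI allI impI)
    fix h1 h2 :: rmap
    assume h1: "degree (fst h1) \<le> d1" "degree (snd h1) \<le> d1"
      and h2: "degree (fst h2) \<le> d2" "degree (snd h2) \<le> d2"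
    define f where "f = rcomp d1 h1 h2"
    define g where "g = rcomp d2 h2 h1"
    assume "0 < minRes (d1 * d2) (rcomp d1 h1 h2)"
    then have pos: "0 < minRes (d1 * d2) f" by (simp add: f_def)
    define \<rho> where "\<rho> = minRes (d1 * d2) f"
    obtain M where M: "mdet M \<noteq> 0" "\<rho> / 2 \<le> normRes (d1 * d2) (mconj (d1 * d2) M f)"
      using minRes_witness[OF dd(1) pos] unfolding \<rho>_def by blast
    have "0 < \<rho> / 2" using pos by (simp add: \<rho>_def)
    from bounds[OF degree_mconj this M(2)] obtain a b where ab: "0 < a" "a / b = c1 * (\<rho> / 2)"
      "\<forall>w. norm w = 1 \<longrightarrow> a \<le> norm (hmap (d1 * d2) (mconj (d1 * d2) M f) w) \<and> norm (hmap (d1 * d2) (mconj (d1 * d2) M f) w) \<le> b"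
      by blast
    \<comment> \<open>The conjugation is distributed over the factors, M o h1 and h2 o M^-1. In the
      reverse order M cancels, which leaves g.\<close>
    define F1 where "F1 = postmap M h1"
    define F2 where "F2 = premap d2 (madj M) h2"
    have F1: "degree (fst F1) \<le> d1" "degree (snd F1) \<le> d1" using degree_postmap[OF h1] by (auto simp: F1_def)
    have F2: "degree (fst F2) \<le> d2" "degree (snd F2) \<le> d2" using degree_premap by (auto simp: F2_def)
    have eq: "hmap (d1 * d2) (mconj (d1 * d2) M f) w = hmap d1 F1 (hmap d2 F2 w)" for w
      by (simp add: hmap_mconj f_def hmap_rcomp[OF h2] F1_def F2_def hmap_postmap hmap_premap)
    from core[OF F1 F2 ab(1) ab(3)[unfolded eq]] obtain i j s where s: "s > 0" "minor F2 i j \<noteq> 0"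
      and s_bds: "\<forall>w. norm w = 1 \<longrightarrow>
            s * (c2 * (a / b) ^ n) \<le> norm (hmap (d2 * d1) (mconj (d2 * d1) (minor_mat F2 i j) (rcomp d2 F2 F1)) w) \<and>
            norm (hmap (d2 * d1) (mconj (d2 * d1) (minor_mat F2 i j) (rcomp d2 F2 F1)) w) \<le> s"
      unfolding n_def by blast
    define N where "N = minor_mat F2 i j"
    \<comment> \<open>The adjugate followes M inside h2, so the scalar \<open>mdet M\<close> passes
      through a map homogeneous of degree d2.\<close>
    define \<mu> where "\<mu> = mdet M ^ d2"
    have \<mu>: "\<mu> \<noteq> 0" using M by (simp add: \<mu>_def)
    have G: "hmap (d2 * d1) (mconj (d2 * d1) N (rcomp d2 F2 F1)) w = cscale \<mu> (hmap (d2 * d1) (mconj (d2 * d1) N g) w)" for w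
      unfolding hmap_mconj hmap_rcomp[OF F1] g_def hmap_rcomp[OF h1]
      by (simp add: F1_def F2_def hmap_postmap hmap_premap mact_madj hmap_cscale mact_cscale \<mu>_def)
    have "c3 * ((s / cmod \<mu> * (c2 * (a / b) ^ n)) / (s / cmod \<mu>)) ^ k \<le> normRes (d2 * d1) (mconj (d2 * d1) N g)"
    proof (rule low[OF degree_mconj])
      have "0 < a / b" unfolding ab(2) using \<open>0 < \<rho> / 2\<close> c1 by (rule mult_pos_pos[rotated])
      then show "0 < s / cmod \<mu> * (c2 * (a / b) ^ n)" using s \<mu> c2 by simp
      show "\<forall>w. norm w = 1 \<longrightarrow> s / cmod \<mu> * (c2 * (a / b) ^ n) \<le> norm (hmap (d2 * d1) (mconj (d2 * d1) N g) w) \<and>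
          norm (hmap (d2 * d1) (mconj (d2 * d1) N g) w) \<le> s / cmod \<mu>"
        using s_bds \<mu> unfolding N_def[symmetric] G norm_cscale
        by (simp add: divide_le_eq le_divide_eq mult.commute)
    qed
    also have "\<dots> \<le> minRes (d2 * d1) g"
      using s by (intro normRes_mconj_le_minRes dd) (simp add: N_def mdet_minor_mat)
    also have "(s / cmod \<mu> * (c2 * (a / b) ^ n)) / (s / cmod \<mu>) = c2 * (a / b) ^ n" using s \<mu> by simp
    also have "\<dots> = c2 * (c1 / 2) ^ n * \<rho> ^ n" unfolding ab(2)
      by (simp add: power_mult_distrib power_divide)
    also have "c3 * (c2 * (c1 / 2) ^ n * \<rho> ^ n) ^ k = c3 * (c2 * (c1 / 2) ^ n) ^ k * \<rho> ^ (n * k)"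
      by (simp only: power_mult_distrib power_mult mult.assoc)
    finally show "c3 * (c2 * (c1 / 2) ^ n) ^ k * minRes (d1 * d2) (rcomp d1 h1 h2) ^ (n * k)
        \<le> minRes (d2 * d1) (rcomp d2 h2 h1)"
      by (simp add: \<rho>_def f_def g_def)
  qed (use c1 c2 c3 in simp)
qed

section \<open>Positivity of the normalised resultants\<close>

lemma is_ratmap_degree: "is_ratmap d h \<Longrightarrow> degree (fst h) \<le> d" "is_ratmap d h \<Longrightarrow> degree (snd h) \<le> d"
  by (simp_all add: is_ratmap_def)

lemma is_ratmap_maxcoef_pos:
  assumes d: "1 \<le> d" and h: "is_ratmap d h"
  shows "0 < maxcoef d h"
proof -
  have "maxcoef d h \<noteq> 0"
  proof
    assume z: "maxcoef d h = 0"
    then have "fst h = smult 0 0" "snd h = smult 0 0"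
      using coeff_le_maxcoef_deg[of h d] is_ratmap_degree[OF h] by (auto intro!: poly_eqI)
    then have "hres d (fst h) (snd h) = 0" using hres_smult[of d 0 0 0] d by (simp add: power_0_left)
    then show False using h by (simp add: is_ratmap_def)
  qed
  then show ?thesis using maxcoef_nonneg[of d h] by linarith
qed

lemma is_ratmap_normRes_pos: "1 \<le> d \<Longrightarrow> is_ratmap d h \<Longrightarrow> 0 < normRes d h"
  using is_ratmap_maxcoef_pos[of d h] by (simp add: normRes_def is_ratmap_def)

text \<open>Lifts bounded away from 0 on the sphere compose to such a lift, and this is equivalent
  to a positive resultant.\<close>

lemma normRes_rcomp_pos:
  assumes d: "1 \<le> d1" "1 \<le> d2" and h1: "is_ratmap d1 h1" and h2: "is_ratmap d2 h2"
  shows "0 < normRes (d1 * d2) (rcomp d1 h1 h2)"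
proof -
  have dd: "1 \<le> d1 * d2" using d by (auto simp: Suc_le_eq)
  obtain a1 where a1: "0 < a1" "\<And>w. norm w = 1 \<Longrightarrow> a1 \<le> norm (hmap d1 h1 w)"
    using hmap_bounds_of_normRes[OF d(1)] is_ratmap_normRes_pos[OF d(1) h1] is_ratmap_degree[OF h1]
    by (metis order_refl)
  obtain a2 where a2: "0 < a2" "\<And>w. norm w = 1 \<Longrightarrow> a2 \<le> norm (hmap d2 h2 w)"
    using hmap_bounds_of_normRes[OF d(2)] is_ratmap_normRes_pos[OF d(2) h2] is_ratmap_degree[OF h2]
    by (metis order_refl)
  define f where "f = rcomp d1 h1 h2"
  have f: "degree (fst f) \<le> d1 * d2" "degree (snd f) \<le> d1 * d2"
    using degree_rcomp[OF is_ratmap_degree[OF h2]] by (simp_all add: f_def)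
  define a where "a = a1 * a2 ^ d1"
  have a: "a > 0" using a1 a2 by (simp add: a_def)
  define b where "b = 2 * real (Suc (d1 * d2)) * maxcoef (d1 * d2) f"
  have bds: "a \<le> norm (hmap (d1 * d2) f w) \<and> norm (hmap (d1 * d2) f w) \<le> b" if w: "norm w = 1" for w
  proof
    have "a2 \<le> norm (hmap d2 h2 w)" by (rule a2(2)[OF w])
    then have "hmap d2 h2 w \<noteq> 0" using a2 by auto
    have "a \<le> a1 * norm (hmap d2 h2 w) ^ d1" unfolding a_def
      using a1 a2 \<open>a2 \<le> norm (hmap d2 h2 w)\<close> by (intro mult_left_mono power_mono) auto
    also have "\<dots> \<le> norm (hmap d1 h1 (hmap d2 h2 w))"
      by (rule norm_hmap_lower[OF a1(2) \<open>hmap d2 h2 w \<noteq> 0\<close>])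
    finally show "a \<le> norm (hmap (d1 * d2) f w)"
      by (simp add: f_def hmap_rcomp[OF is_ratmap_degree[OF h2]])
    show "norm (hmap (d1 * d2) f w) \<le> b" using norm_hmap_le[OF f, of w] w by (simp add: b_def del: of_nat_Suc)
  qed
  have "a \<le> b" using bds[of "(1, 0)"] by (simp add: norm_Pair)
  obtain c k where "c > 0" "c * (a / b) ^ k \<le> normRes (d1 * d2) f"
    using normRes_lower[OF dd] f a bds by metis
  moreover have "0 < c * (a / b) ^ k" using \<open>c > 0\<close> a \<open>a \<le> b\<close> by simp
  ultimately show ?thesis by (simp add: f_def)
qed

section \<open>Comparison of scales\<close>

lemma theta_eq: "0 < s \<Longrightarrow> theta s = 1 / max 1 (- ln s)"
proof -
  assume s: "0 < s"
  have "s \<ge> exp (-1) \<longleftrightarrow> - ln s \<le> 1" using s by (metis exp_ge_zero ln_ge_iff minus_le_iff)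
  then show ?thesis by (cases "exp (- 1) \<le> s") (simp_all add: theta_def)
qed

lemma theta_bounds: "0 < s \<Longrightarrow> 0 < theta s \<and> theta s \<le> 1"
  using max.cobounded1[of 1 "- ln s"] by (simp only: theta_eq) (simp add: divide_le_eq del: max.cobounded1)

text \<open>The hypothesis reads -log y <= -log c + k (-log x). With m = max(1, -log x), which is at
  least 1, the constant is absorbed as |log c| m, so max(1, -log y) is at most a fixed multiple of
  m.\<close>

lemma theta_le:
  assumes x: "0 < x" and c: "0 < c" and le: "c * x ^ k \<le> y"
  shows "theta x \<le> (1 + \<bar>ln c\<bar> + real k) * theta y"
proof -
  define A where "A = 1 + \<bar>ln c\<bar> + real k"
  define m where "m = max 1 (- ln x)"
  have m: "1 \<le> m" "- ln x \<le> m" by (simp_all add: m_def)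
  have cx: "0 < c * x ^ k" using x c by simp
  then have y: "0 < y" using le by linarith
  have "ln c + real k * ln x = ln (c * x ^ k)" using x c by (simp add: ln_mult ln_realpow)
  also have "\<dots> \<le> ln y" using cx le y by simp
  finally have "- ln y \<le> - ln c + real k * (- ln x)" by simp
  also have "\<dots> \<le> \<bar>ln c\<bar> * m + real k * m"
  proof (rule add_mono)
    have "- ln c \<le> \<bar>ln c\<bar> * 1" by simp
    also have "\<dots> \<le> \<bar>ln c\<bar> * m" using m by (intro mult_left_mono) auto
    finally show "- ln c \<le> \<bar>ln c\<bar> * m" .
    show "real k * - ln x \<le> real k * m" using m by (intro mult_left_mono) auto
  qed
  also have "\<dots> \<le> A * m" using m by (simp add: A_def algebra_simps)
  finally have "- ln y \<le> A * m" .
  moreover have "1 \<le> A * m" using m mult_mono[of 1 A 1 m] by (simp add: A_def)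
  ultimately have "max 1 (- ln y) \<le> A * m" by simp
  then have "1 / m \<le> A * (1 / max 1 (- ln y))"
    using m by (simp add: field_simps)
  then show ?thesis using x y by (simp add: theta_eq m_def A_def)
qed

text \<open>Compactness yields a cluster point of the image filter, and an ultrafilter converges to
  its cluster points. The lower bound 1/K keeps the limit positive, as equality of scales
  demands.\<close>

lemma ultrafilter_bounded_convergent:
  fixes r :: "nat \<Rightarrow> real"
  assumes u: "nonprincipal_ultrafilter \<omega>" and K: "0 < K" and r: "\<And>n. 1 / K \<le> r n" "\<And>n. r n \<le> K"
  shows "\<exists>l>0. (r \<longlongrightarrow> l) \<omega>"
proof -
  have "filtermap r \<omega> \<noteq> bot" using u by (simp add: nonprincipal_ultrafilter_def filtermap_bot_iff)
  moreover have "eventually (\<lambda>x. x \<in> {1 / K..K}) (filtermap r \<omega>)"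
    using r by (simp add: eventually_filtermap)
  ultimately obtain l where l: "l \<in> {1 / K..K}" "inf (nhds l) (filtermap r \<omega>) \<noteq> bot"
    using compact_Icc[of "1 / K" K] unfolding compact_filter by blast
  have "(r \<longlongrightarrow> l) \<omega>"
  proof (rule topological_tendstoI)
    fix S assume S: "open S" "l \<in> S"
    show "eventually (\<lambda>n. r n \<in> S) \<omega>"
    proof (rule ccontr)
      assume "\<not> eventually (\<lambda>n. r n \<in> S) \<omega>"
      then have "eventually (\<lambda>n. r n \<notin> S) \<omega>" using u unfolding nonprincipal_ultrafilter_def by blast
      then have "eventually (\<lambda>x. x \<notin> S) (filtermap r \<omega>)" by (simp add: eventually_filtermap)
      moreover have "eventually (\<lambda>x. x \<in> S) (nhds l)" using S by (rule eventually_nhds_in_open)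
      ultimately have "eventually (\<lambda>x. False) (inf (nhds l) (filtermap r \<omega>))"
        unfolding eventually_inf by blast
      then show False using l by (simp add: trivial_limit_def)
    qed
  qed
  moreover have "l > 0" using l K by (auto intro: less_le_trans[of 0 "1 / K"])
  ultimately show ?thesis by blast
qed

section \<open>Maps with two good conjugates\<close>

lemma mact_extremes:
  obtains u w where "norm u = 1" "norm w = 1" "\<And>x. norm (mact N x) \<le> norm (mact N u) * norm x"
    "\<And>x. norm (mact N w) * norm x \<le> norm (mact N x)"
proof -
  define S where "S = sphere (0 :: complex \<times> complex) 1"
  have S: "compact S" "S \<noteq> {}" by (auto simp: S_def)
  have cont: "continuous_on S (\<lambda>x. norm (mact N x))"
    unfolding mact_def by (cases N) (simp, intro continuous_intros)
  obtain u where u: "u \<in> S" "\<forall>x\<in>S. norm (mact N x) \<le> norm (mact N u)"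
    using continuous_attains_sup[OF S cont] by blast
  obtain w where w: "w \<in> S" "\<forall>x\<in>S. norm (mact N w) \<le> norm (mact N x)"
    using continuous_attains_inf[OF S cont] by blast
  have *: "norm (mact N x) \<le> norm (mact N u) * norm x \<and> norm (mact N w) * norm x \<le> norm (mact N x)" for x
  proof (cases "x = 0")
    case True
    then show ?thesis by (cases N) (simp add: mact_def flip: zero_prod_def)
  next
    case False
    define y where "y = cscale (of_real (1 / norm x)) x"
    have y: "x = cscale (of_real (norm x)) y" "norm y = 1"
      using cscale_unit[OF False] by (simp_all add: y_def)
    have eq: "norm (mact N x) = norm (mact N y) * norm x"
      by (subst y(1)) (simp add: mact_cscale mult.commute)
    have "y \<in> S" using y by (simp add: S_def)
    then show ?thesis using u w unfolding eq by (simp add: mult_right_mono)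
  qed
  show thesis using that[of u w] u w * by (simp add: S_def)
qed

text \<open>The matrix sends the k-th coefficient column to two minors, each at most the maximal
  one, while it expands every vector by at least \<beta>.\<close>

lemma maxcoef_le_minor:
  assumes low: "\<And>x. \<beta> * norm x \<le> norm (mact (minor_mat h i j) x)"
    and max: "\<And>k l. k \<le> d \<Longrightarrow> l \<le> d \<Longrightarrow> cmod (minor h k l) \<le> cmod (minor h i j)"
    and ij: "i \<le> d" "j \<le> d" and \<beta>: "0 < \<beta>"
  shows "\<beta> * maxcoef d h \<le> 2 * cmod (minor h i j)"
proof -
  have x: "\<beta> * norm (coeff (fst h) k, coeff (snd h) k) \<le> 2 * cmod (minor h i j)" if "k \<le> d" for k
  proof -
    have "\<beta> * norm (coeff (fst h) k, coeff (snd h) k) \<le> norm (minor h k j, minor h i k)"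
      using low[of "(coeff (fst h) k, coeff (snd h) k)"] by (simp only: mact_minor_mat)
    also have "\<dots> \<le> cmod (minor h k j) + cmod (minor h i k)" by (rule norm_Pair_le)
    finally show ?thesis using max[OF that ij(2)] max[OF ij(1) that] by linarith
  qed
  have "maxcoef d h \<le> 2 * cmod (minor h i j) / \<beta>"
  proof (rule maxcoef_le)
    fix k assume k: "k \<le> d"
    have "\<beta> * cmod (coeff (fst h) k) \<le> \<beta> * norm (coeff (fst h) k, coeff (snd h) k)"
      using \<beta> norm_fst_le by (intro mult_left_mono) auto
    also have "\<dots> \<le> 2 * cmod (minor h i j)" by (rule x[OF k])
    finally show "cmod (coeff (fst h) k) \<le> 2 * cmod (minor h i j) / \<beta>"
      using \<beta> by (simp add: pos_le_divide_eq mult.commute)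
    have "\<beta> * cmod (coeff (snd h) k) \<le> \<beta> * norm (coeff (fst h) k, coeff (snd h) k)"
      using \<beta> norm_snd_le by (intro mult_left_mono) auto
    also have "\<dots> \<le> 2 * cmod (minor h i j)" by (rule x[OF k])
    finally show "cmod (coeff (snd h) k) \<le> 2 * cmod (minor h i j) / \<beta>"
      using \<beta> by (simp add: pos_le_divide_eq mult.commute)
  qed
  then show ?thesis using \<beta> by (simp add: pos_le_divide_eq mult.commute)
qed

lemma norm_mdet_le:
  assumes up: "\<And>x. norm (mact N x) \<le> \<alpha> * norm x" and \<alpha>: "0 \<le> \<alpha>"
  shows "cmod (mdet N) \<le> 2 * \<alpha> ^ 2"
proof (cases N)
  case (fields a b c e)
  have "norm (a, c) \<le> \<alpha>" using up[of "(1, 0)"] by (simp add: mact_def fields norm_Pair)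
  moreover have "norm (b, e) \<le> \<alpha>" using up[of "(0, 1)"] by (simp add: mact_def fields norm_Pair)
  ultimately have "cmod a \<le> \<alpha>" "cmod b \<le> \<alpha>" "cmod c \<le> \<alpha>" "cmod e \<le> \<alpha>"
    using norm_fst_le[of a c] norm_snd_le[of c a] norm_fst_le[of b e] norm_snd_le[of e b] by auto
  then have "cmod a * cmod e \<le> \<alpha> * \<alpha>" "cmod b * cmod c \<le> \<alpha> * \<alpha>"
    using \<alpha> by (auto intro!: mult_mono)
  moreover have "cmod (mdet N) \<le> cmod a * cmod e + cmod b * cmod c"
    using norm_triangle_ineq4[of "a * e" "b * c"] by (simp add: mdet_def fields norm_mult)
  ultimately show ?thesis by (simp add: power2_eq_square)
qed

text \<open>A matrix conjugating one map of degree at least \<open>2\<close> with bounded distortion to another one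
  has bounded condition number: compare both maps at the directions where the matrix
  expands most and least.\<close>
lemma conjugacy_condition_number:
  assumes n: "2 \<le> n" and D: "mdet N \<noteq> 0" and a: "0 < a" and s: "0 < s" and \<sigma>: "0 < \<sigma>"
    and g: "\<And>w. norm w = 1 \<Longrightarrow> a \<le> norm (hmap n g w) \<and> norm (hmap n g w) \<le> b"
    and g': "\<And>w. norm w = 1 \<Longrightarrow> s * \<sigma> \<le> norm (hmap n (mconj n N g) w) \<and> norm (hmap n (mconj n N g) w) \<le> s"
    and u: "norm u = 1" "\<And>x. norm (mact N x) \<le> norm (mact N u) * norm x"
    and w: "norm w = 1" "\<And>x. norm (mact N w) * norm x \<le> norm (mact N x)"
  shows "0 < norm (mact N w)" "\<sigma> * (a / b) * norm (mact N u) \<le> norm (mact N w)"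
proof -
  define \<alpha> where "\<alpha> = norm (mact N u)"
  define \<beta> where "\<beta> = norm (mact N w)"
  define E where "E = cmod (mdet N) ^ n"
  have E: "E > 0" using D by (simp add: E_def)
  have b: "b > 0" using g[OF u(1)] a by linarith
  have nz: "mact N x \<noteq> 0" if "norm x = 1" for x
  proof
    assume "mact N x = 0"
    then have "mact (madj N) 0 = cscale (mdet N) x" using mact_madj(2)[of N x] by simp
    moreover have "mact (madj N) 0 = 0" by (cases N) (simp add: mact_def madj_def flip: zero_prod_def)
    ultimately have "norm (cscale (mdet N) x) = 0" by simp
    then show False using D that by simp
  qed
  show beta: "0 < norm (mact N w)" using nz[OF w(1)] by simp
  then have \<beta>: "\<beta> > 0" by (simp add: \<beta>_def)
  have \<alpha>: "\<alpha> > 0" using nz[OF u(1)] by (simp add: \<alpha>_def)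
  have "\<beta> \<le> \<alpha>" using u(2)[of w] w(1) by (simp add: \<alpha>_def \<beta>_def)
  \<comment> \<open>Evaluating the conjugate at N x rather than at x trades the inverse of N for the
    scalar E.\<close>
  have eq: "norm (hmap n (mconj n N g) (mact N x)) = E * norm (mact N (hmap n g x))" for x
    by (simp add: hmap_mconj mact_madj hmap_cscale mact_cscale E_def norm_power)
  have pow: "x ^ n = x * x ^ (n - 1)" for x :: real using n by (cases n) auto
  have "s * \<sigma> * \<alpha> ^ n \<le> norm (hmap n (mconj n N g) (mact N u))"
    unfolding \<alpha>_def by (rule norm_hmap_lower[OF _ nz[OF u(1)]]) (use g' in blast)
  also have "\<dots> \<le> E * (\<alpha> * b)"
  proof -
    have "norm (mact N (hmap n g u)) \<le> \<alpha> * norm (hmap n g u)" unfolding \<alpha>_def by (rule u)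
    also have "\<dots> \<le> \<alpha> * b" using g[OF u(1)] \<alpha> by (intro mult_left_mono) auto
    finally show ?thesis unfolding eq using E by (intro mult_left_mono) auto
  qed
  finally have "\<alpha> * (s * \<sigma> * \<alpha> ^ (n - 1)) \<le> \<alpha> * (E * b)" by (simp add: pow mult_ac)
  then have 1: "s * \<sigma> * \<alpha> ^ (n - 1) \<le> E * b" using \<alpha> by (simp only: mult_le_cancel_left_pos)
  have "E * (\<beta> * a) \<le> norm (hmap n (mconj n N g) (mact N w))"
  proof -
    have "\<beta> * a \<le> \<beta> * norm (hmap n g w)" using g[OF w(1)] \<beta> by (intro mult_left_mono) auto
    also have "\<dots> \<le> norm (mact N (hmap n g w))" unfolding \<beta>_def by (rule w)
    finally show ?thesis unfolding eq using E by (intro mult_left_mono) auto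
  qed
  also have "\<dots> \<le> s * \<beta> ^ n"
    unfolding \<beta>_def by (rule norm_hmap_upper[OF _ nz[OF w(1)]]) (use g' in blast)
  finally have "\<beta> * (E * a) \<le> \<beta> * (s * \<beta> ^ (n - 1))" by (simp add: pow mult_ac)
  then have 2: "E * a \<le> s * \<beta> ^ (n - 1)" using \<beta> by (simp only: mult_le_cancel_left_pos)
  \<comment> \<open>The unknown E is eliminated between the estimate at the most expanded and that
    at the least expanded direction.\<close>
  have "(s * \<sigma> * \<alpha> ^ (n - 1)) * a \<le> (E * b) * a" using 1 a by (intro mult_right_mono) auto
  also have "\<dots> = b * (E * a)" by simp
  also have "\<dots> \<le> b * (s * \<beta> ^ (n - 1))" using 2 b by (intro mult_left_mono) auto
  finally have "s * (\<sigma> * a * \<alpha> ^ (n - 1)) \<le> s * (b * \<beta> ^ (n - 1))" by (simp add: mult_ac)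
  then have "\<sigma> * a * \<alpha> ^ (n - 1) \<le> b * \<beta> ^ (n - 1)" using s by (simp only: mult_le_cancel_left_pos)
  then have "\<sigma> * (a / b) \<le> (\<beta> / \<alpha>) ^ (n - 1)" using b \<alpha> by (simp add: power_divide field_simps)
  \<comment> \<open>Here n >= 2 is essential: for n = 1 the exponent n - 1 would be 0 and nothing
    would be said about N.\<close>
  also have "\<dots> \<le> (\<beta> / \<alpha>) ^ 1"
    using n \<alpha> \<beta> \<open>\<beta> \<le> \<alpha>\<close> by (intro power_decreasing) auto
  finally show "\<sigma> * (a / b) * norm (mact N u) \<le> norm (mact N w)"
    using \<alpha> by (simp add: pos_le_divide_eq \<alpha>_def \<beta>_def)
qed

text \<open>Let \<alpha>, \<beta> be the largest and smallest expansion of N, D the modulus of its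
  determinant and m = \<open>maxcoef d2 h2\<close>. Then \<tau> \<alpha> <= \<beta>, \<beta> m <= 2
  D and D <= 2 \<alpha>^2. Squaring \<tau> \<alpha> m <= 2 D and bounding one factor D by 2
  \<alpha>^2 cancels \<alpha> and leaves \<tau>^2 m^2 <= 8 D.\<close>

lemma minor_lower_bound:
  assumes d: "1 \<le> d1" "1 \<le> d2" "2 \<le> d1 * d2"
  shows "\<exists>c k. 0 < c \<and> (\<forall>h1 h2 r. degree (fst h1) \<le> d1 \<longrightarrow> degree (snd h1) \<le> d1 \<longrightarrow>
      degree (fst h2) \<le> d2 \<longrightarrow> degree (snd h2) \<le> d2 \<longrightarrow> 0 < r \<longrightarrow>
      r \<le> normRes (d1 * d2) (rcomp d1 h1 h2) \<longrightarrow> r \<le> normRes (d2 * d1) (rcomp d2 h2 h1) \<longrightarrow>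
      (\<exists>i\<le>d2. \<exists>j\<le>d2. c * r ^ k * maxcoef d2 h2 ^ 2 \<le> cmod (minor h2 i j)))"
proof -
  have dd: "1 \<le> d1 * d2" "1 \<le> d2 * d1" "2 \<le> d2 * d1" using d by (auto simp: Suc_le_eq mult.commute)
  obtain c1 where c1: "c1 > 0" and bounds1: "\<And>h r. \<lbrakk>degree (fst h) \<le> d1 * d2; degree (snd h) \<le> d1 * d2;
      0 < r; r \<le> normRes (d1 * d2) h\<rbrakk> \<Longrightarrow>
      \<exists>a b. 0 < a \<and> a / b = c1 * r \<and> (\<forall>w. norm w = 1 \<longrightarrow> a \<le> norm (hmap (d1 * d2) h w) \<and> norm (hmap (d1 * d2) h w) \<le> b)"
    using hmap_bounds_of_normRes[OF dd(1)] by blast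
  obtain c4 where c4: "c4 > 0" and bounds4: "\<And>h r. \<lbrakk>degree (fst h) \<le> d2 * d1; degree (snd h) \<le> d2 * d1;
      0 < r; r \<le> normRes (d2 * d1) h\<rbrakk> \<Longrightarrow>
      \<exists>a b. 0 < a \<and> a / b = c4 * r \<and> (\<forall>w. norm w = 1 \<longrightarrow> a \<le> norm (hmap (d2 * d1) h w) \<and> norm (hmap (d2 * d1) h w) \<le> b)"
    using hmap_bounds_of_normRes[OF dd(2)] by blast
  obtain c2 where c2: "c2 > 0" and core: "\<And>h1 h2 a b. \<lbrakk>degree (fst h1) \<le> d1; degree (snd h1) \<le> d1;
      degree (fst h2) \<le> d2; degree (snd h2) \<le> d2; 0 < a;
      \<forall>w. norm w = 1 \<longrightarrow> a \<le> norm (hmap d1 h1 (hmap d2 h2 w)) \<and> norm (hmap d1 h1 (hmap d2 h2 w)) \<le> b\<rbrakk> \<Longrightarrow>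
      (\<exists>i\<le>d2. \<exists>j\<le>d2. \<exists>s>0. minor h2 i j \<noteq> 0 \<and>
         (\<forall>k\<le>d2. \<forall>l\<le>d2. cmod (minor h2 k l) \<le> cmod (minor h2 i j)) \<and>
         (\<forall>w. norm w = 1 \<longrightarrow>
            s * (c2 * (a / b) ^ Suc d2) \<le> norm (hmap (d2 * d1) (mconj (d2 * d1) (minor_mat h2 i j) (rcomp d2 h2 h1)) w) \<and>
            norm (hmap (d2 * d1) (mconj (d2 * d1) (minor_mat h2 i j) (rcomp d2 h2 h1)) w) \<le> s))"
    using semiconjugate_distortion[OF d(1,2)] by blast
  define n where "n = Suc d2"
  define C where "C = c2 * c1 ^ n * c4"
  have C: "C > 0" using c1 c2 c4 by (simp add: C_def)
  show ?thesis
  proof (rule exI[of _ "C ^ 2 / 8"], rule exI[of _ "Suc n * 2"], intro conjI allI impI)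
    fix h1 h2 :: rmap and r :: real
    assume h1: "degree (fst h1) \<le> d1" "degree (snd h1) \<le> d1"
      and h2: "degree (fst h2) \<le> d2" "degree (snd h2) \<le> d2" and r: "0 < r"
    define f where "f = rcomp d1 h1 h2"
    define g where "g = rcomp d2 h2 h1"
    assume "r \<le> normRes (d1 * d2) (rcomp d1 h1 h2)" "r \<le> normRes (d2 * d1) (rcomp d2 h2 h1)"
    then have rf: "r \<le> normRes (d1 * d2) f" and rg: "r \<le> normRes (d2 * d1) g" by (simp_all add: f_def g_def)
    obtain a b where ab: "0 < a" "a / b = c1 * r"
      "\<forall>w. norm w = 1 \<longrightarrow> a \<le> norm (hmap (d1 * d2) f w) \<and> norm (hmap (d1 * d2) f w) \<le> b"
      using bounds1[OF _ _ r rf] degree_rcomp[OF h2] unfolding f_def by blast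
    obtain a' b' where ab': "0 < a'" "a' / b' = c4 * r"
      "\<forall>w. norm w = 1 \<longrightarrow> a' \<le> norm (hmap (d2 * d1) g w) \<and> norm (hmap (d2 * d1) g w) \<le> b'"
      using bounds4[OF _ _ r rg] degree_rcomp[OF h1] unfolding g_def by blast
    have eq: "hmap (d1 * d2) f w = hmap d1 h1 (hmap d2 h2 w)" for w
      unfolding f_def by (rule hmap_rcomp[OF h2])
    from core[OF h1 h2 ab(1) ab(3)[unfolded eq]] obtain i j s where ij: "i \<le> d2" "j \<le> d2" and s: "s > 0"
      and D: "minor h2 i j \<noteq> 0" and max: "\<forall>k\<le>d2. \<forall>l\<le>d2. cmod (minor h2 k l) \<le> cmod (minor h2 i j)"
      and s_bds: "\<forall>w. norm w = 1 \<longrightarrow>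
            s * (c2 * (a / b) ^ n) \<le> norm (hmap (d2 * d1) (mconj (d2 * d1) (minor_mat h2 i j) g) w) \<and>
            norm (hmap (d2 * d1) (mconj (d2 * d1) (minor_mat h2 i j) g) w) \<le> s"
      unfolding n_def g_def by blast
    define N where "N = minor_mat h2 i j"
    have DN: "mdet N = minor h2 i j" by (simp add: N_def mdet_minor_mat)
    define \<sigma> where "\<sigma> = c2 * (a / b) ^ n"
    have "0 < a / b" unfolding ab(2) using c1 r by simp
    then have \<sigma>: "\<sigma> > 0" using c2 by (simp add: \<sigma>_def)
    obtain u w where uw: "norm u = 1" "norm w = 1" "\<And>x. norm (mact N x) \<le> norm (mact N u) * norm x"
      "\<And>x. norm (mact N w) * norm x \<le> norm (mact N x)" using mact_extremes[of N] by blast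
    define \<alpha> where "\<alpha> = norm (mact N u)"
    define \<beta> where "\<beta> = norm (mact N w)"
    have NZ: "mdet N \<noteq> 0" using D by (simp add: DN)
    have g_bds: "a' \<le> norm (hmap (d2 * d1) g x) \<and> norm (hmap (d2 * d1) g x) \<le> b'" if "norm x = 1" for x
      using ab'(3) that by blast
    have g'_bds: "s * \<sigma> \<le> norm (hmap (d2 * d1) (mconj (d2 * d1) N g) x) \<and>
        norm (hmap (d2 * d1) (mconj (d2 * d1) N g) x) \<le> s" if "norm x = 1" for x
      using s_bds that unfolding \<sigma>_def N_def by blast
    note cond = conjugacy_condition_number[OF dd(3) NZ ab'(1) s \<sigma> g_bds g'_bds uw(1) uw(3) uw(2) uw(4),
        folded \<alpha>_def \<beta>_def]
    have "\<beta> \<le> \<alpha>" using uw(3)[of w] uw(2) by (simp add: \<alpha>_def \<beta>_def)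
    then have \<alpha>: "\<alpha> > 0" using cond by linarith
    \<comment> \<open>The inverse condition number: n powers of r come from the distortion of f
      through the normal form, one more from that of g.\<close>
    define \<tau> where "\<tau> = \<sigma> * (a' / b')"
    have \<tau>: "\<tau> = C * r ^ Suc n"
      unfolding \<tau>_def \<sigma>_def ab(2) ab'(2) C_def by (simp add: power_mult_distrib)
    then have "\<tau> > 0" using C r by simp
    define m where "m = maxcoef d2 h2"
    define D where "D = cmod (minor h2 i j)"
    have m: "\<beta> * m \<le> 2 * D" unfolding m_def D_def
      by (rule maxcoef_le_minor) (use uw(4) max ij cond in \<open>auto simp: \<beta>_def N_def\<close>)
    have "D \<le> 2 * \<alpha> ^ 2" unfolding D_def DN[symmetric]
      by (rule norm_mdet_le) (use uw(3) in \<open>auto simp: \<alpha>_def\<close>)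
    have "D > 0" using D by (simp add: D_def)
    have "(\<tau> * \<alpha>) * m \<le> \<beta> * m" using cond by (intro mult_right_mono) (auto simp: \<tau>_def m_def)
    then have "\<tau> * \<alpha> * m \<le> 2 * D" using m by linarith
    then have "(\<tau> * \<alpha> * m) ^ 2 \<le> (2 * D) ^ 2"
      using \<open>\<tau> > 0\<close> \<alpha> by (intro power_mono) (auto simp: m_def)
    also have "\<dots> = 4 * D * D" by (simp add: power2_eq_square)
    also have "\<dots> \<le> 4 * D * (2 * \<alpha> ^ 2)" using \<open>D \<le> _\<close> \<open>D > 0\<close> by (intro mult_left_mono) auto
    finally have "\<alpha> ^ 2 * (\<tau> ^ 2 * m ^ 2) \<le> \<alpha> ^ 2 * (8 * D)" by (simp add: power_mult_distrib mult_ac)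
    then have "\<tau> ^ 2 * m ^ 2 \<le> 8 * D" using \<alpha> by (simp only: mult_le_cancel_left_pos zero_less_power)
    moreover have "\<tau> ^ 2 = C ^ 2 * r ^ (Suc n * 2)" unfolding \<tau> power_mult_distrib power_mult ..
    ultimately have "C ^ 2 / 8 * r ^ (Suc n * 2) * m ^ 2 \<le> D" by simp
    then show "\<exists>i\<le>d2. \<exists>j\<le>d2. C ^ 2 / 8 * r ^ (Suc n * 2) * maxcoef d2 h2 ^ 2 \<le> cmod (minor h2 i j)"
      using ij unfolding m_def D_def by blast
  qed (use C in simp)
qed

section \<open>Degree of the limit\<close>

text \<open>Each of the two products moves by at most 3 t, since t <= 1 makes the quadratic error
  linear; the minor of the capital letters is exactly 0.\<close>

lemma norm_minor_diff_le:
  fixes p p' q q' P P' Q Q' :: complex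
  assumes eq: "P * Q' = P' * Q" and one: "cmod p \<le> 1" "cmod p' \<le> 1" "cmod q \<le> 1" "cmod q' \<le> 1"
    and t: "cmod (P - p) \<le> t" "cmod (P' - p') \<le> t" "cmod (Q - q) \<le> t" "cmod (Q' - q') \<le> t" "t \<le> 1"
  shows "cmod (p * q' - p' * q) \<le> 6 * t"
proof -
  have t0: "0 \<le> t" using t(1) norm_ge_zero order_trans by blast
  have prod: "cmod (x * y - X * Y) \<le> 3 * t"
    if "cmod x \<le> 1" "cmod y \<le> 1" "cmod (X - x) \<le> t" "cmod (Y - y) \<le> t" for x y X Y :: complex
  proof -
    have "x * y - X * Y = - ((X - x) * y) - (x * (Y - y) + (X - x) * (Y - y))"
      by (simp add: algebra_simps)
    then have "cmod (x * y - X * Y) \<le> cmod ((X - x) * y) + cmod (x * (Y - y) + (X - x) * (Y - y))"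
      by (metis norm_minus_cancel norm_triangle_ineq4)
    also have "\<dots> \<le> cmod ((X - x) * y) + (cmod (x * (Y - y)) + cmod ((X - x) * (Y - y)))"
      by (intro add_left_mono norm_triangle_ineq)
    also have "\<dots> \<le> t * 1 + (1 * t + t * 1)"
      unfolding norm_mult using that t(5) t0 by (intro add_mono mult_mono) auto
    finally show ?thesis by simp
  qed
  have "p * q' - p' * q = (p * q' - P * Q') - (p' * q - P' * Q)" using eq by simp
  then have "cmod (p * q' - p' * q) \<le> cmod (p * q' - P * Q') + cmod (p' * q - P' * Q)"
    by (metis norm_triangle_ineq4)
  also have "\<dots> \<le> 3 * t + 3 * t" using one t by (intro add_mono prod) auto
  finally show ?thesis by simp
qed

text \<open>Degree 0 of the limit would mean a common divisor of degree d, hence cofactors of degree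
  0, that is scalars. The normalised coefficients would then be close to multiples of one form G,
  whose minors vanish exactly, against the lower bound \<delta>.\<close>

lemma lim_deg_pos:
  assumes \<omega>: "\<omega> \<noteq> bot" and h: "\<And>n. degree (fst (h n)) \<le> d" "\<And>n. degree (snd (h n)) \<le> d"
    and m: "\<And>n. 0 < maxcoef d (h n)" and e: "\<And>n. 0 < e n" "\<And>n. e n \<le> 1" and \<delta>: "0 < \<delta>"
    and ev: "eventually (\<lambda>n. \<exists>i\<le>d. \<exists>j\<le>d. \<delta> \<le> (cmod (minor (h n) i j) / maxcoef d (h n) ^ 2) powr e n) \<omega>"
  shows "1 \<le> lim_deg \<omega> e d h"
proof -
  define S where "S = {k. k \<le> d \<and> (\<exists>G. H_nonzero_form \<omega> e k G \<and>
       H_divides \<omega> e k G d (\<lambda>i. ncoeff d h False i) \<and> H_divides \<omega> e k G d (\<lambda>i. ncoeff d h True i))}"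
  have fin: "finite S" unfolding S_def by (rule finite_subset[of _ "{..d}"]) auto
  define F where "F = (\<lambda>b n. if b then snd (h n) else fst (h n))"
  have F: "degree (F b n) \<le> d" for b n using h by (simp add: F_def)
  have nc: "ncoeff d h b i n = coeff (F b n) i / of_real (maxcoef d (h n))" for b i n
    by (simp add: ncoeff_def F_def)
  have nc1: "cmod (ncoeff d h b i n) \<le> 1" for b i n
    using coeff_le_maxcoef_deg[of "h n" d i] h m[of n] by (simp add: nc F_def norm_divide)
  \<comment> \<open>The constant 1 is a common divisor, so \<open>Max\<close> is taken over a
    nonempty finite set and is attained.\<close>
  have "0 \<in> S"
  proof -
    have "H_nonzero_form \<omega> e 0 (\<lambda>n. 1)"
      unfolding H_nonzero_form_def H_form_def H_adm_def H_eq_def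
      using \<omega> by (auto intro: exI[of _ 1] simp: tendsto_const_iff)
    moreover have "H_divides \<omega> e 0 (\<lambda>n. 1) d (\<lambda>i. ncoeff d h b i)" for b
      unfolding H_divides_def
    proof (intro exI[of _ "\<lambda>n. smult (1 / of_real (maxcoef d (h n))) (F b n)"] conjI allI impI)
      show "H_form \<omega> e (d - 0) (\<lambda>n. smult (1 / of_real (maxcoef d (h n))) (F b n))"
        unfolding H_form_def
      proof (intro conjI allI impI)
        show "degree (smult (1 / of_real (maxcoef d (h n))) (F b n)) \<le> d - 0" for n
          using F order_trans[OF degree_smult_le] by simp
        fix i
        show "H_adm \<omega> e (\<lambda>n. coeff (smult (1 / of_real (maxcoef d (h n))) (F b n)) i)"
          unfolding H_adm_def
        proof (intro exI[of _ 1] always_eventually allI)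
          fix n
          show "cmod (coeff (smult (1 / of_real (maxcoef d (h n))) (F b n)) i) powr e n \<le> 1"
            using nc1[of b i n] e(1)[of n] unfolding nc by (intro powr_le1) auto
        qed
      qed
      show "H_eq \<omega> e (\<lambda>n. coeff (1 * smult (1 / of_real (maxcoef d (h n))) (F b n)) k) (ncoeff d h b k)" for k
        unfolding H_eq_def by (simp add: nc)
    qed
    ultimately show ?thesis unfolding S_def by blast
  qed
  have "d \<notin> S"
  proof
    assume "d \<in> S"
    then obtain G where "H_divides \<omega> e d G d (\<lambda>i. ncoeff d h False i)" "H_divides \<omega> e d G d (\<lambda>i. ncoeff d h True i)"
      unfolding S_def by blast
    then have "\<exists>R. H_form \<omega> e 0 R \<and> (\<forall>k\<le>d. H_eq \<omega> e (\<lambda>n. coeff (G n * R n) k) (ncoeff d h b k))" for b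
      by (cases b) (simp_all add: H_divides_def)
    then obtain R where R: "\<And>b. H_form \<omega> e 0 (R b)"
      "\<And>b k. k \<le> d \<Longrightarrow> H_eq \<omega> e (\<lambda>n. coeff (G n * R b n) k) (ncoeff d h b k)"
      by metis
    have "\<exists>x. R b n = [:x:]" for b n
      using R(1)[of b] degree_eq_zeroE[of "R b n"] by (auto simp: H_form_def)
    then obtain x where x: "\<And>b n. R b n = [:x b n:]" by metis
    define P where "P = (\<lambda>b k n. coeff (G n) k * x b n)"
    have coef: "coeff (G n * R b n) k = P b k n" for b k n by (simp add: x P_def mult.commute)
    \<comment> \<open>Below 1, so that the threshold t is at most 1, and with 6 \<eta> < \<delta>,
      so that the perturbation bound 6 t contradicts \<delta>.\<close>
    define \<eta> where "\<eta> = min (1 / 2) (\<delta> / 7)"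
    have \<eta>: "0 < \<eta>" "\<eta> < 1" "6 * \<eta> < \<delta>" using \<delta> by (auto simp: \<eta>_def min_def)
    have "eventually (\<lambda>n. cmod (P b k n - ncoeff d h b k n) powr e n < \<eta>) \<omega>" if "k \<le> d" for b k
      using order_tendstoD(2)[OF R(2)[OF that, of b, unfolded H_eq_def] \<eta>(1)] by (simp add: coef)
    then have "eventually (\<lambda>n. \<forall>k\<in>{..d}. cmod (P b k n - ncoeff d h b k n) powr e n < \<eta>) \<omega>" for b
      by (intro eventually_ball_finite) auto
    from eventually_conj[OF this[of False] this[of True]] ev
    have "eventually (\<lambda>n. False) \<omega>"
    proof eventually_elim
      case (elim n)
      \<comment> \<open>The absolute size whose e n-th power is \<eta>: smallness in the limit field
        becomes an ordinary bound on complex numbers.\<close>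
      define t where "t = \<eta> powr (1 / e n)"
      have en: "0 < e n" "e n \<le> 1" using e by auto
      have te: "t powr e n = \<eta>" using \<eta> en by (simp add: t_def powr_powr)
      have t: "0 < t" "t \<le> 1" using \<eta> en by (auto simp: t_def intro!: powr_le1)
      have close: "cmod (P b k n - ncoeff d h b k n) \<le> t" if "k \<le> d" for b k
      proof (rule ccontr)
        assume "\<not> ?thesis"
        then have "t powr e n \<le> cmod (P b k n - ncoeff d h b k n) powr e n"
          using t en by (intro powr_mono2) auto
        moreover have "cmod (P b k n - ncoeff d h b k n) powr e n < \<eta>" using elim(1) that by (cases b) auto
        ultimately show False using te by simp
      qed
      obtain i j where ij: "i \<le> d" "j \<le> d" "\<delta> \<le> (cmod (minor (h n) i j) / maxcoef d (h n) ^ 2) powr e n"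
        using elim(2) by blast
      have "minor (h n) i j / of_real (maxcoef d (h n)) ^ 2
          = ncoeff d h False i n * ncoeff d h True j n - ncoeff d h False j n * ncoeff d h True i n"
        by (simp add: minor_def nc F_def power2_eq_square diff_divide_distrib)
      then have "cmod (minor (h n) i j) / maxcoef d (h n) ^ 2
          = cmod (ncoeff d h False i n * ncoeff d h True j n - ncoeff d h False j n * ncoeff d h True i n)"
        using m[of n] by (metis norm_divide norm_power norm_of_real abs_of_pos)
      also have "\<dots> \<le> 6 * t"
        by (rule norm_minor_diff_le[of "P False i n" "P True j n" "P False j n" "P True i n"])
          (use nc1 close ij t in \<open>auto simp: P_def\<close>)
      finally have "(cmod (minor (h n) i j) / maxcoef d (h n) ^ 2) powr e n \<le> (6 * t) powr e n"
        using en by (intro powr_mono2) auto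
      also have "\<dots> = 6 powr e n * \<eta>" using t te by (simp add: powr_mult)
      also have "\<dots> \<le> 6 powr 1 * \<eta>" using en \<eta> by (intro mult_right_mono powr_mono) auto
      finally show False using ij \<eta> by simp
    qed
    then show False using \<omega> by (simp add: trivial_limit_def)
  qed
  have "Max S \<in> S" using fin \<open>0 \<in> S\<close> by (intro Max_in) auto
  then have "Max S \<le> d" "Max S \<noteq> d" using \<open>d \<notin> S\<close> by (auto simp: S_def)
  then show ?thesis unfolding lim_deg_def lim_gcd_deg_def S_def[symmetric] by simp
qed

text \<open>A positive limit c of the ratio gives theta(x) > (c/2) e eventually, that is max(1, -log
  x) < (2/c) / e; hence A = 2/c.\<close>

lemma eventually_exp_le:
  assumes sc: "scale_eq \<omega> (\<lambda>n. theta (x n)) e" and x: "\<And>n. 0 < x n" and e: "\<And>n. 0 < e n"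
  shows "\<exists>A>0. eventually (\<lambda>n. exp (- A / e n) \<le> x n) \<omega>"
proof -
  obtain c where c: "c > 0" "((\<lambda>n. theta (x n) / e n) \<longlongrightarrow> c) \<omega>" using sc by (auto simp: scale_eq_def)
  then have "eventually (\<lambda>n. c / 2 < theta (x n) / e n) \<omega>"
    by (intro order_tendstoD(1)[where y = c]) auto
  then have "eventually (\<lambda>n. exp (- (2 / c) / e n) \<le> x n) \<omega>"
  proof eventually_elim
    case (elim n)
    define m where "m = max 1 (- ln (x n))"
    have m: "1 \<le> m" "- ln (x n) \<le> m" by (simp_all add: m_def)
    have "c / 2 * e n < 1 / m" 
      using elim e[of n] unfolding theta_eq[OF x] m_def by (simp only: pos_less_divide_eq)
    then have "m * (c / 2 * e n) < m * (1 / m)" using m by (intro mult_strict_left_mono) auto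
    then have "m < 2 / c / e n" using c e[of n] m by (simp add: field_simps)
    then have "- (2 / c) / e n \<le> ln (x n)" using m by simp
    then have "exp (- (2 / c) / e n) \<le> exp (ln (x n))" by (simp only: exp_le_cancel_iff)
    then show ?case using x[of n] by simp
  qed
  then show ?thesis using c by (intro exI[of _ "2 / c"]) simp
qed

text \<open>Raising to the power e cancels the 1/e in the exponent, and c^e stays above min(1, c)
  because e lies in (0, 1]. So a bound by a power of r survives in the limit field.\<close>

lemma powr_scale_lower:
  fixes c A e :: real
  assumes c: "0 < c" and e: "0 < e" "e \<le> 1"
  shows "min 1 c * exp (- (A * real k)) \<le> (c * exp (- A / e) ^ k) powr e"
proof -
  have "exp (- A / e) ^ k = exp (- (A * real k) / e)"
    by (simp add: exp_of_nat_mult[symmetric] mult.commute)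
  then have "(exp (- A / e) ^ k) powr e = exp (- (A * real k))"
    using e by (simp add: powr_def)
  then have eq: "(c * exp (- A / e) ^ k) powr e = c powr e * exp (- (A * real k))"
    using c by (simp add: powr_mult)
  have "min 1 c \<le> c powr e"
  proof (cases "1 \<le> c")
    case True
    then show ?thesis using e ge_one_powr_ge_zero[of c e] by simp
  next
    case False
    then have "c powr 1 \<le> c powr e" using c e by (intro powr_mono') auto
    then show ?thesis using c False by simp
  qed
  then show ?thesis unfolding eq by (intro mult_right_mono) auto
qed

text \<open>Both compositions must be good at the scale e: f yields the normal form N, and g bounds
  its condition number. Stated for the second factor; exchanging the roles gives the first.\<close>

lemma lim_deg_pos_of_good_scale:
  assumes \<omega>: "\<omega> \<noteq> bot" and d: "1 \<le> d1" "1 \<le> d2" "2 \<le> d1 * d2"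
    and h1: "\<And>n. is_ratmap d1 (h1 n)" and h2: "\<And>n. is_ratmap d2 (h2 n)"
    and e: "\<And>n. 0 < e n" "\<And>n. e n \<le> 1"
    and f: "eventually (\<lambda>n. exp (- A / e n) \<le> normRes (d1 * d2) (rcomp d1 (h1 n) (h2 n))) \<omega>"
    and g: "eventually (\<lambda>n. exp (- A / e n) \<le> normRes (d2 * d1) (rcomp d2 (h2 n) (h1 n))) \<omega>"
  shows "1 \<le> lim_deg \<omega> e d2 h2"
proof -
  obtain c k where c: "c > 0" and minors: "\<And>h1 h2 r. \<lbrakk>degree (fst h1) \<le> d1; degree (snd h1) \<le> d1;
      degree (fst h2) \<le> d2; degree (snd h2) \<le> d2; 0 < r;
      r \<le> normRes (d1 * d2) (rcomp d1 h1 h2); r \<le> normRes (d2 * d1) (rcomp d2 h2 h1)\<rbrakk> \<Longrightarrow>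
      (\<exists>i\<le>d2. \<exists>j\<le>d2. c * r ^ k * maxcoef d2 h2 ^ 2 \<le> cmod (minor h2 i j))"
    using minor_lower_bound[OF d] by blast
  show ?thesis
  proof (rule lim_deg_pos[OF \<omega>])
    show "0 < min 1 c * exp (- (A * real k))" using c by simp
    show "eventually (\<lambda>n. \<exists>i\<le>d2. \<exists>j\<le>d2. min 1 c * exp (- (A * real k))
        \<le> (cmod (minor (h2 n) i j) / maxcoef d2 (h2 n) ^ 2) powr e n) \<omega>"
      using f g
    proof eventually_elim
      case (elim n)
      define r where "r = exp (- A / e n)"
      obtain i j where ij: "i \<le> d2" "j \<le> d2" "c * r ^ k * maxcoef d2 (h2 n) ^ 2 \<le> cmod (minor (h2 n) i j)"
        using minors[OF is_ratmap_degree[OF h1] is_ratmap_degree[OF h2], of r n n] elim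
        unfolding r_def by auto
      have "0 < maxcoef d2 (h2 n) ^ 2" by (intro zero_less_power is_ratmap_maxcoef_pos d h2)
      then have "c * r ^ k \<le> cmod (minor (h2 n) i j) / maxcoef d2 (h2 n) ^ 2"
        using ij by (simp add: pos_le_divide_eq)
      then have "(c * r ^ k) powr e n \<le> (cmod (minor (h2 n) i j) / maxcoef d2 (h2 n) ^ 2) powr e n"
        using c e(1)[of n] by (intro powr_mono2) (auto simp: r_def)
      moreover have "min 1 c * exp (- (A * real k)) \<le> (c * r ^ k) powr e n"
        unfolding r_def using c e by (intro powr_scale_lower) auto
      ultimately show ?case using ij by (meson order_trans)
    qed
  qed (use is_ratmap_degree[OF h2] is_ratmap_maxcoef_pos[OF d(2) h2] e in auto)
qed

section \<open>Equality of the scales and conclusion\<close>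

lemma scale_eq_trans:
  assumes "scale_eq \<omega> a b" "scale_eq \<omega> b c" "\<And>n. 0 < b n"
  shows "scale_eq \<omega> a c"
proof -
  obtain x y where xy: "x > 0" "((\<lambda>n. a n / b n) \<longlongrightarrow> x) \<omega>" "y > 0" "((\<lambda>n. b n / c n) \<longlongrightarrow> y) \<omega>"
    using assms by (auto simp: scale_eq_def)
  have "b n \<noteq> 0" for n using assms(3)[of n] by simp
  then have "((\<lambda>n. a n / c n) \<longlongrightarrow> x * y) \<omega>" using tendsto_mult[OF xy(2,4)] by simp
  then show ?thesis using xy unfolding scale_eq_def by (intro exI[of _ "x * y"]) simp
qed

lemma scale_eq_sym:
  assumes "scale_eq \<omega> a b"
  shows "scale_eq \<omega> b a"
proof -
  obtain x where x: "x > 0" "((\<lambda>n. a n / b n) \<longlongrightarrow> x) \<omega>" using assms by (auto simp: scale_eq_def)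
  have "((\<lambda>n. b n / a n) \<longlongrightarrow> inverse x) \<omega>" using tendsto_inverse[OF x(2)] x(1) by simp
  then show ?thesis using x unfolding scale_eq_def by (intro exI[of _ "inverse x"]) simp
qed

theorem mainTheorem7:
  fixes \<omega> :: "nat filter" and d1 d2 :: nat and h1 h2 :: "nat \<Rightarrow> rmap"
  assumes "nonprincipal_ultrafilter \<omega>"
    and "d1 * d2 \<ge> 2"
    and "\<forall>n. is_ratmap d1 (h1 n)"
    and "\<forall>n. is_ratmap d2 (h2 n)"
  shows "scale_eq \<omega> (eps_star (d1 * d2) (\<lambda>n. rcomp d1 (h1 n) (h2 n)))
                    (eps_star (d2 * d1) (\<lambda>n. rcomp d2 (h2 n) (h1 n)))
       \<and> ((scale_eq \<omega> (eps_scale (d1 * d2) (\<lambda>n. rcomp d1 (h1 n) (h2 n)))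
                      (eps_star (d1 * d2) (\<lambda>n. rcomp d1 (h1 n) (h2 n)))
           \<and> scale_eq \<omega> (eps_scale (d2 * d1) (\<lambda>n. rcomp d2 (h2 n) (h1 n)))
                      (eps_star (d2 * d1) (\<lambda>n. rcomp d2 (h2 n) (h1 n))))
          \<longrightarrow> lim_deg \<omega> (eps_star (d1 * d2) (\<lambda>n. rcomp d1 (h1 n) (h2 n))) d1 h1 \<ge> 1
            \<and> lim_deg \<omega> (eps_star (d1 * d2) (\<lambda>n. rcomp d1 (h1 n) (h2 n))) d2 h2 \<ge> 1)"
proof -
  have "d1 \<noteq> 0" "d2 \<noteq> 0" using assms(2) by (auto intro: gr0I)
  then have d: "1 \<le> d1" "1 \<le> d2" by auto
  have dd: "1 \<le> d1 * d2" "1 \<le> d2 * d1" "2 \<le> d2 * d1" using assms(2) mult.commute[of d2 d1] by linarith+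
  have h1: "is_ratmap d1 (h1 n)" and h2: "is_ratmap d2 (h2 n)" for n using assms by auto
  note deg = is_ratmap_degree[OF h1] is_ratmap_degree[OF h2]
  define f where "f = (\<lambda>n. rcomp d1 (h1 n) (h2 n))"
  define g where "g = (\<lambda>n. rcomp d2 (h2 n) (h1 n))"
  have nf: "0 < normRes (d1 * d2) (f n)" and ng: "0 < normRes (d2 * d1) (g n)" for n
    unfolding f_def g_def using normRes_rcomp_pos d h1 h2 by blast+
  have mf: "0 < minRes (d1 * d2) (f n)" for n
    using normRes_le_minRes[OF dd(1) degree_rcomp[OF deg(3,4)]] nf[of n] unfolding f_def
    by (rule less_le_trans[rotated])
  have mg: "0 < minRes (d2 * d1) (g n)" for n
    using normRes_le_minRes[OF dd(2) degree_rcomp[OF deg(1,2)]] ng[of n] unfolding g_def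
    by (rule less_le_trans[rotated])
  define ef where "ef = eps_star (d1 * d2) f"
  define eg where "eg = eps_star (d2 * d1) g"
  have ef: "0 < ef n" "ef n \<le> 1" and eg: "0 < eg n" for n
    using theta_bounds[OF mf[of n]] theta_bounds[OF mg[of n]] by (simp_all add: ef_def eg_def eps_star_def)
  obtain K1 where K1: "K1 > 0" "\<And>n. ef n \<le> K1 * eg n"
  proof -
    obtain c k where c: "0 < c" "\<And>n. c * minRes (d1 * d2) (f n) ^ k \<le> minRes (d2 * d1) (g n)"
      using minRes_comp_commute[OF d] deg mf unfolding f_def g_def by blast
    show thesis using that[of "1 + \<bar>ln c\<bar> + real k"] theta_le[OF mf c(1) c(2)]
      by (simp add: ef_def eg_def eps_star_def add_pos_nonneg)
  qed
  \<comment> \<open>The same comparison with h1 and h2 exchanged.\<close>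
  obtain K2 where K2: "K2 > 0" "\<And>n. eg n \<le> K2 * ef n"
  proof -
    obtain c k where c: "0 < c" "\<And>n. c * minRes (d2 * d1) (g n) ^ k \<le> minRes (d1 * d2) (f n)"
      using minRes_comp_commute[OF d(2,1)] deg mg unfolding f_def g_def by blast
    show thesis using that[of "1 + \<bar>ln c\<bar> + real k"] theta_le[OF mg c(1) c(2)]
      by (simp add: ef_def eg_def eps_star_def add_pos_nonneg)
  qed
  define K where "K = max K1 K2"
  have "\<exists>l>0. ((\<lambda>n. ef n / eg n) \<longlongrightarrow> l) \<omega>"
  proof (rule ultrafilter_bounded_convergent[OF assms(1)])
    show "0 < K" using K1 by (simp add: K_def)
    fix n
    have "K1 * eg n \<le> K * eg n" using eg[of n] by (intro mult_right_mono) (auto simp: K_def)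
    then have "ef n \<le> K * eg n" using K1(2)[of n] by linarith
    then show "ef n / eg n \<le> K" using eg[of n] by (simp add: pos_divide_le_eq)
    have "K2 * ef n \<le> K * ef n" using ef(1)[of n] by (intro mult_right_mono) (auto simp: K_def)
    then have "eg n \<le> K * ef n" using K2(2)[of n] by linarith
    then show "1 / K \<le> ef n / eg n" using eg[of n] \<open>0 < K\<close> by (simp add: field_simps)
  qed
  then have fg: "scale_eq \<omega> ef eg" by (auto simp: scale_eq_def)
  have "1 \<le> lim_deg \<omega> ef d1 h1 \<and> 1 \<le> lim_deg \<omega> ef d2 h2"
    if f: "scale_eq \<omega> (eps_scale (d1 * d2) f) ef" and g: "scale_eq \<omega> (eps_scale (d2 * d1) g) eg"
  proof -
    have \<omega>: "\<omega> \<noteq> bot" using assms(1) by (simp add: nonprincipal_ultrafilter_def)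
    have "scale_eq \<omega> (\<lambda>n. theta (normRes (d1 * d2) (f n))) ef"
      using f by (simp add: eps_scale_def[abs_def])
    from eventually_exp_le[OF this nf ef(1)] obtain A where
      A: "A > 0" "eventually (\<lambda>n. exp (- A / ef n) \<le> normRes (d1 * d2) (f n)) \<omega>" by blast
    \<comment> \<open>The hypothesis on g refers to its own fundamental scale; the first claim
      carries it over to the common scale \<open>ef\<close>, at which the limits are taken.\<close>
    have "scale_eq \<omega> (eps_scale (d2 * d1) g) ef"
      by (rule scale_eq_trans[OF g scale_eq_sym[OF fg] eg])
    then have "scale_eq \<omega> (\<lambda>n. theta (normRes (d2 * d1) (g n))) ef"
      by (simp add: eps_scale_def[abs_def])
    from eventually_exp_le[OF this ng ef(1)] obtain B where
      B: "B > 0" "eventually (\<lambda>n. exp (- B / ef n) \<le> normRes (d2 * d1) (g n)) \<omega>" by blast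
    define E where "E = max A B"
    have E: "exp (- E / ef n) \<le> exp (- A / ef n)" "exp (- E / ef n) \<le> exp (- B / ef n)" for n
      using ef(1)[of n] by (simp_all add: E_def divide_le_cancel)
    have evf: "eventually (\<lambda>n. exp (- E / ef n) \<le> normRes (d1 * d2) (f n)) \<omega>"
      using A(2) by eventually_elim (use E(1) order_trans in blast)
    have evg: "eventually (\<lambda>n. exp (- E / ef n) \<le> normRes (d2 * d1) (g n)) \<omega>"
      using B(2) by eventually_elim (use E(2) order_trans in blast)
    show ?thesis
      using lim_deg_pos_of_good_scale[OF \<omega> d(2,1) dd(3) h2 h1 ef evg[unfolded g_def] evf[unfolded f_def]]
        lim_deg_pos_of_good_scale[OF \<omega> d assms(2) h1 h2 ef evf[unfolded f_def] evg[unfolded g_def]]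
      by blast
  qed
  then show ?thesis using fg unfolding ef_def eg_def f_def g_def by blast
qed

end
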